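(* Fix $d\in\mathbb{N}$ and let $F_1,\dots,F_d$ be Rademacher functionals with $F_i\in\operatorname{dom}(D)$, $\mathbb{E}[F_i]=0$ and $\mathbb{E}\big[\|(pq)^{-1/4}DF_i\|_{\ell^4(\mathbb{N})}^4\big]<\infty$ for every $i=1,\dots,d$. Define $\mathbf{F}:=(F_1,\dots,F_d)$ and let $\mathbf{N}:=(N_1,\dots,N_d)$ be a centred Gaussian random vector with symmetric and positive semidefinite covariance matrix $\Sigma=(\Sigma_{ij})_{i,j=1}^d$. Further, let \begin{align*} A_1 &:= \frac12\sum_{i,j=1}^d \mathbb{E}\big[\big|\Sigma_{ij}-\langle DF_j,-DL^{-1}F_i\rangle_{\ell^2(\mathbb{N})}\big|\big],\\ A_2 &:= \frac14\,\mathbb{E}\Big[\Big\langle \frac{|p-q|}{\sqrt{pq}}\Big(\sum_{j=1}^d|DF_j|\Big)^2,\ \sum_{i=1}^d|-DL^{-1}F_i|\Big\rangle_{\ell^2(\mathbb{N})}\Big],\\ A_3 &:= \frac{5}{24}\,\mathbb{E}\Big[\Big\langle \frac{1}{pq}\Big(\sum_{j=1}^d|DF_j|\Big)^3,\ \sum_{i=1}^d|-DL^{-1}F_i|\Big\rangle_{\ell^2(\mathbb{N})}\Big]. \end{align*} Then $$d_4(\mathbf{F},\mathbf{N})\le A_1+A_2+A_3 .$$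
   Context: Rademacher setting. Let $p=(p_k)_{k\in\mathbb{N}}$ with $0<p_k<1$, $q=(q_k)_{k\in\mathbb{N}}$ with $q_k=1-p_k$. Let $\Omega=\{-1,+1\}^{\mathbb{N}}$ with the product $\sigma$-algebra and $P=\bigotimes_{k\ge1}(p_k\delta_{+1}+q_k\delta_{-1})$, and let $X=(X_k)_{k\in\mathbb{N}}$, $X_k(\omega)=\omega_k$ (a Rademacher sequence). A Rademacher functional is a real random variable $F=F(X)$ on this space. Put $Y_k=(2\sqrt{p_kq_k})^{-1}(X_k-p_k+q_k)$. Chaos decomposition. For $n\ge1$ let $\ell_0^2(\mathbb{N})^{\circ n}$ be the set of symmetric square-summable functions $f:\mathbb{N}^n\to\mathbb{R}$ vanishing whenever two arguments coincide, and put $J_n(f)=\sum_{(i_1,\dots,i_n)\in\mathbb{N}^n}f(i_1,\dots,i_n)Y_{i_1}\cdots Y_{i_n}$. Every $F\in L^2(\Omega)$ can be written uniquely as $F=\mathbb{E}[F]+\sum_{n\ge1}J_n(f_n)$ with $f_n\in\ell_0^2(\mathbb{N})^{\circ n}$. Discrete Malliavin operators. For $\omega\in\Omega$, $k\in\mathbb{N}$, let $\omega^k_\pm$ be $\omega$ with its $k$-th coordinate replaced by $\pm1$, and $F_k^\pm(\omega)=F(\omega_\pm^k)$. The discrete Malliavin derivative is $DF=(D_kF)_{k\in\mathbb{N}}$, $D_kF=\sqrt{p_kq_k}\,(F_k^+-F_k^-)$. For $F\in L^2(\Omega)$ with chaos kernels $f_n$, $F\in\operatorname{dom}(D)$ means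 $\sum_{n\ge1}n\,n!\,\|f_n\|^2_{\ell^2(\mathbb{N}^n)}<\infty$ (equivalently $\mathbb{E}[\|DF\|_{\ell^2(\mathbb{N})}^2]<\infty$). For centred $F\in L^2(\Omega)$, $L^{-1}F=-\sum_{n\ge1}\frac1nJ_n(f_n)$, and $-DL^{-1}F=(-D_kL^{-1}F)_{k\in\mathbb{N}}$. Conventions. Operations on sequences indexed by $k\in\mathbb{N}$ (products, powers, absolute values, quotients such as $|p-q|/\sqrt{pq}$) are componentwise, and $\langle a,b\rangle_{\ell^2(\mathbb{N})}=\sum_k a_kb_k$. Distance. For a function $g:\mathbb{R}^d\to\mathbb{R}$ put $M_k(g)=\max_{1\le i_1,\dots,i_k\le d}\big\|\frac{\partial^k g}{\partial x_{i_1}\cdots\partial x_{i_k}}\big\|_\infty$ (supremum norm). For $\mathbb{R}^d$-valued random vectors $\mathbf{X},\mathbf{Y}$, $d_4(\mathbf{X},\mathbf{Y})=\sup_g|\mathbb{E}[g(\mathbf{X})]-\mathbb{E}[g(\mathbf{Y})]|$, where the supremum runs over all four times partially differentiable $g:\mathbb{R}^d\to\mathbb{R}$ with bounded partial derivatives satisfying $M_1(g),M_2(g),M_3(g),M_4(g)\le1$. *)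

theory Defs
  imports "HOL-Probability.Probability"
begin

text \<open>The coordinates are indexed by \<open>nat\<close>, starting at 0.  The failure probabilities \<open>q k\<close>
  are written out as \<open>1 - p k\<close>.  The space of the measure below consists of all functions from
  \<open>nat\<close> to the reals with values in \<open>{-1, 1}\<close>.\<close>

definition rademacher :: "(nat \<Rightarrow> real) \<Rightarrow> (nat \<Rightarrow> real) measure" where
  "rademacher p =
     (\<Pi>\<^sub>M k\<in>UNIV. point_measure {-1, 1} (\<lambda>x. ennreal (if x = 1 then p k else 1 - p k)))"

definition Y :: "(nat \<Rightarrow> real) \<Rightarrow> nat \<Rightarrow> (nat \<Rightarrow> real) \<Rightarrow> real" where
  "Y p k \<omega> = (\<omega> k - p k + (1 - p k)) / (2 * sqrt (p k * (1 - p k)))"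

definition square_integrable :: "'a measure \<Rightarrow> ('a \<Rightarrow> real) \<Rightarrow> bool" where
  "square_integrable M F \<longleftrightarrow> F \<in> borel_measurable M \<and> integrable M (\<lambda>\<omega>. (F \<omega>)\<^sup>2)"

definition L2_tendsto ::
    "'a measure \<Rightarrow> ('i \<Rightarrow> 'a \<Rightarrow> real) \<Rightarrow> ('a \<Rightarrow> real) \<Rightarrow> 'i filter \<Rightarrow> bool" where
  "L2_tendsto M g G \<F> \<longleftrightarrow> square_integrable M G \<and>
     ((\<lambda>i. \<integral>\<^sup>+ \<omega>. ennreal ((g i \<omega> - G \<omega>)\<^sup>2) \<partial>M) \<longlongrightarrow> 0) \<F>"

text \<open>A version of the limit; limits in \<open>L\<^sup>2\<close> are unique up to null sets only.\<close>

definition L2_lim :: "'a measure \<Rightarrow> ('i \<Rightarrow> 'a \<Rightarrow> real) \<Rightarrow> 'i filter \<Rightarrow> 'a \<Rightarrow> real" where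
  "L2_lim M g \<F> = (SOME G. L2_tendsto M g G \<F>)"

text \<open>An \<open>n\<close>-tuple of indices is a list of length \<open>n\<close>; the values of a kernel of order \<open>n\<close> at
  lists of any other length are irrelevant.\<close>

definition chaos_kernel :: "nat \<Rightarrow> (nat list \<Rightarrow> real) \<Rightarrow> bool" where
  "chaos_kernel n f \<longleftrightarrow>
     (\<forall>xs ys. length xs = n \<longrightarrow> mset xs = mset ys \<longrightarrow> f xs = f ys) \<and>
     (\<forall>xs. length xs = n \<longrightarrow> \<not> distinct xs \<longrightarrow> f xs = 0) \<and>
     (\<lambda>xs. (f xs)\<^sup>2) summable_on {xs. length xs = n}"

text \<open>The multiple series converges unconditionally in \<open>L\<^sup>2\<close>, i.e. along the net of finite
  sets of index tuples.\<close>

definition J :: "(nat \<Rightarrow> real) \<Rightarrow> nat \<Rightarrow> (nat list \<Rightarrow> real) \<Rightarrow> (nat \<Rightarrow> real) \<Rightarrow> real" where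
  "J p n f = L2_lim (rademacher p)
     (\<lambda>S \<omega>. \<Sum>xs\<in>S. f xs * (\<Prod>i\<leftarrow>xs. Y p i \<omega>))
     (finite_subsets_at_top {xs. length xs = n})"

text \<open>Only the kernels \<open>f n\<close> with \<open>n \<ge> 1\<close> matter.\<close>

definition has_chaos_kernels ::
    "(nat \<Rightarrow> real) \<Rightarrow> ((nat \<Rightarrow> real) \<Rightarrow> real) \<Rightarrow> (nat \<Rightarrow> nat list \<Rightarrow> real) \<Rightarrow> bool" where
  "has_chaos_kernels p F f \<longleftrightarrow> (\<forall>n\<ge>1. chaos_kernel n (f n)) \<and>
     L2_tendsto (rademacher p)
       (\<lambda>m \<omega>. (\<integral>\<omega>'. F \<omega>' \<partial>rademacher p) + (\<Sum>n=1..m. J p n (f n) \<omega>)) F sequentially"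

definition D :: "(nat \<Rightarrow> real) \<Rightarrow> nat \<Rightarrow> ((nat \<Rightarrow> real) \<Rightarrow> real) \<Rightarrow> (nat \<Rightarrow> real) \<Rightarrow> real" where
  "D p k F \<omega> = sqrt (p k * (1 - p k)) * (F (fun_upd \<omega> k 1) - F (fun_upd \<omega> k (-1)))"

definition dom_D :: "(nat \<Rightarrow> real) \<Rightarrow> ((nat \<Rightarrow> real) \<Rightarrow> real) set" where
  "dom_D p = {F. square_integrable (rademacher p) F \<and>
     (\<exists>f. has_chaos_kernels p F f \<and>
        summable (\<lambda>n. real n * fact n * (\<Sum>\<^sub>\<infinity>xs\<in>{xs. length xs = n}. (f n xs)\<^sup>2)))}"

text \<open>The pseudo-inverse is determined up to null sets only, as is each \<open>D\<close> of it: for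
  \<open>0 < p k < 1\<close>, replacing the \<open>k\<close>-th coordinate by \<open>1\<close> or by \<open>-1\<close> maps the measure to an
  absolutely continuous one.\<close>

definition L_inv :: "(nat \<Rightarrow> real) \<Rightarrow> ((nat \<Rightarrow> real) \<Rightarrow> real) \<Rightarrow> (nat \<Rightarrow> real) \<Rightarrow> real" where
  "L_inv p F = (let f = (SOME f. has_chaos_kernels p F f) in
     L2_lim (rademacher p) (\<lambda>m \<omega>. - (\<Sum>n=1..m. 1 / real n * J p n (f n) \<omega>)) sequentially)"

text \<open>The covariance matrix may be singular, so point masses count as Gaussian.\<close>

definition gaussian_var :: "'b measure \<Rightarrow> ('b \<Rightarrow> real) \<Rightarrow> bool" where
  "gaussian_var M Z \<longleftrightarrow>
     (\<exists>\<mu> \<sigma>. \<sigma> > 0 \<and> distributed M lborel Z (normal_density \<mu> \<sigma>)) \<or>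
     (Z \<in> borel_measurable M \<and> (\<exists>\<mu>. AE x in M. Z x = \<mu>))"

definition centred_gaussian_vector ::
    "'b measure \<Rightarrow> ('b \<Rightarrow> real ^ 'd) \<Rightarrow> real ^ 'd ^ 'd \<Rightarrow> bool" where
  "centred_gaussian_vector M N S \<longleftrightarrow>
     N \<in> borel_measurable M \<and> (\<forall>u. gaussian_var M (\<lambda>x. u \<bullet> N x)) \<and>
     (\<forall>i. (\<integral>x. N x $ i \<partial>M) = 0) \<and>
     (\<forall>i j. (\<integral>x. N x $ i * N x $ j \<partial>M) = S $ i $ j)"

definition partial_deriv :: "'d::finite \<Rightarrow> (real ^ 'd \<Rightarrow> real) \<Rightarrow> real ^ 'd \<Rightarrow> real" where
  "partial_deriv i g x = deriv (\<lambda>t. g (x + t *\<^sub>R axis i 1)) 0"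

abbreviation iter_partial :: "'d::finite list \<Rightarrow> (real ^ 'd \<Rightarrow> real) \<Rightarrow> real ^ 'd \<Rightarrow> real" where
  "iter_partial is g \<equiv> foldr partial_deriv is g"

definition partially_differentiable :: "nat \<Rightarrow> (real ^ 'd::finite \<Rightarrow> real) \<Rightarrow> bool" where
  "partially_differentiable m g \<longleftrightarrow>
     (\<forall>is i x. length is < m \<longrightarrow>
        (\<lambda>t. iter_partial is g (x + t *\<^sub>R axis i 1)) field_differentiable at (0::real))"

definition M_sup :: "nat \<Rightarrow> (real ^ 'd::finite \<Rightarrow> real) \<Rightarrow> ennreal" where
  "M_sup k g = (SUP is\<in>{is. length is = k}. SUP x. ennreal \<bar>iter_partial is g x\<bar>)"

definition d4_test :: "(real ^ 'd::finite \<Rightarrow> real) set" where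
  "d4_test = {g. partially_differentiable 4 g \<and>
     (\<forall>is. length is \<in> {1..4} \<longrightarrow> bounded (range (iter_partial is g))) \<and>
     (\<forall>k\<in>{1..4}. M_sup k g \<le> 1)}"

definition d4 :: "'a measure \<Rightarrow> ('a \<Rightarrow> real ^ 'd::finite) \<Rightarrow> 'b measure \<Rightarrow> ('b \<Rightarrow> real ^ 'd) \<Rightarrow> ennreal"
  where "d4 M U M' V =
    (SUP g\<in>d4_test. ennreal \<bar>(\<integral>x. g (U x) \<partial>M) - (\<integral>y. g (V y) \<partial>M')\<bar>)"

end

(*
  Along the smart path h(t) = E g(sin t F + cos t N), with N independent of F, the derivative
  h'(t) splits into an F-part and an N-part.  For the F-part, Malliavin integration by parts
  E[F_i G] = E <DG, -D L^-1 F_i> is applied to G = (d_i g)(sin t F + const); expanding D_k G along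
  the segment between the two values of F at X_k = -1 and X_k = +1, and averaging over X_k, gives
  the second-order term plus errors controlled by A2 and A3.  For the N-part, Gaussian
  integration by parts gives the same second-order term with Sigma in place of <DF, -D L^-1 F>.
  Hence |h'(t)| <= 2 sin t cos t (A1 + A2 + A3) on [0, pi/2].

  The chaos decomposition only enters through approximation in L^2 by finite Walsh sums
  sum_A c(A) prod_{k in A} Y_k: there L^-1 divides c(A) by - card A, and the gradient bounds are
  orthonormality.  Uniqueness of the kernels is never needed: the kernels witnessing that F is in
  dom D may differ from those chosen in L^-1.
*)
theory Submission
  imports Defs
begin

section \<open>Square-integrable functions\<close>

text \<open>Two obstacles shape the details. First, the chaos kernels of G = (d_i g)(s F + a) are
  out of reach. Integration by parts is therefore proved for every square-integrable G whose
  gradient, computed from its values by \<open>D\<close>, has finite total energy; the Lipschitz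
  bound on d_i g supplies that. Second, the covariance matrix may be singular, so N need not have a
  density and is known only through its one-dimensional projections. Gaussian integration by parts
  is therefore drawn from rotation invariance of (N, N'), which rests on the fact that
  characteristic functions determine expectations. The coefficients sin t and cos t keep the path
  smooth up to both endpoints, and 2 sin t cos t integrates to 1. Splitting off this 2 yields the
  1/2 of \<open>A1\<close>, turns the coefficient 1/2 of |p - q| into 1/4, and turns the constant
  5/12 = 1/6 + 1/4 of the trapezoidal rule into 5/24. All three bounds live in
  \<open>ennreal\<close>, so an infinite bound is trivial and the remainders need no
  integrability.\<close>

abbreviation L2sq :: "'a measure \<Rightarrow> ('a \<Rightarrow> real) \<Rightarrow> ennreal" where
  "L2sq M f \<equiv> \<integral>\<^sup>+ \<omega>. ennreal ((f \<omega>)\<^sup>2) \<partial>M"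

lemma square_integrable_iff_L2sq:
  "square_integrable M f \<longleftrightarrow> f \<in> borel_measurable M \<and> L2sq M f < \<infinity>"
  unfolding square_integrable_def by (auto simp: integrable_iff_bounded)

lemma square_integrable_measurable[measurable_dest]:
  "square_integrable M f \<Longrightarrow> f \<in> borel_measurable M"
  by (simp add: square_integrable_def)

lemma L2sq_eq_integral:
  "square_integrable M f \<Longrightarrow> L2sq M f = ennreal (\<integral>\<omega>. (f \<omega>)\<^sup>2 \<partial>M)"
  by (simp add: square_integrable_def nn_integral_eq_integral)

lemma square_add_le: "((a::real) + b)\<^sup>2 \<le> 2 * a\<^sup>2 + 2 * b\<^sup>2"
  using sum_squares_bound[of a b] by (simp add: power2_sum)

lemma square_diff_le: "((a::real) - b)\<^sup>2 \<le> 2 * a\<^sup>2 + 2 * b\<^sup>2"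
  using square_add_le[of a "-b"] by simp

text \<open>The factor 2 from (a + b)^2 <= 2 a^2 + 2 b^2 replaces Minkowski's inequality and its
  square roots; only finiteness and smallness are ever drawn from it.\<close>

lemma L2sq_add_le:
  assumes [measurable]: "f \<in> borel_measurable M" "g \<in> borel_measurable M"
  shows "L2sq M (\<lambda>\<omega>. f \<omega> + g \<omega>) \<le> 2 * L2sq M f + 2 * L2sq M g"
proof -
  have "L2sq M (\<lambda>\<omega>. f \<omega> + g \<omega>) \<le> (\<integral>\<^sup>+\<omega>. 2 * ennreal ((f \<omega>)\<^sup>2) + 2 * ennreal ((g \<omega>)\<^sup>2) \<partial>M)"
  proof (rule nn_integral_mono)
    fix \<omega>
    have "ennreal ((f \<omega> + g \<omega>)\<^sup>2) \<le> ennreal (2 * (f \<omega>)\<^sup>2 + 2 * (g \<omega>)\<^sup>2)"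
      by (intro ennreal_leI square_add_le)
    then show "ennreal ((f \<omega> + g \<omega>)\<^sup>2) \<le> 2 * ennreal ((f \<omega>)\<^sup>2) + 2 * ennreal ((g \<omega>)\<^sup>2)"
      by (simp add: ennreal_plus ennreal_mult)
  qed
  also have "\<dots> = 2 * L2sq M f + 2 * L2sq M g"
    by (simp add: nn_integral_add nn_integral_cmult)
  finally show ?thesis .
qed

lemma L2sq_diff_le:
  assumes [measurable]: "f \<in> borel_measurable M" "g \<in> borel_measurable M"
  shows "L2sq M (\<lambda>\<omega>. f \<omega> - g \<omega>) \<le> 2 * L2sq M f + 2 * L2sq M g"
  using L2sq_add_le[of f M "\<lambda>\<omega>. - g \<omega>"] by simp

lemma L2sq_triangle:
  assumes [measurable]: "f \<in> borel_measurable M" "g \<in> borel_measurable M" "h \<in> borel_measurable M"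
  shows "L2sq M (\<lambda>\<omega>. f \<omega> - h \<omega>)
    \<le> 2 * L2sq M (\<lambda>\<omega>. f \<omega> - g \<omega>) + 2 * L2sq M (\<lambda>\<omega>. g \<omega> - h \<omega>)"
  using L2sq_add_le[of "\<lambda>\<omega>. f \<omega> - g \<omega>" M "\<lambda>\<omega>. g \<omega> - h \<omega>"] by simp

lemma L2sq_diff_commute: "L2sq M (\<lambda>\<omega>. f \<omega> - g \<omega>) = L2sq M (\<lambda>\<omega>. g \<omega> - f \<omega>)"
  by (simp add: power2_commute)

lemma L2sq_cmult:
  assumes [measurable]: "f \<in> borel_measurable M"
  shows "L2sq M (\<lambda>\<omega>. c * f \<omega>) = ennreal (c\<^sup>2) * L2sq M f"
  by (simp add: power_mult_distrib ennreal_mult nn_integral_cmult)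

lemma square_integrable_add[intro]:
  assumes "square_integrable M f" "square_integrable M g"
  shows "square_integrable M (\<lambda>\<omega>. f \<omega> + g \<omega>)"
  using assms L2sq_add_le[of f M g]
  by (auto simp: square_integrable_iff_L2sq ennreal_mult_less_top intro: le_less_trans)

lemma square_integrable_cmult[intro]:
  assumes "square_integrable M f"
  shows "square_integrable M (\<lambda>\<omega>. c * f \<omega>)"
  using assms by (auto simp: square_integrable_iff_L2sq L2sq_cmult ennreal_mult_less_top)

lemma square_integrable_uminus[intro]:
  assumes "square_integrable M f"
  shows "square_integrable M (\<lambda>\<omega>. - f \<omega>)"
  using square_integrable_cmult[OF assms, of "-1"] by simp

lemma square_integrable_diff[intro]:
  assumes "square_integrable M f" "square_integrable M g"
  shows "square_integrable M (\<lambda>\<omega>. f \<omega> - g \<omega>)"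
  using square_integrable_add[OF assms(1) square_integrable_uminus[OF assms(2)]] by simp

lemma square_integrable_zero[simp]: "square_integrable M (\<lambda>\<omega>. 0)"
  by (simp add: square_integrable_def)

lemma square_integrable_sum[intro]:
  "(\<And>i. i \<in> I \<Longrightarrow> square_integrable M (f i)) \<Longrightarrow> square_integrable M (\<lambda>\<omega>. \<Sum>i\<in>I. f i \<omega>)"
  by (induction I rule: infinite_finite_induct) auto

lemma (in finite_measure) square_integrable_bounded:
  assumes "f \<in> borel_measurable M" "\<And>x. x \<in> space M \<Longrightarrow> \<bar>f x\<bar> \<le> B"
  shows "square_integrable M f"
proof -
  have "\<bar>f x\<bar>\<^sup>2 \<le> B\<^sup>2" if "x \<in> space M" for x
    using assms(2)[OF that] by (intro power_mono) auto
  then have "integrable M (\<lambda>x. (f x)\<^sup>2)"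
    using assms(1) by (intro integrable_const_bound[where B="B\<^sup>2"] AE_I2) auto
  then show ?thesis using assms by (simp add: square_integrable_def)
qed

lemma square_integrable_mono:
  assumes "square_integrable M f" and [measurable]: "g \<in> borel_measurable M"
    and "\<And>x. x \<in> space M \<Longrightarrow> \<bar>g x\<bar> \<le> \<bar>f x\<bar>"
  shows "square_integrable M g"
proof -
  have "L2sq M g \<le> L2sq M f"
    using assms(3) by (intro nn_integral_mono ennreal_leI) (simp add: abs_le_square_iff)
  then show ?thesis using assms by (auto simp: square_integrable_iff_L2sq intro: le_less_trans)
qed

lemma square_integrable_abs[intro]:
  "square_integrable M f \<Longrightarrow> square_integrable M (\<lambda>x. \<bar>f x\<bar>)"
  by (auto simp: square_integrable_def)

lemma integrable_mult_square_integrable: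
  assumes "square_integrable M f" "square_integrable M g"
  shows "integrable M (\<lambda>\<omega>. f \<omega> * g \<omega>)"
proof (rule Bochner_Integration.integrable_bound)
  show "integrable M (\<lambda>\<omega>. (f \<omega>)\<^sup>2 + (g \<omega>)\<^sup>2)"
    using assms by (simp add: square_integrable_def)
  show "(\<lambda>\<omega>. f \<omega> * g \<omega>) \<in> borel_measurable M"
    using assms by (auto simp: square_integrable_def)
  have "\<bar>f x * g x\<bar> \<le> (f x)\<^sup>2 + (g x)\<^sup>2" for x
    using sum_squares_bound[of "\<bar>f x\<bar>" "\<bar>g x\<bar>"] mult_nonneg_nonneg[of "\<bar>f x\<bar>" "\<bar>g x\<bar>"]
    by (simp add: abs_mult del: mult_nonneg_nonneg zero_le_mult_iff)
  then show "AE x in M. norm (f x * g x) \<le> norm ((f x)\<^sup>2 + (g x)\<^sup>2)"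
    by (intro AE_I2) simp
qed

lemma (in finite_measure) square_integrable_const[simp]: "square_integrable M (\<lambda>x. c)"
  by (simp add: square_integrable_def)

lemma (in finite_measure) square_integrable_imp_integrable:
  assumes "square_integrable M f"
  shows "integrable M f"
  using integrable_mult_square_integrable[OF assms square_integrable_const[of 1]] by simp

text \<open>A weighted form of 2ab <= a^2 + b^2 in place of Cauchy-Schwarz. It is linear in both
  squared norms, so it can be summed over coordinates term by term, and the free weight
  \<open>r\<close> is tuned afterwards.\<close>

lemma abs_integral_mult_le:
  assumes f: "square_integrable M f" and g: "square_integrable M g" and "0 < r"
  shows "\<bar>\<integral>\<omega>. f \<omega> * g \<omega> \<partial>M\<bar> \<le> r * (\<integral>\<omega>. (f \<omega>)\<^sup>2 \<partial>M) + (\<integral>\<omega>. (g \<omega>)\<^sup>2 \<partial>M) / r"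
proof -
  have *: "\<bar>a * b\<bar> \<le> r * a\<^sup>2 + b\<^sup>2 / r" for a b :: real
  proof -
    have "2 * (sqrt r * \<bar>a\<bar>) * (\<bar>b\<bar> / sqrt r) \<le> (sqrt r * \<bar>a\<bar>)\<^sup>2 + (\<bar>b\<bar> / sqrt r)\<^sup>2"
      by (rule sum_squares_bound)
    then have "2 * \<bar>a * b\<bar> \<le> r * a\<^sup>2 + b\<^sup>2 / r"
      using \<open>0 < r\<close> by (simp add: power_mult_distrib power_divide abs_mult)
    then show ?thesis by simp
  qed
  have "\<bar>\<integral>\<omega>. f \<omega> * g \<omega> \<partial>M\<bar> \<le> (\<integral>\<omega>. \<bar>f \<omega> * g \<omega>\<bar> \<partial>M)"
    by (rule integral_abs_bound)
  also have "\<dots> \<le> (\<integral>\<omega>. r * (f \<omega>)\<^sup>2 + (g \<omega>)\<^sup>2 / r \<partial>M)"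
    using integrable_mult_square_integrable[OF f g] f g *
    by (intro integral_mono) (auto simp: square_integrable_def)
  also have "\<dots> = r * (\<integral>\<omega>. (f \<omega>)\<^sup>2 \<partial>M) + (\<integral>\<omega>. (g \<omega>)\<^sup>2 \<partial>M) / r"
    using f g by (simp add: square_integrable_def)
  finally show ?thesis .
qed

section \<open>Limits and completeness in the space of square-integrable functions\<close>

lemma L2_tendstoD:
  "L2_tendsto M g G \<F> \<Longrightarrow> square_integrable M G"
  "L2_tendsto M g G \<F> \<Longrightarrow> ((\<lambda>i. L2sq M (\<lambda>\<omega>. g i \<omega> - G \<omega>)) \<longlongrightarrow> 0) \<F>"
  by (simp_all add: L2_tendsto_def)

text \<open>Lets series of multiple integrals and their finite Walsh approximants stand in for one
  another.\<close>

lemma L2_tendsto_trans: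
  assumes g: "L2_tendsto M g G \<F>" and gm: "\<And>i. g i \<in> borel_measurable M"
    and hm: "\<And>i. h i \<in> borel_measurable M"
    and 0: "((\<lambda>i. L2sq M (\<lambda>\<omega>. h i \<omega> - g i \<omega>)) \<longlongrightarrow> 0) \<F>"
  shows "L2_tendsto M h G \<F>"
proof -
  have [measurable]: "G \<in> borel_measurable M" "g i \<in> borel_measurable M" "h i \<in> borel_measurable M" for i
    using gm hm L2_tendstoD(1)[OF g] by auto
  have "((\<lambda>i. 2 * L2sq M (\<lambda>\<omega>. h i \<omega> - g i \<omega>) + 2 * L2sq M (\<lambda>\<omega>. g i \<omega> - G \<omega>)) \<longlongrightarrow> 2 * 0 + 2 * 0) \<F>"
    by (intro tendsto_add ennreal_tendsto_cmult 0 L2_tendstoD(2)[OF g]) auto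
  then have "((\<lambda>i. 2 * L2sq M (\<lambda>\<omega>. h i \<omega> - g i \<omega>) + 2 * L2sq M (\<lambda>\<omega>. g i \<omega> - G \<omega>)) \<longlongrightarrow> 0) \<F>"
    by simp
  moreover have "eventually (\<lambda>i. L2sq M (\<lambda>\<omega>. h i \<omega> - G \<omega>)
        \<le> 2 * L2sq M (\<lambda>\<omega>. h i \<omega> - g i \<omega>) + 2 * L2sq M (\<lambda>\<omega>. g i \<omega> - G \<omega>)) \<F>"
    by (intro always_eventually allI L2sq_triangle) auto
  ultimately have "((\<lambda>i. L2sq M (\<lambda>\<omega>. h i \<omega> - G \<omega>)) \<longlongrightarrow> 0) \<F>"
    by - (rule tendsto_sandwich[where f="\<lambda>_. 0"], simp_all)
  then show ?thesis using g by (simp add: L2_tendsto_def)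
qed

lemma two_add_two_ennreal:
  "0 \<le> x \<Longrightarrow> 2 * ennreal x + 2 * ennreal x = ennreal (2 * x + 2 * x)"
  by (metis distrib_left_numeral ennreal_mult ennreal_numeral ennreal_plus zero_le_numeral add_nonneg_nonneg)

text \<open>Riesz-Fischer: a rapidly convergent subsequence converges almost everywhere, and Fatou's
  lemma along it bounds the distance of every later term to the limit.\<close>

lemma L2_Cauchy_convergent:
  assumes X: "\<And>n. square_integrable M (X n)"
    and C: "\<And>e. 0 < e \<Longrightarrow> \<exists>N. \<forall>m\<ge>N. \<forall>n\<ge>N. L2sq M (\<lambda>\<omega>. X m \<omega> - X n \<omega>) \<le> ennreal e"
  shows "\<exists>G. L2_tendsto M X G sequentially"
proof -
  have [measurable]: "X n \<in> borel_measurable M" for n using X by auto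
  \<comment> \<open>The rate 4^-j survives multiplication by 2^j, and that extra weight gives
    geometric decay of the increments pointwise.\<close>
  have "\<exists>N. \<forall>m\<ge>N. \<forall>n\<ge>N. L2sq M (\<lambda>\<omega>. X m \<omega> - X n \<omega>) \<le> ennreal (1 / 4 ^ j)" for j :: nat
    by (rule C) simp
  then obtain N where N: "\<And>j m n. m \<ge> N j \<Longrightarrow> n \<ge> N j \<Longrightarrow>
      L2sq M (\<lambda>\<omega>. X m \<omega> - X n \<omega>) \<le> ennreal (1 / 4 ^ j)" by metis
  \<comment> \<open>The running maximum makes the chosen indices monotone.\<close>
  define r where "r j = (MAX i\<in>{..j}. N i)" for j
  have rN: "N j \<le> r j" for j by (auto simp: r_def)
  have rmono: "r i \<le> r j" if "i \<le> j" for i j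
    unfolding r_def using that by (intro Max_mono) auto
  have d: "L2sq M (\<lambda>\<omega>. X m \<omega> - X (r k) \<omega>) \<le> ennreal (1 / 4 ^ j)" if "m \<ge> r j" "k \<ge> j" for j m k
    using that rmono[of j k] rN[of j] by (intro N) auto
  have "(\<integral>\<^sup>+\<omega>. (\<Sum>j. ennreal (2 ^ j * (X (r (Suc j)) \<omega> - X (r j) \<omega>)\<^sup>2)) \<partial>M)
      = (\<Sum>j. ennreal (2 ^ j) * L2sq M (\<lambda>\<omega>. X (r (Suc j)) \<omega> - X (r j) \<omega>))"
    by (simp add: nn_integral_suminf nn_integral_cmult ennreal_mult)
  also have "\<dots> \<le> (\<Sum>j. ennreal (2 ^ j) * ennreal (1 / 4 ^ j))"
    by (intro suminf_le mult_left_mono d) (auto simp: rmono)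
  also have "\<dots> = (\<Sum>j. ennreal ((1/2) ^ j))"
  proof (intro arg_cong[where f=suminf] ext)
    fix j :: nat
    have "(4::real) ^ j = 2 ^ j * 2 ^ j" by (metis mult_2 numeral_Bit0 power_mult_distrib)
    then show "ennreal (2 ^ j) * ennreal (1 / 4 ^ j) = ennreal ((1/2) ^ j)"
      by (simp add: power_one_over ennreal_mult[symmetric])
  qed
  also have "\<dots> < \<infinity>"
    by (simp add: suminf_ennreal2 summable_geometric)
  finally have fin: "(\<integral>\<^sup>+\<omega>. (\<Sum>j. ennreal (2 ^ j * (X (r (Suc j)) \<omega> - X (r j) \<omega>)\<^sup>2)) \<partial>M) < \<infinity>" .
  have "AE \<omega> in M. (\<Sum>j. ennreal (2 ^ j * (X (r (Suc j)) \<omega> - X (r j) \<omega>)\<^sup>2)) \<noteq> \<infinity>"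
    by (rule nn_integral_noteq_infinite) (measurable, use fin in \<open>simp add: less_top\<close>)
  then have conv: "AE \<omega> in M. convergent (\<lambda>j. X (r j) \<omega>)"
  proof eventually_elim
    case (elim \<omega>)
    define dd where "dd j = X (r (Suc j)) \<omega> - X (r j) \<omega>" for j
    define K where "K = enn2real (\<Sum>j. ennreal (2 ^ j * (dd j)\<^sup>2))"
    have b: "2 ^ j * (dd j)\<^sup>2 \<le> K" for j
    proof -
      have "ennreal (2 ^ j * (dd j)\<^sup>2) \<le> (\<Sum>j. ennreal (2 ^ j * (dd j)\<^sup>2))"
        using sum_le_suminf[OF summableI, of "{j}" "\<lambda>j. ennreal (2 ^ j * (dd j)\<^sup>2)"]
        by (simp only: sum.insert finite.emptyI empty_iff not_False_eq_True sum.empty add_0_right finite.insertI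
              zero_le simp_thms)
      also have "\<dots> = ennreal K" using elim by (simp add: K_def dd_def less_top)
      finally show ?thesis by (simp add: K_def)
    qed
    have K0: "0 \<le> K" by (simp add: K_def)
    have "\<bar>dd j\<bar> \<le> sqrt K * (1 / sqrt 2) ^ j" for j
    proof -
      have "(dd j)\<^sup>2 \<le> K / 2 ^ j" using b[of j] by (simp add: field_simps)
      then have "\<bar>dd j\<bar> \<le> sqrt (K / 2 ^ j)" by (simp add: real_le_rsqrt)
      then show ?thesis by (simp add: real_sqrt_divide real_sqrt_power power_one_over)
    qed
    then have "summable dd"
      by (intro summable_comparison_test'[OF summable_mult[OF summable_geometric]]) auto
    then have "convergent (\<lambda>n. \<Sum>j<n. dd j)" by (simp add: summable_iff_convergent)
    then have "convergent (\<lambda>n. (\<Sum>j<n. dd j) + X (r 0) \<omega>)"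
      by (intro convergent_add convergent_const)
    moreover have "(\<Sum>j<n. dd j) + X (r 0) \<omega> = X (r n) \<omega>" for n
      by (induction n) (simp_all add: dd_def)
    ultimately show ?case by simp
  qed
  define G where "G \<omega> = lim (\<lambda>j. X (r j) \<omega>)" for \<omega>
  have [measurable]: "G \<in> borel_measurable M" unfolding G_def by measurable
  have G: "AE \<omega> in M. (\<lambda>j. X (r j) \<omega>) \<longlonglongrightarrow> G \<omega>"
    using conv by eventually_elim (simp add: G_def convergent_LIMSEQ_iff)
  have bound: "L2sq M (\<lambda>\<omega>. X m \<omega> - G \<omega>) \<le> ennreal (1 / 4 ^ j)" if m: "m \<ge> r j" for m j
  proof -
    have "L2sq M (\<lambda>\<omega>. X m \<omega> - G \<omega>) = (\<integral>\<^sup>+\<omega>. liminf (\<lambda>k. ennreal ((X m \<omega> - X (r k) \<omega>)\<^sup>2)) \<partial>M)"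
    proof (rule nn_integral_cong_AE, use G in eventually_elim)
      case (elim \<omega>)
      have "(\<lambda>k. ennreal ((X m \<omega> - X (r k) \<omega>)\<^sup>2)) \<longlonglongrightarrow> ennreal ((X m \<omega> - G \<omega>)\<^sup>2)"
        by (intro tendsto_intros tendsto_ennrealI elim)
      then show ?case by (intro lim_imp_Liminf[symmetric]) auto
    qed
    also have "\<dots> \<le> liminf (\<lambda>k. L2sq M (\<lambda>\<omega>. X m \<omega> - X (r k) \<omega>))"
      by (rule nn_integral_liminf) auto
    also have "\<dots> \<le> ennreal (1 / 4 ^ j)"
    proof (rule order_trans[OF Liminf_le_Limsup])
      show "limsup (\<lambda>k. L2sq M (\<lambda>\<omega>. X m \<omega> - X (r k) \<omega>)) \<le> ennreal (1 / 4 ^ j)"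
        using d[OF m] by (intro Limsup_bounded) (auto simp: eventually_sequentially)
    qed auto
    finally show ?thesis .
  qed
  have "L2sq M G < \<infinity>"
  proof -
    have "L2sq M G = L2sq M (\<lambda>\<omega>. X (r 0) \<omega> - (X (r 0) \<omega> - G \<omega>))" by simp
    also have "\<dots> \<le> 2 * L2sq M (X (r 0)) + 2 * L2sq M (\<lambda>\<omega>. X (r 0) \<omega> - G \<omega>)"
      by (intro L2sq_diff_le) auto
    also have "\<dots> < \<infinity>"
      using X[of "r 0"] bound[of 0 "r 0"]
      by (auto simp: square_integrable_iff_L2sq ennreal_mult_less_top intro: le_less_trans)
    finally show ?thesis .
  qed
  then have Gs: "square_integrable M G" by (simp add: square_integrable_iff_L2sq)
  have "(\<lambda>m. L2sq M (\<lambda>\<omega>. X m \<omega> - G \<omega>)) \<longlonglongrightarrow> 0"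
  proof (rule order_tendstoI)
    fix a :: ennreal assume "0 < a"
    have "(\<lambda>j. ennreal ((1/4) ^ j)) \<longlonglongrightarrow> ennreal 0"
      by (intro tendsto_ennrealI LIMSEQ_realpow_zero) auto
    then have "eventually (\<lambda>j. ennreal ((1/4) ^ j) < a) sequentially"
      using \<open>0 < a\<close> by (intro order_tendstoD) auto
    then obtain j where j: "ennreal (1 / 4 ^ j) < a"
      by (auto simp: eventually_sequentially power_one_over)
    show "eventually (\<lambda>m. L2sq M (\<lambda>\<omega>. X m \<omega> - G \<omega>) < a) sequentially"
      using bound[of j] j by (auto simp: eventually_sequentially intro!: exI[of _ "r j"] intro: le_less_trans)
  qed auto
  with Gs show ?thesis by (auto simp: L2_tendsto_def)
qed

text \<open>Cauchy nets are reduced to Cauchy sequences by choosing increasing finite sets.\<close>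

lemma L2_Cauchy_net_convergent:
  assumes X: "\<And>T. square_integrable M (X T)"
    and C: "\<And>e. 0 < e \<Longrightarrow> \<exists>T0. finite T0 \<and> T0 \<subseteq> I \<and>
      (\<forall>T. finite T \<longrightarrow> T0 \<subseteq> T \<longrightarrow> T \<subseteq> I \<longrightarrow> L2sq M (\<lambda>\<omega>. X T \<omega> - X T0 \<omega>) \<le> ennreal e)"
  shows "\<exists>G. L2_tendsto M X G (finite_subsets_at_top I)"
proof -
  have [measurable]: "X n \<in> borel_measurable M" for n using X by auto
  have "\<exists>T0. finite T0 \<and> T0 \<subseteq> I \<and>
      (\<forall>T. finite T \<longrightarrow> T0 \<subseteq> T \<longrightarrow> T \<subseteq> I \<longrightarrow> L2sq M (\<lambda>\<omega>. X T \<omega> - X T0 \<omega>) \<le> ennreal (1 / Suc j))" for j :: nat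
    by (rule C) simp
  then obtain T0 where T0: "\<And>j. finite (T0 j)" "\<And>j. T0 j \<subseteq> I"
     "\<And>j T. finite T \<Longrightarrow> T0 j \<subseteq> T \<Longrightarrow> T \<subseteq> I \<Longrightarrow> L2sq M (\<lambda>\<omega>. X T \<omega> - X (T0 j) \<omega>) \<le> ennreal (1 / Suc j)"
    by metis
  \<comment> \<open>Unions make the sets increase, so \<open>R j\<close> lies beyond all thresholds
    up to j.\<close>
  define R where "R j = (\<Union>i\<le>j. T0 i)" for j
  have R: "finite (R j)" "R j \<subseteq> I" "i \<le> j \<Longrightarrow> T0 i \<subseteq> R j" for i j
    using T0(1,2) by (auto simp: R_def)
  have d: "L2sq M (\<lambda>\<omega>. X S \<omega> - X T \<omega>) \<le> ennreal (4 / Suc j)"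
    if "finite T" "T0 j \<subseteq> T" "T \<subseteq> I" "finite S" "T0 j \<subseteq> S" "S \<subseteq> I" for j S T
  proof -
    have "L2sq M (\<lambda>\<omega>. X S \<omega> - X T \<omega>)
        \<le> 2 * L2sq M (\<lambda>\<omega>. X S \<omega> - X (T0 j) \<omega>) + 2 * L2sq M (\<lambda>\<omega>. X (T0 j) \<omega> - X T \<omega>)"
      by (rule L2sq_triangle) auto
    also have "\<dots> \<le> 2 * ennreal (1 / Suc j) + 2 * ennreal (1 / Suc j)"
      using T0(3)[OF that(4,5,6)] T0(3)[OF that(1,2,3), unfolded L2sq_diff_commute[of M "X T"]]
      by (intro add_mono mult_left_mono) simp_all
    also have "\<dots> = ennreal (2 * (1 / Suc j) + 2 * (1 / Suc j))"
      by (rule two_add_two_ennreal) simp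
    finally show ?thesis by simp
  qed
  have arch: "\<exists>j. 4 / real (Suc j) < e" if "0 < e" for e
    using reals_Archimedean[of "e/4"] that by (auto simp: field_simps)
  have "\<exists>G. L2_tendsto M (\<lambda>j. X (R j)) G sequentially"
  proof (rule L2_Cauchy_convergent)
    fix e :: real assume "0 < e"
    from arch[OF this] obtain j where j: "4 / real (Suc j) < e" ..
    show "\<exists>N. \<forall>m\<ge>N. \<forall>n\<ge>N. L2sq M (\<lambda>\<omega>. X (R m) \<omega> - X (R n) \<omega>) \<le> ennreal e"
    proof (intro exI[of _ j] allI impI)
      fix m n assume "j \<le> m" "j \<le> n"
      then have "L2sq M (\<lambda>\<omega>. X (R m) \<omega> - X (R n) \<omega>) \<le> ennreal (4 / Suc j)"
        by (intro d R)
      also have "\<dots> \<le> ennreal e" using j by (intro ennreal_leI) simp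
      finally show "L2sq M (\<lambda>\<omega>. X (R m) \<omega> - X (R n) \<omega>) \<le> ennreal e" .
    qed
  qed (rule X)
  then obtain G where G: "L2_tendsto M (\<lambda>j. X (R j)) G sequentially" ..
  note [measurable] = square_integrable_measurable[OF L2_tendstoD(1)[OF G]]
  have "((\<lambda>T. L2sq M (\<lambda>\<omega>. X T \<omega> - G \<omega>)) \<longlongrightarrow> 0) (finite_subsets_at_top I)"
  proof (rule order_tendstoI)
    fix a :: ennreal assume "0 < a"
    then obtain e where e: "0 < e" "ennreal e < a"
      by (metis dense ennreal_cases ennreal_less_zero_iff order_less_le_trans top_greatest dual_order.strict_iff_not)
    from arch[of "e/4"] e obtain j where j: "4 / real (Suc j) < e/4" by auto
    have "eventually (\<lambda>i. L2sq M (\<lambda>\<omega>. X (R i) \<omega> - G \<omega>) < ennreal (e/4)) sequentially"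
      using L2_tendstoD(2)[OF G] e by (intro order_tendstoD) auto
    \<comment> \<open>The condition i >= j puts \<open>R i\<close> beyond the threshold
      \<open>T0 j\<close>, so every T beyond \<open>T0 j\<close> can be compared with it.\<close>
    then have "eventually (\<lambda>i. L2sq M (\<lambda>\<omega>. X (R i) \<omega> - G \<omega>) < ennreal (e/4) \<and> i \<ge> j) sequentially"
      using eventually_ge_at_top[of j] by eventually_elim simp
    then obtain i where i: "L2sq M (\<lambda>\<omega>. X (R i) \<omega> - G \<omega>) < ennreal (e/4)" "i \<ge> j"
      by (auto dest: eventually_happens)
    show "eventually (\<lambda>T. L2sq M (\<lambda>\<omega>. X T \<omega> - G \<omega>) < a) (finite_subsets_at_top I)"
      unfolding eventually_finite_subsets_at_top
    proof (intro exI[of _ "T0 j"] conjI T0 allI impI)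
      fix T assume T: "finite T \<and> T0 j \<subseteq> T \<and> T \<subseteq> I"
      have "L2sq M (\<lambda>\<omega>. X T \<omega> - G \<omega>)
        \<le> 2 * L2sq M (\<lambda>\<omega>. X T \<omega> - X (R i) \<omega>) + 2 * L2sq M (\<lambda>\<omega>. X (R i) \<omega> - G \<omega>)"
        by (rule L2sq_triangle) auto
      also have "\<dots> \<le> 2 * ennreal (e/4) + 2 * ennreal (e/4)"
      proof (intro add_mono mult_left_mono)
        have "L2sq M (\<lambda>\<omega>. X T \<omega> - X (R i) \<omega>) \<le> ennreal (4 / Suc j)"
          using T R i by (intro d) auto
        also have "\<dots> \<le> ennreal (e/4)" using j by (intro ennreal_leI) simp
        finally show "L2sq M (\<lambda>\<omega>. X T \<omega> - X (R i) \<omega>) \<le> ennreal (e/4)" .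
      qed (use i in auto)
      also have "\<dots> = ennreal (2 * (e/4) + 2 * (e/4))"
        using e by (intro two_add_two_ennreal) simp
      finally show "L2sq M (\<lambda>\<omega>. X T \<omega> - G \<omega>) < a" using e by simp
    qed
  qed auto
  then show ?thesis using L2_tendstoD(1)[OF G] by (auto simp: L2_tendsto_def)
qed

lemma L2_tendsto_integral_mult:
  assumes g: "L2_tendsto M g G \<F>" and gs: "\<And>i. square_integrable M (g i)" and H: "square_integrable M H"
  shows "((\<lambda>i. \<integral>\<omega>. g i \<omega> * H \<omega> \<partial>M) \<longlongrightarrow> (\<integral>\<omega>. G \<omega> * H \<omega> \<partial>M)) \<F>"
proof (rule tendstoI)
  fix e :: real assume "0 < e"
  note G = L2_tendstoD(1)[OF g]
  define K where "K = (\<integral>\<omega>. (H \<omega>)\<^sup>2 \<partial>M)"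
  have K: "0 \<le> K" by (simp add: K_def)
  \<comment> \<open>A large weight goes to the difference, which convergence makes small, and leaves
    less than e / 2 for the fixed factor H. Adding 1 keeps the weight positive when \<open>K\<close>
    is 0.\<close>
  define l where "l = 2 * (K + 1) / e"
  have l: "0 < l" using K \<open>0 < e\<close> by (simp add: l_def)
  have "eventually (\<lambda>i. L2sq M (\<lambda>\<omega>. g i \<omega> - G \<omega>) < ennreal (e / (2 * l))) \<F>"
    using L2_tendstoD(2)[OF g] l \<open>0 < e\<close> by (intro order_tendstoD) auto
  then show "eventually (\<lambda>i. dist (\<integral>\<omega>. g i \<omega> * H \<omega> \<partial>M) (\<integral>\<omega>. G \<omega> * H \<omega> \<partial>M) < e) \<F>"
  proof eventually_elim
    case (elim i)
    have d: "square_integrable M (\<lambda>\<omega>. g i \<omega> - G \<omega>)" using gs G by auto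
    have "(\<integral>\<omega>. (g i \<omega> - G \<omega>)\<^sup>2 \<partial>M) < e / (2 * l)"
      using elim by (simp add: L2sq_eq_integral[OF d] ennreal_less_iff)
    then have a: "l * (\<integral>\<omega>. (g i \<omega> - G \<omega>)\<^sup>2 \<partial>M) < e / 2"
      using l by (simp add: field_simps)
    have b: "K / l < e / 2" using \<open>0 < e\<close> K by (simp add: l_def field_simps)
    have "(\<integral>\<omega>. g i \<omega> * H \<omega> \<partial>M) - (\<integral>\<omega>. G \<omega> * H \<omega> \<partial>M) = (\<integral>\<omega>. (g i \<omega> - G \<omega>) * H \<omega> \<partial>M)"
      using integrable_mult_square_integrable[OF gs H] integrable_mult_square_integrable[OF G H]
      by (simp add: left_diff_distrib)
    then show ?case
      using abs_integral_mult_le[OF d H l] a b unfolding dist_real_def K_def by linarith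
  qed
qed

section \<open>Rademacher sequences and Walsh functions\<close>

locale rademacher_seq =
  fixes p :: "nat \<Rightarrow> real"
  assumes p_pos: "\<And>k. 0 < p k" and p_less: "\<And>k. p k < 1"
begin

abbreviation R :: "(nat \<Rightarrow> real) measure" where "R \<equiv> rademacher p"

abbreviation coord_measure :: "nat \<Rightarrow> real measure" where
  "coord_measure k \<equiv> point_measure {-1, 1} (\<lambda>x. ennreal (if x = 1 then p k else 1 - p k))"

lemma prob_space_coord: "prob_space (coord_measure k)"
proof
  show "emeasure (coord_measure k) (space (coord_measure k)) = 1"
    using p_pos[of k] p_less[of k]
    by (simp add: space_point_measure emeasure_point_measure_finite flip: ennreal_plus)
qed

sublocale prob_space R
  unfolding rademacher_def by (intro prob_space_PiM prob_space_coord)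

lemma space_R: "space R = {\<omega>. \<forall>k. \<omega> k \<in> {-1, 1}}"
  by (auto simp: rademacher_def space_PiM space_point_measure PiE_def Pi_def extensional_def)

lemma coord_measurable[measurable]: "(\<lambda>\<omega>. \<omega> k) \<in> borel_measurable R"
proof -
  have "(\<lambda>\<omega>. \<omega> k) \<in> measurable R (coord_measure k)"
    unfolding rademacher_def by measurable
  moreover have "(\<lambda>x. x) \<in> measurable (coord_measure k) borel"
    by simp
  ultimately show ?thesis by (rule measurable_compose)
qed

section \<open>Splitting off and resampling one coordinate\<close>

lemma upd_measurable[measurable]:
  assumes "c \<in> {-1, 1}"
  shows "(\<lambda>\<omega>. fun_upd \<omega> k c) \<in> measurable R R"
  unfolding rademacher_def
proof (rule measurable_PiM_single')
  fix i :: nat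
  have "(\<lambda>\<omega>. \<omega> i) \<in> measurable (Pi\<^sub>M UNIV coord_measure) (coord_measure i)"
    by measurable
  moreover have "(\<lambda>\<omega>. c) \<in> measurable (Pi\<^sub>M UNIV coord_measure) (coord_measure i)"
    using assms by (intro measurable_const) (auto simp: space_point_measure)
  ultimately show "(\<lambda>\<omega>. (fun_upd \<omega> k c) i) \<in> measurable (Pi\<^sub>M UNIV coord_measure) (coord_measure i)"
    by (cases "i = k") simp_all
qed (use assms in \<open>auto simp: space_PiM space_point_measure PiE_def Pi_def\<close>)

text \<open>Independence of coordinate k from the others, in the form in which Fubini's theorem
  applies.\<close>

lemma distr_upd:
  "distr (coord_measure k \<Otimes>\<^sub>M Pi\<^sub>M (- {k}) coord_measure) R (\<lambda>(x, X). fun_upd X k x) = R"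
proof -
  have "insert k (- {k}) = UNIV" by auto
  then show ?thesis
    using distr_pair_PiM_eq_PiM[of "- {k}" coord_measure k] prob_space_coord
    by (simp add: rademacher_def)
qed

lemma merge_measurable[measurable]:
  "(\<lambda>(x, X). fun_upd X k x) \<in> measurable (coord_measure k \<Otimes>\<^sub>M Pi\<^sub>M (- {k}) coord_measure) R"
proof -
  have "insert k (- {k}) = UNIV" by auto
  then have "(\<lambda>(x, X). fun_upd X k x) \<in> measurable (coord_measure k \<Otimes>\<^sub>M Pi\<^sub>M (- {k}) coord_measure)
      (Pi\<^sub>M (insert k (- {k})) coord_measure)"
    by measurable
  with \<open>insert k (- {k}) = UNIV\<close> show ?thesis by (simp add: rademacher_def)
qed

text \<open>Fubini's theorem after splitting off coordinate k, whose law has two atoms. This takes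
  the place of conditional expectation throughout.\<close>

lemma
  fixes \<phi> :: "(nat \<Rightarrow> real) \<Rightarrow> real"
  assumes \<phi>: "integrable R \<phi>" and c: "c \<in> {-1, 1}"
  shows integrable_upd: "integrable R (\<lambda>\<omega>. \<phi> (fun_upd \<omega> k c))" (is ?I)
    and resample_integral:
      "(\<integral>\<omega>. \<phi> \<omega> \<partial>R) = p k * (\<integral>\<omega>. \<phi> (fun_upd \<omega> k 1) \<partial>R) + (1 - p k) * (\<integral>\<omega>. \<phi> (fun_upd \<omega> k (-1)) \<partial>R)" (is ?E)
proof -
  let ?B = "coord_measure k" and ?P = "Pi\<^sub>M (- {k}) coord_measure"
  interpret B: prob_space ?B by (rule prob_space_coord)
  interpret P: prob_space ?P by (intro prob_space_PiM prob_space_coord)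
  interpret BP: pair_prob_space ?B ?P ..
  have [measurable]: "\<phi> \<in> borel_measurable R" using \<phi> by simp
  have int: "integrable (?B \<Otimes>\<^sub>M ?P) (\<lambda>(x, X). \<phi> (fun_upd X k x))"
    using integrable_distr[OF merge_measurable, of k \<phi>] \<phi> unfolding distr_upd by (simp add: split_beta')
  \<comment> \<open>Both atoms have positive mass, so what holds almost everywhere holds at each of
    them.\<close>
  have ix: "integrable ?P (\<lambda>X. \<phi> (fun_upd X k c))" if "c \<in> {-1, 1}" for c
    using BP.AE_integrable_fst'[OF int] p_pos[of k] p_less[of k] that
    by (auto simp: AE_point_measure)
  have ixBP: "integrable (?B \<Otimes>\<^sub>M ?P) (\<lambda>z. \<phi> (fun_upd (snd z) k c))" if "c \<in> {-1, 1}" for c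
  proof (rule BP.Fubini_integrable)
    have [measurable]: "(\<lambda>X. \<phi> (fun_upd X k c)) \<in> borel_measurable ?P"
      using ix[OF that] by simp
    show "(\<lambda>z. \<phi> (fun_upd (snd z) k c)) \<in> borel_measurable (?B \<Otimes>\<^sub>M ?P)"
      by measurable
  qed (use ix[OF that] in simp_all)
  have upd: "distr (?B \<Otimes>\<^sub>M ?P) R (\<lambda>(x, X). fun_upd X k x) = R" by (rule distr_upd)
  have iu: "integrable R (\<lambda>\<omega>. \<phi> (fun_upd \<omega> k c))"
    and eu: "(\<integral>\<omega>. \<phi> (fun_upd \<omega> k c) \<partial>R) = (\<integral>X. \<phi> (fun_upd X k c) \<partial>?P)" if c: "c \<in> {-1, 1}" for c
  proof -
    have [measurable]: "(\<lambda>\<omega>. \<phi> (fun_upd \<omega> k c)) \<in> borel_measurable R"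
      using measurable_compose[OF upd_measurable[OF c, of k], of \<phi> borel] by simp
    have "integrable (distr (?B \<Otimes>\<^sub>M ?P) R (\<lambda>(x, X). fun_upd X k x)) (\<lambda>\<omega>. \<phi> (fun_upd \<omega> k c))"
      using ixBP[OF c] by (subst integrable_distr_eq) (auto simp: split_beta')
    then show "integrable R (\<lambda>\<omega>. \<phi> (fun_upd \<omega> k c))" by (simp add: upd)
    have "(\<integral>\<omega>. \<phi> (fun_upd \<omega> k c) \<partial>R) = (\<integral>\<omega>. \<phi> (fun_upd \<omega> k c) \<partial>distr (?B \<Otimes>\<^sub>M ?P) R (\<lambda>(x, X). fun_upd X k x))"
      by (simp add: upd)
    also have "\<dots> = (\<integral>z. \<phi> (fun_upd (snd z) k c) \<partial>(?B \<Otimes>\<^sub>M ?P))"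
      by (subst integral_distr) (auto simp: split_beta')
    also have "\<dots> = (\<integral>x. (\<integral>X. \<phi> (fun_upd X k c) \<partial>?P) \<partial>?B)"
      using BP.integral_fst'[OF ixBP[OF c]] by simp
    also have "\<dots> = (\<integral>X. \<phi> (fun_upd X k c) \<partial>?P)" by (simp add: B.prob_space)
    finally show "(\<integral>\<omega>. \<phi> (fun_upd \<omega> k c) \<partial>R) = (\<integral>X. \<phi> (fun_upd X k c) \<partial>?P)" .
  qed
  show ?I by (rule iu[OF c])
  have "(\<integral>\<omega>. \<phi> \<omega> \<partial>R) = (\<integral>\<omega>. \<phi> \<omega> \<partial>distr (?B \<Otimes>\<^sub>M ?P) R (\<lambda>(x, X). fun_upd X k x))"
    by (simp add: upd)
  also have "\<dots> = (\<integral>(x, X). \<phi> (fun_upd X k x) \<partial>(?B \<Otimes>\<^sub>M ?P))"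
    by (subst integral_distr) (auto simp: split_beta')
  also have "\<dots> = (\<integral>x. (\<integral>X. \<phi> (fun_upd X k x) \<partial>?P) \<partial>?B)"
    using BP.integral_fst'[OF int] by simp
  also have "\<dots> = p k * (\<integral>X. \<phi> (fun_upd X k 1) \<partial>?P) + (1 - p k) * (\<integral>X. \<phi> (fun_upd X k (-1)) \<partial>?P)"
    using p_pos[of k] p_less[of k] by (subst lebesgue_integral_point_measure_finite) (auto simp: less_imp_le)
  finally show ?E by (simp add: eu)
qed

lemma square_integrable_upd:
  assumes "square_integrable R V" "c \<in> {-1, 1}"
  shows "square_integrable R (\<lambda>\<omega>. V (fun_upd \<omega> k c))"
  using assms integrable_upd[of "\<lambda>\<omega>. (V \<omega>)\<^sup>2" c k]
    measurable_compose[OF upd_measurable[OF assms(2), of k], of V borel]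
  by (simp add: square_integrable_def)

lemma D_upd[simp]: "D p k V (fun_upd \<omega> k c) = D p k V \<omega>"
  by (simp add: D_def)

lemma square_integrable_D[intro]:
  assumes "square_integrable R V"
  shows "square_integrable R (D p k V)"
  unfolding D_def by (intro square_integrable_cmult square_integrable_diff square_integrable_upd assms) auto

lemma pq_pos: "0 < p k * (1 - p k)"
  using p_pos[of k] p_less[of k] by simp

text \<open>Continuity of a single \<open>D p k\<close> in L^2, which lets gradients pass to limits.
  The factor p (1 - p) of the squared difference is at most p and at most 1 - p, the two weights of
  resampling.\<close>

lemma integral_D_square_le:
  assumes V: "square_integrable R V"
  shows "(\<integral>\<omega>. (D p k V \<omega>)\<^sup>2 \<partial>R) \<le> 2 * (\<integral>\<omega>. (V \<omega>)\<^sup>2 \<partial>R)"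
proof -
  let ?I = "\<lambda>c. \<integral>\<omega>. (V (fun_upd \<omega> k c))\<^sup>2 \<partial>R"
  have i: "integrable R (\<lambda>\<omega>. (V \<omega>)\<^sup>2)" using V by (simp add: square_integrable_def)
  note iu = integrable_upd[OF i]
  have "(\<integral>\<omega>. (D p k V \<omega>)\<^sup>2 \<partial>R)
     \<le> (\<integral>\<omega>. p k * (1 - p k) * (2 * (V (fun_upd \<omega> k 1))\<^sup>2 + 2 * (V (fun_upd \<omega> k (-1)))\<^sup>2) \<partial>R)"
  proof (rule integral_mono)
    show "integrable R (\<lambda>\<omega>. (D p k V \<omega>)\<^sup>2)"
      using square_integrable_D[OF V] by (simp add: square_integrable_def)
    show "integrable R (\<lambda>\<omega>. p k * (1 - p k) * (2 * (V (fun_upd \<omega> k 1))\<^sup>2 + 2 * (V (fun_upd \<omega> k (-1)))\<^sup>2))"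
      using iu[of 1 k] iu[of "-1" k] by simp
    show "(D p k V \<omega>)\<^sup>2 \<le> p k * (1 - p k) * (2 * (V (fun_upd \<omega> k 1))\<^sup>2 + 2 * (V (fun_upd \<omega> k (-1)))\<^sup>2)" for \<omega>
      using pq_pos[of k] square_diff_le unfolding D_def power_mult_distrib
      by (simp add: mult_left_mono)
  qed
  also have "\<dots> = p k * (1 - p k) * (2 * ?I 1 + 2 * ?I (-1))"
    using iu[of 1 k] iu[of "-1" k] by simp
  also have "\<dots> \<le> 2 * (p k * ?I 1 + (1 - p k) * ?I (-1))"
  proof -
    have "0 \<le> ?I 1" "0 \<le> ?I (-1)" by simp_all
    then have "p k * (1 - p k) * ?I 1 \<le> p k * ?I 1" "p k * (1 - p k) * ?I (-1) \<le> (1 - p k) * ?I (-1)"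
      using p_pos[of k] p_less[of k] by (auto simp: mult.assoc mult_left_le_one_le intro!: mult_left_mono)
    then show ?thesis by (simp add: algebra_simps)
  qed
  also have "\<dots> = 2 * (\<integral>\<omega>. (V \<omega>)\<^sup>2 \<partial>R)"
    using resample_integral[OF i, of 1 k] by simp
  finally show ?thesis .
qed

lemma L2sq_D_le:
  assumes V: "square_integrable R V"
  shows "L2sq R (D p k V) \<le> 2 * L2sq R V"
proof -
  have "L2sq R (D p k V) \<le> ennreal (2 * (\<integral>\<omega>. (V \<omega>)\<^sup>2 \<partial>R))"
    unfolding L2sq_eq_integral[OF square_integrable_D[OF V]]
    by (intro ennreal_leI integral_D_square_le V)
  also have "\<dots> = 2 * L2sq R V"
    by (simp add: L2sq_eq_integral[OF V] ennreal_mult)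
  finally show ?thesis .
qed

section \<open>The normalised variables and adjointness\<close>

lemma Y_upd_same: "Y p k (fun_upd \<omega> k 1) = (1 - p k) / sqrt (p k * (1 - p k))"
  "Y p k (fun_upd \<omega> k (-1)) = - p k / sqrt (p k * (1 - p k))"
proof -
  have "Y p k (fun_upd \<omega> k 1) = (2 * (1 - p k)) / (2 * sqrt (p k * (1 - p k)))"
    "Y p k (fun_upd \<omega> k (-1)) = (2 * (- p k)) / (2 * sqrt (p k * (1 - p k)))"
    by (simp_all add: Y_def)
  then show "Y p k (fun_upd \<omega> k 1) = (1 - p k) / sqrt (p k * (1 - p k))"
    "Y p k (fun_upd \<omega> k (-1)) = - p k / sqrt (p k * (1 - p k))"
    by (simp_all only: mult_divide_mult_cancel_left_if) simp_all
qed

lemma Y_upd_other: "j \<noteq> k \<Longrightarrow> Y p j (fun_upd \<omega> k c) = Y p j \<omega>"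
  by (simp add: Y_def)

lemma Y_measurable[measurable]: "Y p k \<in> borel_measurable R"
  unfolding Y_def by measurable

lemma Y_bounded: "\<omega> \<in> space R \<Longrightarrow> \<bar>Y p k \<omega>\<bar> \<le> 1 / sqrt (p k * (1 - p k))"
proof -
  assume "\<omega> \<in> space R"
  then have "\<omega> k \<in> {-1, 1}" by (auto simp: space_R)
  then have "\<bar>\<omega> k - p k + (1 - p k)\<bar> \<le> 2" using p_pos[of k] p_less[of k] by auto
  then show ?thesis using pq_pos[of k] by (simp add: Y_def abs_mult field_simps)
qed

text \<open>The values of \<open>Y p k\<close>, multiplied by their probabilities, are sqrt (p (1 -
  p)) and its negative, so averaging over coordinate k turns multiplication by \<open>Y p k\<close>
  into \<open>D p k\<close>. The factor H does not see that coordinate and passes through.\<close>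

lemma Y_adjoint:
  assumes i: "integrable R (\<lambda>\<omega>. Y p k \<omega> * (H \<omega> * G \<omega>))" "integrable R (\<lambda>\<omega>. H \<omega> * G \<omega>)"
    and H: "\<And>\<omega> c. H (fun_upd \<omega> k c) = H \<omega>"
  shows "(\<integral>\<omega>. Y p k \<omega> * (H \<omega> * G \<omega>) \<partial>R) = (\<integral>\<omega>. H \<omega> * D p k G \<omega> \<partial>R)"
proof -
  let ?s = "sqrt (p k * (1 - p k))"
  have s: "p k * ((1 - p k) / ?s) = ?s" "(1 - p k) * (p k / ?s) = ?s"
    using pq_pos[of k] real_div_sqrt[of "p k * (1 - p k)"] by (simp_all add: mult.commute)
  have iu: "integrable R (\<lambda>\<omega>. H \<omega> * G (fun_upd \<omega> k c))" if "c \<in> {-1, 1}" for c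
    using integrable_upd[OF i(2) that, of k] by (simp add: H)
  have "(\<integral>\<omega>. Y p k \<omega> * (H \<omega> * G \<omega>) \<partial>R)
     = p k * (\<integral>\<omega>. (1 - p k) / ?s * (H \<omega> * G (fun_upd \<omega> k 1)) \<partial>R)
      + (1 - p k) * (\<integral>\<omega>. - p k / ?s * (H \<omega> * G (fun_upd \<omega> k (-1))) \<partial>R)"
    by (subst resample_integral[OF i(1), of 1 k]) (simp_all add: H Y_upd_same)
  also have "\<dots> = (p k * ((1 - p k) / ?s)) * (\<integral>\<omega>. H \<omega> * G (fun_upd \<omega> k 1) \<partial>R)
     - ((1 - p k) * (p k / ?s)) * (\<integral>\<omega>. H \<omega> * G (fun_upd \<omega> k (-1)) \<partial>R)"
    by (simp only: integral_mult_right_zero mult.assoc)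
  also have "\<dots> = ?s * ((\<integral>\<omega>. H \<omega> * G (fun_upd \<omega> k 1) \<partial>R) - (\<integral>\<omega>. H \<omega> * G (fun_upd \<omega> k (-1)) \<partial>R))"
    unfolding s by (simp add: algebra_simps)
  also have "\<dots> = ?s * (\<integral>\<omega>. H \<omega> * G (fun_upd \<omega> k 1) - H \<omega> * G (fun_upd \<omega> k (-1)) \<partial>R)"
    using iu by simp
  also have "\<dots> = (\<integral>\<omega>. H \<omega> * D p k G \<omega> \<partial>R)"
    by (simp add: D_def algebra_simps flip: integral_mult_right_zero)
  finally show ?thesis .
qed

section \<open>Walsh functions and finite Walsh sums\<close>

definition walsh :: "nat set \<Rightarrow> (nat \<Rightarrow> real) \<Rightarrow> real" where
  "walsh A \<omega> = (\<Prod>k\<in>A. Y p k \<omega>)"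

lemma walsh_empty[simp]: "walsh {} \<omega> = 1"
  by (simp add: walsh_def)

lemma walsh_upd: "k \<notin> A \<Longrightarrow> walsh A (fun_upd \<omega> k c) = walsh A \<omega>"
  unfolding walsh_def by (intro prod.cong refl Y_upd_other) auto

lemma walsh_remove: "finite A \<Longrightarrow> k \<in> A \<Longrightarrow> walsh A \<omega> = Y p k \<omega> * walsh (A - {k}) \<omega>"
  unfolding walsh_def by (rule prod.remove)

lemma walsh_measurable[measurable]: "walsh A \<in> borel_measurable R"
  unfolding walsh_def by measurable

lemma walsh_bounded: "\<omega> \<in> space R \<Longrightarrow> \<bar>walsh A \<omega>\<bar> \<le> (\<Prod>k\<in>A. 1 / sqrt (p k * (1 - p k)))"
  unfolding walsh_def abs_prod by (intro prod_mono) (auto simp: Y_bounded)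

lemma square_integrable_walsh[simp]: "square_integrable R (walsh A)"
  by (rule square_integrable_bounded[OF walsh_measurable walsh_bounded])

text \<open>The two values of \<open>Y p k\<close> differ by the reciprocal of the factor in
  \<open>D\<close>, so differentiation just removes that variable from the product.\<close>

lemma D_walsh:
  assumes "finite A"
  shows "D p k (walsh A) \<omega> = (if k \<in> A then walsh (A - {k}) \<omega> else 0)"
proof (cases "k \<in> A")
  case True
  let ?s = "sqrt (p k * (1 - p k))"
  have s: "?s * ((1 - p k) / ?s + p k / ?s) = 1"
    using pq_pos[of k] p_pos[of k] p_less[of k] by (simp add: add_divide_distrib[symmetric])
  have "D p k (walsh A) \<omega> = ?s * ((1 - p k) / ?s + p k / ?s) * walsh (A - {k}) \<omega>"
    using True by (simp add: D_def walsh_remove[OF assms True] Y_upd_same walsh_upd algebra_simps)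
  then show ?thesis using True s by simp
qed (simp add: D_def walsh_upd)

lemma walsh_adjoint:
  assumes G: "square_integrable R G" and A: "finite A" "k \<in> A"
  shows "(\<integral>\<omega>. walsh A \<omega> * G \<omega> \<partial>R) = (\<integral>\<omega>. walsh (A - {k}) \<omega> * D p k G \<omega> \<partial>R)"
proof -
  have "(\<integral>\<omega>. walsh A \<omega> * G \<omega> \<partial>R) = (\<integral>\<omega>. Y p k \<omega> * (walsh (A - {k}) \<omega> * G \<omega>) \<partial>R)"
    using walsh_remove[OF A] by (simp add: mult.assoc)
  also have "\<dots> = (\<integral>\<omega>. walsh (A - {k}) \<omega> * D p k G \<omega> \<partial>R)"
  proof (rule Y_adjoint)
    show "integrable R (\<lambda>\<omega>. Y p k \<omega> * (walsh (A - {k}) \<omega> * G \<omega>))"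
      using integrable_mult_square_integrable[OF square_integrable_walsh[of A] G] walsh_remove[OF A]
      by (simp add: mult.assoc)
  qed (use integrable_mult_square_integrable[OF square_integrable_walsh G] in \<open>auto simp: walsh_upd\<close>)
  finally show ?thesis .
qed

text \<open>A variable taken out of one function acts as \<open>D p k\<close> on the other, where it
  removes k or gives 0. Against the constant 1 any remaining variable gives 0.\<close>

lemma walsh_orthonormal:
  assumes "finite A" "finite B"
  shows "(\<integral>\<omega>. walsh A \<omega> * walsh B \<omega> \<partial>R) = (if A = B then 1 else 0)"
  using assms
proof (induction A arbitrary: B rule: finite_induct)
  case empty
  show ?case
  proof (cases "B = {}")
    case False
    then obtain k where "k \<in> B" by auto
    then have "(\<integral>\<omega>. walsh B \<omega> * 1 \<partial>R) = 0"
      using empty by (subst walsh_adjoint[of "\<lambda>_. 1" B k]) (auto simp: D_def)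
    with False show ?thesis by auto
  qed (simp add: prob_space)
next
  case (insert k A)
  have "(\<integral>\<omega>. walsh (insert k A) \<omega> * walsh B \<omega> \<partial>R) = (\<integral>\<omega>. walsh A \<omega> * D p k (walsh B) \<omega> \<partial>R)"
    using insert by (subst walsh_adjoint[of _ _ k]) auto
  also have "\<dots> = (if k \<in> B then \<integral>\<omega>. walsh A \<omega> * walsh (B - {k}) \<omega> \<partial>R else 0)"
    by (auto simp: D_walsh insert)
  also have "\<dots> = (if insert k A = B then 1 else 0)"
    using insert.hyps insert.prems insert.IH[of "B - {k}"] by auto
  finally show ?case .
qed

text \<open>Summation runs over the support of \<open>c\<close>, so no index set has to be carried
  along.\<close>

definition walsh_sum :: "(nat set \<Rightarrow> real) \<Rightarrow> (nat \<Rightarrow> real) \<Rightarrow> real" where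
  "walsh_sum c \<omega> = (\<Sum>A | c A \<noteq> 0. c A * walsh A \<omega>)"

text \<open>Finiteness of the sets themselves is demanded because \<open>walsh\<close> of an
  infinite set is the constant 1, the default value of an infinite product.\<close>

definition finite_coeffs :: "(nat set \<Rightarrow> real) \<Rightarrow> bool" where
  "finite_coeffs c \<longleftrightarrow> finite {A. c A \<noteq> 0} \<and> (\<forall>A. c A \<noteq> 0 \<longrightarrow> finite A)"

lemma walsh_sum_superset:
  assumes "finite T" "{A. c A \<noteq> 0} \<subseteq> T"
  shows "walsh_sum c \<omega> = (\<Sum>A\<in>T. c A * walsh A \<omega>)"
  unfolding walsh_sum_def using assms by (intro sum.mono_neutral_left) auto

lemma square_integrable_walsh_sum[simp]: "square_integrable R (walsh_sum c)"
  unfolding walsh_sum_def by (intro square_integrable_sum square_integrable_cmult square_integrable_walsh)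

lemma walsh_sum_measurable[measurable]: "walsh_sum c \<in> borel_measurable R"
  by (rule square_integrable_measurable[OF square_integrable_walsh_sum])

lemma finite_coeffs_diff: "finite_coeffs c \<Longrightarrow> finite_coeffs c' \<Longrightarrow> finite_coeffs (\<lambda>A. c A - c' A)"
  unfolding finite_coeffs_def
  by (rule conjI, rule finite_subset[of _ "{A. c A \<noteq> 0} \<union> {A. c' A \<noteq> 0}"]) (auto, metis)

lemma finite_coeffs_mult: "finite_coeffs c \<Longrightarrow> finite_coeffs (\<lambda>A. a A * c A)"
  unfolding finite_coeffs_def
  by (auto elim!: finite_subset[rotated])

lemma finite_coeffs_divide_card: "finite_coeffs c \<Longrightarrow> finite_coeffs (\<lambda>A. c A / card A)"
  using finite_coeffs_mult[of c "\<lambda>A. 1 / card A"] by simp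

lemma walsh_sum_diff:
  assumes "finite_coeffs c" "finite_coeffs c'"
  shows "walsh_sum (\<lambda>A. c A - c' A) \<omega> = walsh_sum c \<omega> - walsh_sum c' \<omega>"
proof -
  let ?T = "{A. c A \<noteq> 0} \<union> {A. c' A \<noteq> 0}"
  have "finite ?T" using assms by (simp add: finite_coeffs_def)
  moreover have "{A. c A - c' A \<noteq> 0} \<subseteq> ?T" by auto
  ultimately show ?thesis
    using walsh_sum_superset[of ?T c \<omega>] walsh_sum_superset[of ?T c' \<omega>]
      walsh_sum_superset[of ?T "\<lambda>A. c A - c' A" \<omega>]
    by (simp add: left_diff_distrib sum_subtractf)
qed

lemma integral_walsh_sum_mult:
  assumes "square_integrable R G"
  shows "(\<integral>\<omega>. walsh_sum c \<omega> * G \<omega> \<partial>R) = (\<Sum>A | c A \<noteq> 0. c A * (\<integral>\<omega>. walsh A \<omega> * G \<omega> \<partial>R))"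
  using integrable_mult_square_integrable[OF square_integrable_walsh assms]
  by (simp add: walsh_sum_def sum_distrib_right mult.assoc)

lemma integral_walsh_walsh_sum:
  assumes c: "finite_coeffs c" and A: "finite A"
  shows "(\<integral>\<omega>. walsh A \<omega> * walsh_sum c \<omega> \<partial>R) = c A"
proof -
  have "(\<integral>\<omega>. walsh A \<omega> * walsh_sum c \<omega> \<partial>R) = (\<integral>\<omega>. walsh_sum c \<omega> * walsh A \<omega> \<partial>R)"
    by (simp add: mult.commute)
  also have "\<dots> = (\<Sum>B | c B \<noteq> 0. c B * (\<integral>\<omega>. walsh B \<omega> * walsh A \<omega> \<partial>R))"
    by (rule integral_walsh_sum_mult) simp
  also have "\<dots> = (\<Sum>B | c B \<noteq> 0. if B = A then c B else 0)"
    using c A by (intro sum.cong) (auto simp: walsh_orthonormal finite_coeffs_def)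
  also have "\<dots> = c A"
    using c by (simp add: finite_coeffs_def)
  finally show ?thesis .
qed

lemma integral_walsh_sum_walsh_sum:
  assumes "finite_coeffs c" "finite_coeffs c'"
  shows "(\<integral>\<omega>. walsh_sum c \<omega> * walsh_sum c' \<omega> \<partial>R) = (\<Sum>A | c A \<noteq> 0. c A * c' A)"
  using assms by (subst integral_walsh_sum_mult)
    (auto intro!: sum.cong simp: integral_walsh_walsh_sum finite_coeffs_def)

lemma integral_walsh_sum_square:
  assumes "finite_coeffs c"
  shows "(\<integral>\<omega>. (walsh_sum c \<omega>)\<^sup>2 \<partial>R) = (\<Sum>A | c A \<noteq> 0. (c A)\<^sup>2)"
  using integral_walsh_sum_walsh_sum[OF assms assms] by (simp add: power2_eq_square)

lemma D_walsh_sum: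
  assumes "finite_coeffs c"
  shows "D p k (walsh_sum c) \<omega> = (\<Sum>A | c A \<noteq> 0. c A * (if k \<in> A then walsh (A - {k}) \<omega> else 0))"
proof -
  have "D p k (walsh_sum c) \<omega> = (\<Sum>A | c A \<noteq> 0. c A * D p k (walsh A) \<omega>)"
    by (simp add: D_def walsh_sum_def sum_subtractf sum_distrib_left right_diff_distrib mult_ac)
  also have "\<dots> = (\<Sum>A | c A \<noteq> 0. c A * (if k \<in> A then walsh (A - {k}) \<omega> else 0))"
    using assms by (intro sum.cong) (auto simp: D_walsh finite_coeffs_def)
  finally show ?thesis .
qed

lemma D_diff: "D p k (\<lambda>\<omega>. V \<omega> - W \<omega>) \<omega> = D p k V \<omega> - D p k W \<omega>"
  by (simp add: D_def algebra_simps)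

text \<open>The divergence is the adjoint of the gradient, and the divergence of the gradient of
  \<open>walsh A\<close> is \<open>card A\<close> times \<open>walsh A\<close>.\<close>

lemma sum_integral_D_walsh_sum:
  assumes c: "finite_coeffs c" and G: "square_integrable R G"
    and K: "finite K" "\<And>A. c A \<noteq> 0 \<Longrightarrow> A \<subseteq> K"
  shows "(\<Sum>k\<in>K. \<integral>\<omega>. D p k G \<omega> * D p k (walsh_sum c) \<omega> \<partial>R)
    = (\<integral>\<omega>. walsh_sum (\<lambda>A. real (card A) * c A) \<omega> * G \<omega> \<partial>R)"
proof -
  have 1: "(\<integral>\<omega>. D p k G \<omega> * D p k (walsh_sum c) \<omega> \<partial>R)
      = (\<Sum>A | c A \<noteq> 0. if k \<in> A then c A * (\<integral>\<omega>. walsh A \<omega> * G \<omega> \<partial>R) else 0)" for k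
  proof -
    have i: "integrable R (\<lambda>\<omega>. D p k G \<omega> * (c A * (if k \<in> A then walsh (A - {k}) \<omega> else 0)))" for A
      using integrable_mult_square_integrable[OF square_integrable_D[OF G] square_integrable_walsh, of k "A - {k}"]
      by (cases "k \<in> A") (simp_all add: mult.left_commute)
    have "(\<integral>\<omega>. D p k G \<omega> * D p k (walsh_sum c) \<omega> \<partial>R)
       = (\<integral>\<omega>. (\<Sum>A | c A \<noteq> 0. D p k G \<omega> * (c A * (if k \<in> A then walsh (A - {k}) \<omega> else 0))) \<partial>R)"
      by (simp only: D_walsh_sum[OF c] sum_distrib_left)
    also have "\<dots> = (\<Sum>A | c A \<noteq> 0. \<integral>\<omega>. D p k G \<omega> * (c A * (if k \<in> A then walsh (A - {k}) \<omega> else 0)) \<partial>R)"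
      by (rule Bochner_Integration.integral_sum) (rule i)
    also have "\<dots> = (\<Sum>A | c A \<noteq> 0. if k \<in> A then c A * (\<integral>\<omega>. walsh A \<omega> * G \<omega> \<partial>R) else 0)"
    proof (intro sum.cong refl)
      fix A assume "A \<in> {A. c A \<noteq> 0}"
      then have A: "finite A" using c by (simp add: finite_coeffs_def)
      show "(\<integral>\<omega>. D p k G \<omega> * (c A * (if k \<in> A then walsh (A - {k}) \<omega> else 0)) \<partial>R)
         = (if k \<in> A then c A * (\<integral>\<omega>. walsh A \<omega> * G \<omega> \<partial>R) else 0)"
        using walsh_adjoint[OF G A, of k] by (simp add: mult_ac flip: integral_mult_right_zero)
    qed
    finally show ?thesis .
  qed
  have "(\<Sum>k\<in>K. \<integral>\<omega>. D p k G \<omega> * D p k (walsh_sum c) \<omega> \<partial>R)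
      = (\<Sum>A | c A \<noteq> 0. \<Sum>k\<in>K. if k \<in> A then c A * (\<integral>\<omega>. walsh A \<omega> * G \<omega> \<partial>R) else 0)"
    unfolding 1 by (rule sum.swap)
  \<comment> \<open>Since \<open>K\<close> covers every set in the support, each A is counted once
    for each of its elements.\<close>
  also have "\<dots> = (\<Sum>A | c A \<noteq> 0. real (card A) * c A * (\<integral>\<omega>. walsh A \<omega> * G \<omega> \<partial>R))"
  proof (intro sum.cong refl)
    fix A assume "A \<in> {A. c A \<noteq> 0}"
    then have "K \<inter> A = A" using K by auto
    then show "(\<Sum>k\<in>K. if k \<in> A then c A * (\<integral>\<omega>. walsh A \<omega> * G \<omega> \<partial>R) else 0)
       = real (card A) * c A * (\<integral>\<omega>. walsh A \<omega> * G \<omega> \<partial>R)"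
      using K(1) by (simp flip: sum.inter_restrict)
  qed
  \<comment> \<open>The supports differ at most in the empty set, whose term is 0.\<close>
  also have "\<dots> = (\<Sum>A | real (card A) * c A \<noteq> 0. real (card A) * c A * (\<integral>\<omega>. walsh A \<omega> * G \<omega> \<partial>R))"
    using c by (intro sum.mono_neutral_right) (auto simp: finite_coeffs_def card_gt_0_iff)
  also have "\<dots> = (\<integral>\<omega>. walsh_sum (\<lambda>A. real (card A) * c A) \<omega> * G \<omega> \<partial>R)"
    by (rule integral_walsh_sum_mult[OF G, symmetric])
  finally show ?thesis .
qed

end

section \<open>Chaos decompositions and integration by parts\<close>

lemma sum_power2_le_card:
  fixes f :: "'a \<Rightarrow> real"
  shows "(\<Sum>i\<in>I. f i)\<^sup>2 \<le> real (card I) * (\<Sum>i\<in>I. (f i)\<^sup>2)"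
  using sum_squared_le_sum_of_squares[of f I] by (simp add: mult.commute)

lemma L2sq_sum_le:
  assumes [measurable]: "\<And>i. i \<in> I \<Longrightarrow> f i \<in> borel_measurable M"
  shows "L2sq M (\<lambda>\<omega>. \<Sum>i\<in>I. f i \<omega>) \<le> of_nat (card I) * (\<Sum>i\<in>I. L2sq M (f i))"
proof -
  have "L2sq M (\<lambda>\<omega>. \<Sum>i\<in>I. f i \<omega>) \<le> (\<integral>\<^sup>+\<omega>. of_nat (card I) * (\<Sum>i\<in>I. ennreal ((f i \<omega>)\<^sup>2)) \<partial>M)"
  proof (rule nn_integral_mono)
    fix \<omega>
    have "ennreal ((\<Sum>i\<in>I. f i \<omega>)\<^sup>2) \<le> ennreal (real (card I) * (\<Sum>i\<in>I. (f i \<omega>)\<^sup>2))"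
      by (intro ennreal_leI sum_power2_le_card)
    then show "ennreal ((\<Sum>i\<in>I. f i \<omega>)\<^sup>2) \<le> of_nat (card I) * (\<Sum>i\<in>I. ennreal ((f i \<omega>)\<^sup>2))"
      by (simp add: ennreal_mult sum_nonneg ennreal_of_nat_eq_real_of_nat flip: sum_ennreal)
  qed
  also have "\<dots> = of_nat (card I) * (\<Sum>i\<in>I. L2sq M (f i))"
    by (simp add: nn_integral_cmult nn_integral_sum del: sum_ennreal)
  finally show ?thesis .
qed

lemma chaos_kernel_not_distinct:
  "chaos_kernel n f \<Longrightarrow> length xs = n \<Longrightarrow> \<not> distinct xs \<Longrightarrow> f xs = 0"
  unfolding chaos_kernel_def by blast

lemma chaos_kernel_summable:
  "chaos_kernel n f \<Longrightarrow> (\<lambda>xs. (f xs)\<^sup>2) summable_on {xs. length xs = n}"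
  unfolding chaos_kernel_def by blast

context rademacher_seq
begin

section \<open>Partial sums of multiple integrals as Walsh sums\<close>

definition psum :: "(nat list \<Rightarrow> real) \<Rightarrow> nat list set \<Rightarrow> (nat \<Rightarrow> real) \<Rightarrow> real" where
  "psum f S \<omega> = (\<Sum>xs\<in>S. f xs * (\<Prod>i\<leftarrow>xs. Y p i \<omega>))"

text \<open>The finite set \<open>S\<close> of tuples need not be closed under permutations, so the
  coefficient of \<open>walsh A\<close> collects just those orderings of A that lie in
  \<open>S\<close>.\<close>

definition kcoeff :: "(nat list \<Rightarrow> real) \<Rightarrow> nat list set \<Rightarrow> nat set \<Rightarrow> real" where
  "kcoeff f S A = (\<Sum>xs | xs \<in> S \<and> distinct xs \<and> set xs = A. f xs)"

lemma kcoeff_nonzero: "kcoeff f S A \<noteq> 0 \<Longrightarrow> \<exists>xs\<in>S. distinct xs \<and> set xs = A"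
  unfolding kcoeff_def by (erule sum.not_neutral_contains_not_neutral) auto

lemma finite_coeffs_kcoeff:
  assumes "finite S"
  shows "finite_coeffs (kcoeff f S)"
proof -
  have "{A. kcoeff f S A \<noteq> 0} \<subseteq> set ` S" using kcoeff_nonzero by blast
  then show ?thesis
    unfolding finite_coeffs_def using assms kcoeff_nonzero by (metis List.finite_set finite_imageI finite_subset)
qed

lemma sum_kcoeff_group:
  fixes h :: "nat list \<Rightarrow> real"
  assumes "finite S"
  shows "(\<Sum>A\<in>set ` S. \<Sum>xs | xs \<in> S \<and> distinct xs \<and> set xs = A. h xs) = (\<Sum>xs | xs \<in> S \<and> distinct xs. h xs)"
proof -
  have *: "{x \<in> {xs \<in> S. distinct xs}. set x = A} = {xs. xs \<in> S \<and> distinct xs \<and> set xs = A}" for A :: "nat set"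
    by auto
  have "(\<Sum>A\<in>set ` S. sum h {x \<in> {xs \<in> S. distinct xs}. set x = A}) = (\<Sum>xs\<in>{xs \<in> S. distinct xs}. h xs)"
    using assms by (intro sum.group) auto
  then show ?thesis unfolding * by simp
qed

lemma psum_eq_walsh_sum:
  assumes "finite S" "\<And>xs. xs \<in> S \<Longrightarrow> \<not> distinct xs \<Longrightarrow> f xs = 0"
  shows "psum f S = walsh_sum (kcoeff f S)"
proof
  fix \<omega>
  have "psum f S \<omega> = (\<Sum>xs | xs \<in> S \<and> distinct xs. f xs * walsh (set xs) \<omega>)"
    unfolding psum_def walsh_def using assms
    by (intro sum.mono_neutral_cong_right) (auto simp: prod.distinct_set_conv_list)
  also have "\<dots> = (\<Sum>A\<in>set ` S. \<Sum>xs | xs \<in> S \<and> distinct xs \<and> set xs = A. f xs * walsh (set xs) \<omega>)"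
    using assms(1) by (rule sum_kcoeff_group[symmetric])
  also have "\<dots> = (\<Sum>A\<in>set ` S. kcoeff f S A * walsh A \<omega>)"
    unfolding kcoeff_def sum_distrib_right by (intro sum.cong) auto
  also have "\<dots> = walsh_sum (kcoeff f S) \<omega>"
    using assms(1) kcoeff_nonzero by (intro walsh_sum_superset[symmetric]) blast+
  finally show "psum f S \<omega> = walsh_sum (kcoeff f S) \<omega>" .
qed

text \<open>At most \<open>fact (card A)\<close> orderings of A occur, and Cauchy-Schwarz over them
  produces the weight n! of the chaos norm. For general \<open>S\<close> an inequality is all that
  holds.\<close>

lemma kcoeff_square_le:
  assumes "finite S"
  shows "(kcoeff f S A)\<^sup>2 \<le> (\<Sum>xs | xs \<in> S \<and> distinct xs \<and> set xs = A. fact (length xs) * (f xs)\<^sup>2)"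
proof -
  let ?L = "{xs. xs \<in> S \<and> distinct xs \<and> set xs = A}"
  have fin: "finite ?L" using assms by simp
  show ?thesis
  proof (cases "?L = {}")
    case False
    then have A: "finite A" by auto
    have "card ?L \<le> card (permutations_of_set A)"
      using A by (intro card_mono finite_permutations_of_set) (auto simp: permutations_of_set_def)
    then have "real (card ?L) \<le> real (fact (card A))"
      using A by (intro of_nat_mono) simp
    then have le: "real (card ?L) \<le> fact (card A)"
      by (simp only: of_nat_fact)
    have "(kcoeff f S A)\<^sup>2 \<le> real (card ?L) * (\<Sum>xs\<in>?L. (f xs)\<^sup>2)"
      unfolding kcoeff_def by (rule sum_power2_le_card)
    also have "\<dots> \<le> fact (card A) * (\<Sum>xs\<in>?L. (f xs)\<^sup>2)"
      using le by (intro mult_right_mono sum_nonneg) auto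
    also have "\<dots> = (\<Sum>xs\<in>?L. fact (length xs) * (f xs)\<^sup>2)"
      unfolding sum_distrib_left by (intro sum.cong) (auto simp: distinct_card)
    finally show ?thesis .
  qed (simp only: kcoeff_def, simp)
qed

text \<open>The weight \<open>w\<close> will be 1 for L^2 norms and n for the energy of the
  gradient.\<close>

lemma sum_weight_kcoeff_le:
  assumes S: "finite S" and w: "\<And>n. 0 \<le> w n"
  shows "(\<Sum>A | kcoeff f S A \<noteq> 0. w (card A) * (kcoeff f S A)\<^sup>2)
     \<le> (\<Sum>xs\<in>S. w (length xs) * fact (length xs) * (f xs)\<^sup>2)"
proof -
  have "(\<Sum>A | kcoeff f S A \<noteq> 0. w (card A) * (kcoeff f S A)\<^sup>2)
      \<le> (\<Sum>A\<in>set ` S. w (card A) * (kcoeff f S A)\<^sup>2)"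
    using S kcoeff_nonzero w by (intro sum_mono2) (auto, blast)
  also have "\<dots> \<le> (\<Sum>A\<in>set ` S. w (card A) * (\<Sum>xs | xs \<in> S \<and> distinct xs \<and> set xs = A. fact (length xs) * (f xs)\<^sup>2))"
    by (intro sum_mono mult_left_mono kcoeff_square_le S w)
  also have "\<dots> = (\<Sum>A\<in>set ` S. \<Sum>xs | xs \<in> S \<and> distinct xs \<and> set xs = A. w (length xs) * fact (length xs) * (f xs)\<^sup>2)"
    unfolding sum_distrib_left by (intro sum.cong refl) (auto simp: distinct_card mult.assoc)
  also have "\<dots> = (\<Sum>xs | xs \<in> S \<and> distinct xs. w (length xs) * fact (length xs) * (f xs)\<^sup>2)"
    by (rule sum_kcoeff_group[OF S])
  also have "\<dots> \<le> (\<Sum>xs\<in>S. w (length xs) * fact (length xs) * (f xs)\<^sup>2)"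
    using S w by (intro sum_mono2) auto
  finally show ?thesis .
qed

lemma integral_psum_square_le:
  assumes S: "finite S" and f: "\<And>xs. xs \<in> S \<Longrightarrow> \<not> distinct xs \<Longrightarrow> f xs = 0"
  shows "(\<integral>\<omega>. (psum f S \<omega>)\<^sup>2 \<partial>R) \<le> (\<Sum>xs\<in>S. fact (length xs) * (f xs)\<^sup>2)"
  using sum_weight_kcoeff_le[OF S, of "\<lambda>_. 1" f]
  by (simp add: psum_eq_walsh_sum[OF S f] integral_walsh_sum_square finite_coeffs_kcoeff S)

lemma Y_prod_list_measurable[measurable]: "(\<lambda>\<omega>. \<Prod>i\<leftarrow>xs. Y p i \<omega>) \<in> borel_measurable R"
  by (induction xs) auto

lemma square_integrable_psum[simp]: "square_integrable R (psum f S)"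
proof -
  have "square_integrable R (\<lambda>\<omega>. \<Prod>i\<leftarrow>xs. Y p i \<omega>)" for xs
  proof (rule square_integrable_bounded[where B="\<Prod>i\<leftarrow>xs. 1 / sqrt (p i * (1 - p i))"])
    fix \<omega> assume w: "\<omega> \<in> space R"
    show "\<bar>\<Prod>i\<leftarrow>xs. Y p i \<omega>\<bar> \<le> (\<Prod>i\<leftarrow>xs. 1 / sqrt (p i * (1 - p i)))"
    proof (induction xs)
      case (Cons x xs)
      then show ?case
        using Y_bounded[OF w, of x] pq_pos[of x]
        by (simp only: list.map prod_list.Cons abs_mult) (intro mult_mono, auto)
    qed simp
  qed measurable
  then show ?thesis unfolding psum_def by (intro square_integrable_sum square_integrable_cmult)
qed

lemma psum_diff:
  assumes "finite T" "S \<subseteq> T"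
  shows "psum f T \<omega> - psum f S \<omega> = psum f (T - S) \<omega>"
  unfolding psum_def using assms by (simp add: sum_diff)

text \<open>\<open>J\<close> is a choice of limit, so a limit has to be shown to exist. By
  orthonormality the squared distance of nested partial sums is at most n! times a tail of the
  summable squares of the kernel.\<close>

lemma L2_tendsto_J:
  assumes f: "chaos_kernel n f"
  shows "L2_tendsto R (psum f) (J p n f) (finite_subsets_at_top {xs. length xs = n})"
proof -
  let ?I = "{xs :: nat list. length xs = n}"
  have f0: "f xs = 0" if "length xs = n" "\<not> distinct xs" for xs
    using f that by (rule chaos_kernel_not_distinct)
  have "\<exists>G. L2_tendsto R (psum f) G (finite_subsets_at_top ?I)"
  proof (rule L2_Cauchy_net_convergent)
    fix e :: real assume "0 < e"
    \<comment> \<open>Two partial sums within d of the total differ by at most 2 d, and the weight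
      n! still has to be absorbed.\<close>
    define d where "d = e / (2 * fact n)"
    have d: "0 < d" using \<open>0 < e\<close> by (simp add: d_def)
    have "((\<lambda>xs. (f xs)\<^sup>2) has_sum (\<Sum>\<^sub>\<infinity>xs\<in>?I. (f xs)\<^sup>2)) ?I"
      by (intro has_sum_infsum chaos_kernel_summable f)
    then have "eventually (\<lambda>T. dist (\<Sum>xs\<in>T. (f xs)\<^sup>2) (\<Sum>\<^sub>\<infinity>xs\<in>?I. (f xs)\<^sup>2) < d) (finite_subsets_at_top ?I)"
      unfolding has_sum_def using d by (rule tendstoD)
    then obtain T0 where T0: "finite T0" "T0 \<subseteq> ?I"
      and T: "\<And>T. finite T \<Longrightarrow> T0 \<subseteq> T \<Longrightarrow> T \<subseteq> ?I \<Longrightarrow>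
         dist (\<Sum>xs\<in>T. (f xs)\<^sup>2) (\<Sum>\<^sub>\<infinity>xs\<in>?I. (f xs)\<^sup>2) < d"
      unfolding eventually_finite_subsets_at_top by metis
    show "\<exists>T0. finite T0 \<and> T0 \<subseteq> ?I \<and>
      (\<forall>T. finite T \<longrightarrow> T0 \<subseteq> T \<longrightarrow> T \<subseteq> ?I \<longrightarrow> L2sq R (\<lambda>\<omega>. psum f T \<omega> - psum f T0 \<omega>) \<le> ennreal e)"
    proof (intro exI[of _ T0] conjI T0 allI impI)
      fix T assume t: "finite T" "T0 \<subseteq> T" "T \<subseteq> ?I"
      have "(\<Sum>xs\<in>T - T0. (f xs)\<^sup>2) = (\<Sum>xs\<in>T. (f xs)\<^sup>2) - (\<Sum>xs\<in>T0. (f xs)\<^sup>2)"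
        using t by (simp add: sum_diff)
      also have "\<dots> \<le> 2 * d"
        using T[OF t] T[OF T0(1) order_refl T0(2)] unfolding dist_real_def by linarith
      finally have b: "(\<Sum>xs\<in>T - T0. (f xs)\<^sup>2) \<le> 2 * d" .
      have "(\<integral>\<omega>. (psum f (T - T0) \<omega>)\<^sup>2 \<partial>R) \<le> (\<Sum>xs\<in>T - T0. fact (length xs) * (f xs)\<^sup>2)"
        using t f0 by (intro integral_psum_square_le) auto
      also have "\<dots> = fact n * (\<Sum>xs\<in>T - T0. (f xs)\<^sup>2)"
        unfolding sum_distrib_left using t by (intro sum.cong) auto
      also have "\<dots> \<le> fact n * (2 * d)" using b by (intro mult_left_mono) auto
      also have "\<dots> = e" by (simp add: d_def)
      finally show "L2sq R (\<lambda>\<omega>. psum f T \<omega> - psum f T0 \<omega>) \<le> ennreal e"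
        by (simp add: psum_diff t L2sq_eq_integral[OF square_integrable_psum] ennreal_leI)
    qed
  qed simp
  then show ?thesis
    unfolding J_def L2_lim_def psum_def[abs_def] by (rule someI_ex)
qed

lemma square_integrable_J: "chaos_kernel n f \<Longrightarrow> square_integrable R (J p n f)"
  using L2_tendsto_J by (rule L2_tendstoD)

text \<open>A diagonal argument: the m-th approximant uses the first m chaoses, each cut down to
  finitely many tuples. One family \<open>c\<close> serves F, its negated pseudo-inverse and the
  energy at once, because in the chaos of order n dividing by n is dividing by
  \<open>card A\<close>.\<close>

lemma chaos_approximation:
  assumes F: "has_chaos_kernels p F f" and EF: "(\<integral>\<omega>. F \<omega> \<partial>R) = 0"
  obtains c where "\<And>m. finite_coeffs (c m)" "\<And>m. c m {} = 0"
    "L2_tendsto R (\<lambda>m. walsh_sum (c m)) F sequentially"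
    "(\<lambda>m. L2sq R (\<lambda>\<omega>. walsh_sum (\<lambda>A. c m A / card A) \<omega> - (\<Sum>n=1..m. 1 / real n * J p n (f n) \<omega>)))
       \<longlonglongrightarrow> 0"
    "\<And>m. (\<Sum>A | c m A \<noteq> 0. real (card A) * (c m A)\<^sup>2)
       \<le> (\<Sum>n=1..m. real n * fact n * (\<Sum>\<^sub>\<infinity>xs\<in>{xs. length xs = n}. (f n xs)\<^sup>2))"
proof -
  let ?I = "\<lambda>n. {xs :: nat list. length xs = n}"
  have K: "chaos_kernel n (f n)" if "n \<ge> 1" for n using F that by (simp add: has_chaos_kernels_def)
  note Js = square_integrable_J[OF K]
  \<comment> \<open>The cube pays for m terms and for the factor m lost in squaring their sum: the
    total error is at most m^2 / (m + 1)^3 <= 1 / (m + 1).\<close>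
  have "\<exists>S. finite S \<and> S \<subseteq> ?I n \<and> L2sq R (\<lambda>\<omega>. psum (f n) S \<omega> - J p n (f n) \<omega>) \<le> ennreal (1 / Suc m ^ 3)"
    if n: "n \<ge> 1" for m n :: nat
  proof -
    have "eventually (\<lambda>S. L2sq R (\<lambda>\<omega>. psum (f n) S \<omega> - J p n (f n) \<omega>) < ennreal (1 / Suc m ^ 3)) (finite_subsets_at_top (?I n))"
      using L2_tendstoD(2)[OF L2_tendsto_J[OF K[OF n]]] by (rule order_tendstoD) simp
    then show ?thesis unfolding eventually_finite_subsets_at_top by (meson order_refl less_imp_le)
  qed
  \<comment> \<open>With n >= 1 moved inside, the choice function can be total.\<close>
  then have "\<forall>m n. \<exists>S. n \<ge> 1 \<longrightarrow> finite S \<and> S \<subseteq> ?I n \<and>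
      L2sq R (\<lambda>\<omega>. psum (f n) S \<omega> - J p n (f n) \<omega>) \<le> ennreal (1 / Suc m ^ 3)"
    by blast
  then obtain S where "\<forall>m n. n \<ge> 1 \<longrightarrow> finite (S m n) \<and> S m n \<subseteq> ?I n \<and>
      L2sq R (\<lambda>\<omega>. psum (f n) (S m n) \<omega> - J p n (f n) \<omega>) \<le> ennreal (1 / Suc m ^ 3)"
    by (auto simp only: choice_iff)
  then have S: "\<And>m n. n \<ge> 1 \<Longrightarrow> finite (S m n)" "\<And>m n. n \<ge> 1 \<Longrightarrow> S m n \<subseteq> ?I n"
    "\<And>m n. n \<ge> 1 \<Longrightarrow> L2sq R (\<lambda>\<omega>. psum (f n) (S m n) \<omega> - J p n (f n) \<omega>) \<le> ennreal (1 / Suc m ^ 3)"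
    by blast+
  define T where "T m = (\<Union>n\<in>{1..m}. S m n)" for m
  \<comment> \<open>The order is the length of the tuple, so the kernels of all orders fit into one
    function on lists.\<close>
  define a where "a xs = f (length xs) xs" for xs
  define c where "c m = kcoeff a (T m)" for m
  have finT: "finite (T m)" for m using S(1) by (auto simp: T_def)
  have Tlen: "1 \<le> length xs \<and> length xs \<le> m \<and> xs \<in> S m (length xs)" if xs: "xs \<in> T m" for m xs
  proof -
    obtain n where n: "n \<in> {1..m}" "xs \<in> S m n" using xs by (auto simp: T_def)
    with S(2)[of n m] have "length xs = n" by auto
    with n show ?thesis by auto
  qed
  have a0: "a xs = 0" if "xs \<in> T m" "\<not> distinct xs" for xs m
    using chaos_kernel_not_distinct[OF K, of "length xs" xs] Tlen[OF that(1)] that(2) by (simp add: a_def)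
  have sumT: "(\<Sum>xs\<in>T m. h xs) = (\<Sum>n=1..m. \<Sum>xs\<in>S m n. h xs)" for m and h :: "nat list \<Rightarrow> real"
    unfolding T_def
  proof (rule sum.UNION_disjoint)
    show "\<forall>i\<in>{1..m}. \<forall>j\<in>{1..m}. i \<noteq> j \<longrightarrow> S m i \<inter> S m j = {}"
    proof (intro ballI impI)
      fix i j assume "i \<in> {1..m}" "j \<in> {1..m}" "i \<noteq> j"
      then show "S m i \<inter> S m j = {}" using S(2)[of i m] S(2)[of j m] by auto
    qed
  qed (use S(1) in auto)
  have fc: "finite_coeffs (c m)" for m unfolding c_def by (rule finite_coeffs_kcoeff[OF finT])
  \<comment> \<open>Only orders n >= 1 enter, so no tuple in \<open>T m\<close> is empty.\<close>
  have c0: "c m {} = 0" for m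
    unfolding c_def using kcoeff_nonzero Tlen by fastforce
  have W: "walsh_sum (c m) \<omega> = (\<Sum>n=1..m. psum (f n) (S m n) \<omega>)" for m \<omega>
  proof -
    have "walsh_sum (c m) \<omega> = psum a (T m) \<omega>"
      unfolding c_def using psum_eq_walsh_sum[OF finT a0] by simp
    also have "\<dots> = (\<Sum>n=1..m. \<Sum>xs\<in>S m n. a xs * (\<Prod>i\<leftarrow>xs. Y p i \<omega>))"
      unfolding psum_def by (rule sumT)
    also have "\<dots> = (\<Sum>n=1..m. psum (f n) (S m n) \<omega>)"
      unfolding psum_def a_def using S(2) by (intro sum.cong refl) fastforce
    finally show ?thesis .
  qed
  have cU: "(\<lambda>A. c m A / card A) = kcoeff (\<lambda>xs. a xs / length xs) (T m)" for m
    unfolding c_def kcoeff_def sum_divide_distrib by (intro ext sum.cong refl) (auto simp: distinct_card)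
  have U: "walsh_sum (\<lambda>A. c m A / card A) \<omega> = (\<Sum>n=1..m. 1 / real n * psum (f n) (S m n) \<omega>)" for m \<omega>
  proof -
    have "walsh_sum (\<lambda>A. c m A / card A) \<omega> = psum (\<lambda>xs. a xs / length xs) (T m) \<omega>"
      unfolding cU using psum_eq_walsh_sum[OF finT, of m "\<lambda>xs. a xs / length xs"] a0 by simp
    also have "\<dots> = (\<Sum>n=1..m. \<Sum>xs\<in>S m n. a xs / length xs * (\<Prod>i\<leftarrow>xs. Y p i \<omega>))"
      unfolding psum_def by (rule sumT)
    also have "\<dots> = (\<Sum>n=1..m. 1 / real n * psum (f n) (S m n) \<omega>)"
      unfolding psum_def a_def sum_distrib_left using S(2) by (intro sum.cong refl) fastforce
    finally show ?thesis .
  qed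
  \<comment> \<open>The weights b will be 1 for F and 1 / n for the pseudo-inverse.\<close>
  have close: "(\<lambda>m. L2sq R (\<lambda>\<omega>. (\<Sum>n=1..m. b n * psum (f n) (S m n) \<omega>) - (\<Sum>n=1..m. b n * J p n (f n) \<omega>))) \<longlonglongrightarrow> 0"
    if b: "\<And>n. \<bar>b n\<bar> \<le> 1" for b :: "nat \<Rightarrow> real"
  proof (rule tendsto_sandwich[OF always_eventually always_eventually tendsto_const])
    show "\<forall>m. L2sq R (\<lambda>\<omega>. (\<Sum>n=1..m. b n * psum (f n) (S m n) \<omega>) - (\<Sum>n=1..m. b n * J p n (f n) \<omega>))
        \<le> ennreal (1 / Suc m)"
    proof
      fix m
      let ?d = "\<lambda>n \<omega>. psum (f n) (S m n) \<omega> - J p n (f n) \<omega>"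
      have ds: "square_integrable R (?d n)" if "n \<in> {1..m}" for n
        using Js[of n] that by (intro square_integrable_diff) auto
      have "L2sq R (\<lambda>\<omega>. (\<Sum>n=1..m. b n * psum (f n) (S m n) \<omega>) - (\<Sum>n=1..m. b n * J p n (f n) \<omega>))
          = L2sq R (\<lambda>\<omega>. \<Sum>n=1..m. b n * ?d n \<omega>)"
        by (simp only: sum_subtractf right_diff_distrib)
      also have "\<dots> \<le> of_nat (card {1..m}) * (\<Sum>n=1..m. L2sq R (\<lambda>\<omega>. b n * ?d n \<omega>))"
        using ds by (intro L2sq_sum_le) auto
      also have "\<dots> \<le> of_nat (card {1..m}) * (\<Sum>n=1..m. ennreal (1 / Suc m ^ 3))"
      proof (intro mult_left_mono sum_mono)
        fix n assume n: "n \<in> {1..m}"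
        have "L2sq R (\<lambda>\<omega>. b n * ?d n \<omega>) = ennreal ((b n)\<^sup>2) * L2sq R (?d n)"
          using ds[OF n] by (intro L2sq_cmult) auto
        also have "\<dots> \<le> 1 * ennreal (1 / Suc m ^ 3)"
          using b[of n] S(3)[of n m] n by (intro mult_mono) (auto simp: abs_square_le_1)
        finally show "L2sq R (\<lambda>\<omega>. b n * ?d n \<omega>) \<le> ennreal (1 / Suc m ^ 3)" by simp
      qed auto
      also have "\<dots> = ennreal (real m * (real m * (1 / Suc m ^ 3)))"
        by (simp add: ennreal_of_nat_eq_real_of_nat del: sum_ennreal flip: ennreal_mult)
      also have "\<dots> \<le> ennreal (1 / Suc m)"
      proof (rule ennreal_leI)
        have cube: "x * x * (1 / x ^ 3) = 1 / x" if "x \<noteq> 0" for x :: real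
          using that by (simp add: power3_eq_cube)
        have "real m * real m \<le> real (Suc m) * real (Suc m)" by (intro mult_mono) auto
        then have "real m * (real m * (1 / Suc m ^ 3)) \<le> real (Suc m) * real (Suc m) * (1 / Suc m ^ 3)"
          by (simp add: divide_right_mono)
        also have "\<dots> = 1 / Suc m" using cube[of "real (Suc m)"] by simp
        finally show "real m * (real m * (1 / Suc m ^ 3)) \<le> 1 / Suc m" .
      qed
      finally show "L2sq R (\<lambda>\<omega>. (\<Sum>n=1..m. b n * psum (f n) (S m n) \<omega>) - (\<Sum>n=1..m. b n * J p n (f n) \<omega>))
        \<le> ennreal (1 / Suc m)" .
    qed
    have "(\<lambda>m. ennreal (1 / Suc m)) \<longlonglongrightarrow> ennreal 0"
      by (intro tendsto_ennrealI LIMSEQ_inverse_real_of_nat[unfolded inverse_eq_divide])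
    then show "(\<lambda>m. ennreal (1 / Suc m)) \<longlonglongrightarrow> 0" by simp
  qed simp
  show thesis
  proof
    show "finite_coeffs (c m)" "c m {} = 0" for m by (rule fc c0)+
    have "L2_tendsto R (\<lambda>m \<omega>. \<Sum>n=1..m. J p n (f n) \<omega>) F sequentially"
      using F by (simp add: has_chaos_kernels_def EF)
    then show "L2_tendsto R (\<lambda>m. walsh_sum (c m)) F sequentially"
    proof (rule L2_tendsto_trans)
      show "(\<lambda>\<omega>. \<Sum>n=1..m. J p n (f n) \<omega>) \<in> borel_measurable R" for m
        using Js by (intro borel_measurable_sum) auto
      show "(\<lambda>m. L2sq R (\<lambda>\<omega>. walsh_sum (c m) \<omega> - (\<Sum>n=1..m. J p n (f n) \<omega>))) \<longlonglongrightarrow> 0"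
        using close[of "\<lambda>_. 1"] by (simp add: W)
    qed measurable
    show "(\<lambda>m. L2sq R (\<lambda>\<omega>. walsh_sum (\<lambda>A. c m A / card A) \<omega> - (\<Sum>n=1..m. 1 / real n * J p n (f n) \<omega>)))
       \<longlonglongrightarrow> 0"
      unfolding U by (rule close) (simp add: divide_le_eq)
    fix m
    have "(\<Sum>A | c m A \<noteq> 0. real (card A) * (c m A)\<^sup>2)
        \<le> (\<Sum>xs\<in>T m. real (length xs) * fact (length xs) * (a xs)\<^sup>2)"
      unfolding c_def by (rule sum_weight_kcoeff_le[OF finT]) simp
    also have "\<dots> = (\<Sum>n=1..m. \<Sum>xs\<in>S m n. real (length xs) * fact (length xs) * (a xs)\<^sup>2)"
      by (rule sumT)
    also have "\<dots> = (\<Sum>n=1..m. real n * fact n * (\<Sum>xs\<in>S m n. (f n xs)\<^sup>2))"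
      unfolding sum_distrib_left a_def using S(2) by (intro sum.cong refl) fastforce
    also have "\<dots> \<le> (\<Sum>n=1..m. real n * fact n * (\<Sum>\<^sub>\<infinity>xs\<in>?I n. (f n xs)\<^sup>2))"
    proof (intro sum_mono mult_left_mono)
      fix n assume n: "n \<in> {1..m}"
      then have "(\<lambda>xs. (f n xs)\<^sup>2) summable_on ?I n"
        by (intro chaos_kernel_summable K) simp
      then show "(\<Sum>xs\<in>S m n. (f n xs)\<^sup>2) \<le> (\<Sum>\<^sub>\<infinity>xs\<in>?I n. (f n xs)\<^sup>2)"
        using S(1,2) n by (intro finite_sum_le_infsum) auto
    qed auto
    finally show "(\<Sum>A | c m A \<noteq> 0. real (card A) * (c m A)\<^sup>2)
       \<le> (\<Sum>n=1..m. real n * fact n * (\<Sum>\<^sub>\<infinity>xs\<in>?I n. (f n xs)\<^sup>2))" .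
  qed
qed

section \<open>Energy of the gradient\<close>

lemma sum_integral_D_walsh_sum_square:
  assumes c: "finite_coeffs c" and K: "finite K"
  shows "(\<Sum>k\<in>K. \<integral>\<omega>. (D p k (walsh_sum c) \<omega>)\<^sup>2 \<partial>R) \<le> (\<Sum>A | c A \<noteq> 0. real (card A) * (c A)\<^sup>2)"
proof -
  \<comment> \<open>The adjoint identity needs an index set that covers every set in the support;
    enlarging \<open>K\<close> only adds squares.\<close>
  let ?K = "K \<union> \<Union>{A. c A \<noteq> 0}"
  have "finite (\<Union>{A. c A \<noteq> 0})" using c by (auto simp: finite_coeffs_def)
  then have fK: "finite ?K" using K by simp
  have "(\<Sum>k\<in>K. \<integral>\<omega>. (D p k (walsh_sum c) \<omega>)\<^sup>2 \<partial>R) \<le> (\<Sum>k\<in>?K. \<integral>\<omega>. (D p k (walsh_sum c) \<omega>)\<^sup>2 \<partial>R)"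
    using fK by (intro sum_mono2) auto
  also have "\<dots> = (\<Sum>k\<in>?K. \<integral>\<omega>. D p k (walsh_sum c) \<omega> * D p k (walsh_sum c) \<omega> \<partial>R)"
    by (simp add: power2_eq_square)
  also have "\<dots> = (\<integral>\<omega>. walsh_sum (\<lambda>A. real (card A) * c A) \<omega> * walsh_sum c \<omega> \<partial>R)"
    using fK by (intro sum_integral_D_walsh_sum c) auto
  also have "\<dots> = (\<integral>\<omega>. walsh_sum c \<omega> * walsh_sum (\<lambda>A. real (card A) * c A) \<omega> \<partial>R)"
    by (simp add: mult.commute)
  also have "\<dots> = (\<Sum>A | c A \<noteq> 0. c A * (real (card A) * c A))"
    by (intro integral_walsh_sum_walsh_sum c finite_coeffs_mult)
  finally show ?thesis by (simp add: power2_eq_square mult_ac)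
qed

text \<open>The expected squared l2 norm of the gradient, computed from the values of
  \<open>V\<close> alone. It is therefore available for compositions whose chaos kernels are
  unknown.\<close>

definition energy :: "((nat \<Rightarrow> real) \<Rightarrow> real) \<Rightarrow> ennreal" where
  "energy V = (\<Sum>k. L2sq R (D p k V))"

text \<open>Lower semicontinuity of the energy under L^2 limits, up to a harmless factor 2. For the
  first n coordinates the gradient is continuous in L^2, with an error of at most 4 n times the
  squared distance; the bound left in the limit is free of n.\<close>

lemma energy_limit_le:
  assumes W: "L2_tendsto R W F sequentially" and Ws: "\<And>m. square_integrable R (W m)"
    and C: "eventually (\<lambda>m. \<forall>K. finite K \<longrightarrow> (\<Sum>k\<in>K. \<integral>\<omega>. (D p k (W m) \<omega>)\<^sup>2 \<partial>R) \<le> C) sequentially"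
  shows "energy F \<le> ennreal (2 * C)"
  unfolding energy_def
proof (rule suminf_le_const[OF summableI])
  fix n
  note F = L2_tendstoD(1)[OF W]
  have "eventually (\<lambda>m. (\<Sum>k<n. L2sq R (D p k F)) \<le> of_nat (4 * n) * L2sq R (\<lambda>\<omega>. W m \<omega> - F \<omega>) + ennreal (2 * C)) sequentially"
    using C
  proof eventually_elim
    case (elim m)
    have ds: "square_integrable R (\<lambda>\<omega>. F \<omega> - W m \<omega>)" using F Ws by (intro square_integrable_diff)
    have "L2sq R (D p k F) \<le> 4 * L2sq R (\<lambda>\<omega>. W m \<omega> - F \<omega>) + 2 * L2sq R (D p k (W m))" for k
    proof -
      have "L2sq R (D p k F) = L2sq R (\<lambda>\<omega>. D p k (\<lambda>\<omega>. F \<omega> - W m \<omega>) \<omega> + D p k (W m) \<omega>)"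
        by (simp add: D_diff)
      also have "\<dots> \<le> 2 * L2sq R (D p k (\<lambda>\<omega>. F \<omega> - W m \<omega>)) + 2 * L2sq R (D p k (W m))"
        using ds Ws by (intro L2sq_add_le square_integrable_measurable square_integrable_D)
      also have "\<dots> \<le> 2 * (2 * L2sq R (\<lambda>\<omega>. F \<omega> - W m \<omega>)) + 2 * L2sq R (D p k (W m))"
        by (intro add_mono mult_left_mono L2sq_D_le ds) auto
      finally show ?thesis
        by (simp add: L2sq_diff_commute[of R F] mult.assoc[symmetric])
    qed
    then have "(\<Sum>k<n. L2sq R (D p k F)) \<le> (\<Sum>k<n. 4 * L2sq R (\<lambda>\<omega>. W m \<omega> - F \<omega>) + 2 * L2sq R (D p k (W m)))"
      by (intro sum_mono)
    also have "\<dots> = of_nat (4 * n) * L2sq R (\<lambda>\<omega>. W m \<omega> - F \<omega>) + 2 * (\<Sum>k<n. L2sq R (D p k (W m)))"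
      by (simp add: sum.distrib sum_distrib_left mult_ac)
    also have "(\<Sum>k<n. L2sq R (D p k (W m))) = ennreal (\<Sum>k<n. \<integral>\<omega>. (D p k (W m) \<omega>)\<^sup>2 \<partial>R)"
      by (simp add: L2sq_eq_integral[OF square_integrable_D[OF Ws]])
    also have "2 * \<dots> \<le> 2 * ennreal C"
      using elim by (intro mult_left_mono ennreal_leI) auto
    also have "2 * ennreal C = ennreal (2 * C)"
      by (subst ennreal_mult') auto
    finally show ?case by simp
  qed
  moreover have "(\<lambda>m. of_nat (4 * n) * L2sq R (\<lambda>\<omega>. W m \<omega> - F \<omega>) + ennreal (2 * C)) \<longlonglongrightarrow> of_nat (4 * n) * 0 + ennreal (2 * C)"
    by (intro tendsto_add ennreal_tendsto_cmult L2_tendstoD(2)[OF W] tendsto_const) (simp add: ennreal_of_nat_eq_real_of_nat)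
  ultimately show "(\<Sum>k<n. L2sq R (D p k F)) \<le> ennreal (2 * C)"
    by (intro tendsto_lowerbound[where F=sequentially and f="\<lambda>m. of_nat (4 * n) * L2sq R (\<lambda>\<omega>. W m \<omega> - F \<omega>) + ennreal (2 * C)"]) simp_all
qed

text \<open>Membership in \<open>dom_D\<close> bounds the weighted sums of one family of kernels.
  Finite Walsh sums built from these kernels have energies below the total, and the bound passes to
  the limit F.\<close>

lemma dom_D_energy:
  assumes "F \<in> dom_D p" and EF: "(\<integral>\<omega>. F \<omega> \<partial>R) = 0"
  shows "energy F < \<infinity>"
proof -
  from assms(1) obtain f where f: "has_chaos_kernels p F f"
    and s: "summable (\<lambda>n. real n * fact n * (\<Sum>\<^sub>\<infinity>xs\<in>{xs. length xs = n}. (f n xs)\<^sup>2))"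
    by (auto simp: dom_D_def)
  let ?t = "\<lambda>n. real n * fact n * (\<Sum>\<^sub>\<infinity>xs\<in>{xs. length xs = n}. (f n xs)\<^sup>2)"
  obtain c where c: "\<And>m. finite_coeffs (c m)" "L2_tendsto R (\<lambda>m. walsh_sum (c m)) F sequentially"
    and e: "\<And>m. (\<Sum>A | c m A \<noteq> 0. real (card A) * (c m A)\<^sup>2) \<le> (\<Sum>n=1..m. ?t n)"
    by (rule chaos_approximation[OF f EF]) blast
  have "energy F \<le> ennreal (2 * suminf ?t)"
  proof (rule energy_limit_le[OF c(2)])
    show "eventually (\<lambda>m. \<forall>K. finite K \<longrightarrow> (\<Sum>k\<in>K. \<integral>\<omega>. (D p k (walsh_sum (c m)) \<omega>)\<^sup>2 \<partial>R) \<le> suminf ?t) sequentially"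
    proof (intro always_eventually allI impI)
      fix m and K :: "nat set" assume "finite K"
      then have "(\<Sum>k\<in>K. \<integral>\<omega>. (D p k (walsh_sum (c m)) \<omega>)\<^sup>2 \<partial>R) \<le> (\<Sum>A | c m A \<noteq> 0. real (card A) * (c m A)\<^sup>2)"
        by (intro sum_integral_D_walsh_sum_square c)
      also have "\<dots> \<le> (\<Sum>n=1..m. ?t n)" by (rule e)
      also have "\<dots> \<le> suminf ?t" by (intro sum_le_suminf s) (auto intro!: mult_nonneg_nonneg infsum_nonneg)
      finally show "(\<Sum>k\<in>K. \<integral>\<omega>. (D p k (walsh_sum (c m)) \<omega>)\<^sup>2 \<partial>R) \<le> suminf ?t" .
    qed
  qed simp
  then show ?thesis by (rule order.strict_trans1) simp
qed

section \<open>The pseudo-inverse and integration by parts\<close>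

lemma L2_tendsto_uminus:
  "L2_tendsto M g G \<F> \<Longrightarrow> L2_tendsto M (\<lambda>i \<omega>. - g i \<omega>) (\<lambda>\<omega>. - G \<omega>) \<F>"
  using L2sq_diff_commute[of M] by (auto simp: L2_tendsto_def)

text \<open>\<open>L_inv\<close> rests on two choices, of kernels and of a limit, and the second
  says nothing until the series is shown to converge. It does converge because dividing coefficients
  by \<open>card A\<close> does not increase the L^2 norm, so the Cauchy property is inherited from
  the sums for F.\<close>

lemma neg_L_inv_approximation:
  assumes "has_chaos_kernels p F f0" and EF: "(\<integral>\<omega>. F \<omega> \<partial>R) = 0"
  obtains c where "\<And>m. finite_coeffs (c m)" "\<And>m. c m {} = 0"
    "L2_tendsto R (\<lambda>m. walsh_sum (c m)) F sequentially"
    "L2_tendsto R (\<lambda>m. walsh_sum (\<lambda>A. c m A / card A)) (\<lambda>\<omega>. - L_inv p F \<omega>) sequentially"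
proof -
  define f where "f = (SOME f. has_chaos_kernels p F f)"
  have f: "has_chaos_kernels p F f" unfolding f_def by (rule someI[where P="has_chaos_kernels p F", OF assms(1)])
  have Js: "square_integrable R (J p n (f n))" if "n \<ge> 1" for n
    using f that by (intro square_integrable_J) (simp add: has_chaos_kernels_def)
  obtain c where c: "\<And>m. finite_coeffs (c m)" "\<And>m. c m {} = 0"
    "L2_tendsto R (\<lambda>m. walsh_sum (c m)) F sequentially"
    and d: "(\<lambda>m. L2sq R (\<lambda>\<omega>. walsh_sum (\<lambda>A. c m A / card A) \<omega> - (\<Sum>n=1..m. 1 / real n * J p n (f n) \<omega>)))
       \<longlonglongrightarrow> 0"
    by (rule chaos_approximation[OF f EF]) blast
  let ?U = "\<lambda>m. walsh_sum (\<lambda>A. c m A / card A)"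
  let ?J = "\<lambda>m \<omega>. \<Sum>n=1..m. 1 / real n * J p n (f n) \<omega>"
  note fcd = finite_coeffs_divide_card[OF c(1)]
  have le: "L2sq R (\<lambda>\<omega>. ?U l \<omega> - ?U m \<omega>) \<le> L2sq R (\<lambda>\<omega>. walsh_sum (c l) \<omega> - walsh_sum (c m) \<omega>)" for l m
  proof -
    let ?c = "\<lambda>A. c l A - c m A" and ?u = "\<lambda>A. c l A / card A - c m A / card A"
    have fc: "finite_coeffs ?c" by (intro finite_coeffs_diff c)
    have fu: "finite_coeffs ?u" by (intro finite_coeffs_diff fcd)
    have "L2sq R (\<lambda>\<omega>. ?U l \<omega> - ?U m \<omega>) = ennreal (\<integral>\<omega>. (walsh_sum ?u \<omega>)\<^sup>2 \<partial>R)"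
      by (simp add: walsh_sum_diff[OF fcd fcd, symmetric] L2sq_eq_integral)
    also have "\<dots> = ennreal (\<Sum>A | ?u A \<noteq> 0. (?u A)\<^sup>2)"
      by (simp add: integral_walsh_sum_square[OF fu])
    also have "\<dots> \<le> ennreal (\<Sum>A | ?c A \<noteq> 0. (?c A)\<^sup>2)"
    proof (rule ennreal_leI)
      have "(?u A)\<^sup>2 \<le> (?c A)\<^sup>2" for A
      proof -
        \<comment> \<open>For \<open>card A = 0\<close> division by zero gives 0, so the bound holds
          there too.\<close>
        have "\<bar>?c A / card A\<bar> \<le> \<bar>?c A\<bar>"
          using divide_left_mono[of 1 "real (card A)" "\<bar>?c A\<bar>"] by (cases "card A = 0") (auto simp: Suc_le_eq)
        then have "(?c A / card A)\<^sup>2 \<le> (?c A)\<^sup>2" unfolding abs_le_square_iff .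
        then show ?thesis by (simp add: diff_divide_distrib)
      qed
      then have "(\<Sum>A | ?u A \<noteq> 0. (?u A)\<^sup>2) \<le> (\<Sum>A | ?u A \<noteq> 0. (?c A)\<^sup>2)"
        by (intro sum_mono)
      also have "\<dots> \<le> (\<Sum>A | ?c A \<noteq> 0. (?c A)\<^sup>2)"
        using fc by (intro sum_mono2) (auto simp: finite_coeffs_def)
      finally show "(\<Sum>A | ?u A \<noteq> 0. (?u A)\<^sup>2) \<le> (\<Sum>A | ?c A \<noteq> 0. (?c A)\<^sup>2)" .
    qed
    also have "\<dots> = L2sq R (\<lambda>\<omega>. walsh_sum (c l) \<omega> - walsh_sum (c m) \<omega>)"
      by (simp add: walsh_sum_diff[OF c(1) c(1), symmetric] L2sq_eq_integral integral_walsh_sum_square[OF fc])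
    finally show ?thesis .
  qed
  have [measurable]: "F \<in> borel_measurable R" using L2_tendstoD(1)[OF c(3)] by auto
  have "\<exists>G. L2_tendsto R ?U G sequentially"
  proof (rule L2_Cauchy_convergent)
    fix e :: real assume "0 < e"
    have "eventually (\<lambda>m. L2sq R (\<lambda>\<omega>. walsh_sum (c m) \<omega> - F \<omega>) < ennreal (e/4)) sequentially"
      using L2_tendstoD(2)[OF c(3)] \<open>0 < e\<close> by (intro order_tendstoD) auto
    then obtain N where N: "\<And>m. m \<ge> N \<Longrightarrow> L2sq R (\<lambda>\<omega>. walsh_sum (c m) \<omega> - F \<omega>) < ennreal (e/4)"
      by (auto simp: eventually_sequentially)
    show "\<exists>N. \<forall>m\<ge>N. \<forall>n\<ge>N. L2sq R (\<lambda>\<omega>. ?U m \<omega> - ?U n \<omega>) \<le> ennreal e"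
    proof (intro exI[of _ N] allI impI)
      fix m n assume mn: "N \<le> m" "N \<le> n"
      have "L2sq R (\<lambda>\<omega>. ?U m \<omega> - ?U n \<omega>) \<le> L2sq R (\<lambda>\<omega>. walsh_sum (c m) \<omega> - walsh_sum (c n) \<omega>)"
        by (rule le)
      also have "\<dots> \<le> 2 * L2sq R (\<lambda>\<omega>. walsh_sum (c m) \<omega> - F \<omega>) + 2 * L2sq R (\<lambda>\<omega>. F \<omega> - walsh_sum (c n) \<omega>)"
        by (rule L2sq_triangle) measurable
      also have "\<dots> \<le> 2 * ennreal (e/4) + 2 * ennreal (e/4)"
        using N[OF mn(1)] N[OF mn(2), unfolded L2sq_diff_commute[of R "walsh_sum (c n)"]]
        by (intro add_mono mult_left_mono) simp_all
      also have "\<dots> = ennreal (2 * (e/4) + 2 * (e/4))"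
        using \<open>0 < e\<close> by (intro two_add_two_ennreal) simp
      finally show "L2sq R (\<lambda>\<omega>. ?U m \<omega> - ?U n \<omega>) \<le> ennreal e" by simp
    qed
  qed simp
  then obtain G where G: "L2_tendsto R ?U G sequentially" ..
  have Jm: "?J m \<in> borel_measurable R" for m
    using Js by (intro borel_measurable_sum borel_measurable_times square_integrable_measurable) auto
  have JG: "L2_tendsto R ?J G sequentially"
    by (rule L2_tendsto_trans[OF G _ Jm], measurable) (use d in \<open>subst L2sq_diff_commute\<close>)
  \<comment> \<open>Existence of some limit is what makes the function chosen in
    \<open>L_inv\<close> a limit as well.\<close>
  have "\<exists>G. L2_tendsto R (\<lambda>m \<omega>. - ?J m \<omega>) G sequentially"
    using L2_tendsto_uminus[OF JG] by blast
  then have "L2_tendsto R (\<lambda>m \<omega>. - ?J m \<omega>) (L_inv p F) sequentially"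
    unfolding L_inv_def Let_def L2_lim_def f_def[symmetric] by (rule someI_ex)
  from L2_tendsto_uminus[OF this]
  have JL: "L2_tendsto R ?J (\<lambda>\<omega>. - L_inv p F \<omega>) sequentially" by simp
  have "L2_tendsto R ?U (\<lambda>\<omega>. - L_inv p F \<omega>) sequentially"
    by (rule L2_tendsto_trans[OF JL Jm _ d]) measurable
  with c show thesis by (intro that)
qed

lemma energy_less_top_summable:
  assumes "energy V < \<infinity>" "square_integrable R V"
  shows "summable (\<lambda>k. \<integral>\<omega>. (D p k V \<omega>)\<^sup>2 \<partial>R)"
    and "energy V = ennreal (\<Sum>k. \<integral>\<omega>. (D p k V \<omega>)\<^sup>2 \<partial>R)"
proof -
  have *: "energy V = (\<Sum>k. ennreal (\<integral>\<omega>. (D p k V \<omega>)\<^sup>2 \<partial>R))"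
    by (simp add: energy_def L2sq_eq_integral[OF square_integrable_D[OF assms(2)]])
  show s: "summable (\<lambda>k. \<integral>\<omega>. (D p k V \<omega>)\<^sup>2 \<partial>R)"
    using assms(1) * by (intro summable_suminf_not_top) auto
  show "energy V = ennreal (\<Sum>k. \<integral>\<omega>. (D p k V \<omega>)\<^sup>2 \<partial>R)"
    unfolding * using s by (intro suminf_ennreal2) auto
qed

lemma L2_tendsto_diff_const:
  assumes "L2_tendsto M g G \<F>" "square_integrable M h"
  shows "L2_tendsto M (\<lambda>i \<omega>. g i \<omega> - h \<omega>) (\<lambda>\<omega>. G \<omega> - h \<omega>) \<F>"
  using assms unfolding L2_tendsto_def by (auto simp: algebra_simps)

text \<open>The squared norm of the gradient costs a factor \<open>card A\<close>, while division by
  \<open>card A\<close> gains its square. Hence energies of differences are controlled by L^2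
  distances of the sums for F; with m fixed, l runs to infinity by lower semicontinuity.\<close>

lemma energy_convergence:
  assumes c: "\<And>m. finite_coeffs (c m)" "\<And>m. c m {} = 0"
    and W: "L2_tendsto R (\<lambda>m. walsh_sum (c m)) F sequentially"
    and U: "L2_tendsto R (\<lambda>m. walsh_sum (\<lambda>A. c m A / card A)) U sequentially"
    and "0 < e"
  shows "\<exists>N. \<forall>m\<ge>N. energy (\<lambda>\<omega>. U \<omega> - walsh_sum (\<lambda>A. c m A / card A) \<omega>) \<le> ennreal e"
proof -
  let ?U = "\<lambda>m. walsh_sum (\<lambda>A. c m A / card A)"
  note fcd = finite_coeffs_divide_card[OF c(1)]
  have [measurable]: "F \<in> borel_measurable R" using L2_tendstoD(1)[OF W] by auto
  have le: "(\<Sum>k\<in>K. \<integral>\<omega>. (D p k (\<lambda>\<omega>. ?U l \<omega> - ?U m \<omega>) \<omega>)\<^sup>2 \<partial>R)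
      \<le> (\<integral>\<omega>. (walsh_sum (c l) \<omega> - walsh_sum (c m) \<omega>)\<^sup>2 \<partial>R)" if K: "finite K" for K l m
  proof -
    let ?c = "\<lambda>A. c l A - c m A" and ?u = "\<lambda>A. c l A / card A - c m A / card A"
    have fc: "finite_coeffs ?c" by (intro finite_coeffs_diff c)
    have fu: "finite_coeffs ?u" by (intro finite_coeffs_diff fcd)
    have "(\<Sum>k\<in>K. \<integral>\<omega>. (D p k (\<lambda>\<omega>. ?U l \<omega> - ?U m \<omega>) \<omega>)\<^sup>2 \<partial>R)
        = (\<Sum>k\<in>K. \<integral>\<omega>. (D p k (walsh_sum ?u) \<omega>)\<^sup>2 \<partial>R)"
      by (simp add: walsh_sum_diff[OF fcd fcd, symmetric, abs_def] D_def)
    also have "\<dots> \<le> (\<Sum>A | ?u A \<noteq> 0. real (card A) * (?u A)\<^sup>2)"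
      by (rule sum_integral_D_walsh_sum_square[OF fu K])
    also have "\<dots> \<le> (\<Sum>A | ?u A \<noteq> 0. (?c A)\<^sup>2)"
    proof (rule sum_mono)
      fix A
      have "card A * (?c A / card A)\<^sup>2 \<le> (?c A)\<^sup>2"
      proof (cases "card A = 0")
        case False
        then have "card A * (?c A / card A)\<^sup>2 = (?c A)\<^sup>2 / card A"
          by (simp add: power2_eq_square)
        also have "\<dots> \<le> (?c A)\<^sup>2 / 1"
          using False by (intro divide_left_mono) (auto simp: Suc_le_eq)
        finally show ?thesis by simp
      qed simp
      then show "real (card A) * (?u A)\<^sup>2 \<le> (?c A)\<^sup>2" by (simp add: diff_divide_distrib)
    qed
    also have "\<dots> \<le> (\<Sum>A | ?c A \<noteq> 0. (?c A)\<^sup>2)"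
      using fc by (intro sum_mono2) (auto simp: finite_coeffs_def)
    also have "\<dots> = (\<integral>\<omega>. (walsh_sum (c l) \<omega> - walsh_sum (c m) \<omega>)\<^sup>2 \<partial>R)"
      by (simp add: walsh_sum_diff[OF c(1) c(1), symmetric] integral_walsh_sum_square[OF fc])
    finally show ?thesis .
  qed
  \<comment> \<open>Two squared distances of e / 8, each doubled by the triangle inequality, add up
    to e / 2, and \<open>energy_limit_le\<close> doubles once more.\<close>
  have "eventually (\<lambda>m. L2sq R (\<lambda>\<omega>. walsh_sum (c m) \<omega> - F \<omega>) < ennreal (e/8)) sequentially"
    using L2_tendstoD(2)[OF W] \<open>0 < e\<close> by (intro order_tendstoD) auto
  then obtain N where N: "\<And>m. m \<ge> N \<Longrightarrow> L2sq R (\<lambda>\<omega>. walsh_sum (c m) \<omega> - F \<omega>) < ennreal (e/8)"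
    by (auto simp: eventually_sequentially)
  show ?thesis
  proof (intro exI[of _ N] allI impI)
    fix m assume m: "N \<le> m"
    have "energy (\<lambda>\<omega>. U \<omega> - ?U m \<omega>) \<le> ennreal (2 * (e/2))"
    proof (rule energy_limit_le[OF L2_tendsto_diff_const[OF U square_integrable_walsh_sum]])
      show "eventually (\<lambda>l. \<forall>K. finite K \<longrightarrow>
          (\<Sum>k\<in>K. \<integral>\<omega>. (D p k (\<lambda>\<omega>. ?U l \<omega> - ?U m \<omega>) \<omega>)\<^sup>2 \<partial>R) \<le> e/2) sequentially"
        unfolding eventually_sequentially
      proof (intro exI[of _ N] allI impI)
        fix l and K :: "nat set" assume l: "N \<le> l" and K: "finite K"
        have ds: "square_integrable R (\<lambda>\<omega>. walsh_sum (c l) \<omega> - walsh_sum (c m) \<omega>)"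
          by (intro square_integrable_diff square_integrable_walsh_sum)
        have "L2sq R (\<lambda>\<omega>. walsh_sum (c l) \<omega> - walsh_sum (c m) \<omega>)
            \<le> 2 * L2sq R (\<lambda>\<omega>. walsh_sum (c l) \<omega> - F \<omega>) + 2 * L2sq R (\<lambda>\<omega>. F \<omega> - walsh_sum (c m) \<omega>)"
          by (rule L2sq_triangle) measurable
        also have "\<dots> \<le> 2 * ennreal (e/8) + 2 * ennreal (e/8)"
          using N[OF l] N[OF m, unfolded L2sq_diff_commute[of R "walsh_sum (c m)"]]
          by (intro add_mono mult_left_mono) simp_all
        also have "\<dots> = ennreal (2 * (e/8) + 2 * (e/8))"
          using \<open>0 < e\<close> by (intro two_add_two_ennreal) simp
        finally have "(\<integral>\<omega>. (walsh_sum (c l) \<omega> - walsh_sum (c m) \<omega>)\<^sup>2 \<partial>R) \<le> e/2"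
          using \<open>0 < e\<close> by (simp add: L2sq_eq_integral[OF ds])
        with le[OF K, of l m] show "(\<Sum>k\<in>K. \<integral>\<omega>. (D p k (\<lambda>\<omega>. ?U l \<omega> - ?U m \<omega>) \<omega>)\<^sup>2 \<partial>R) \<le> e/2"
          by linarith
      qed
    qed (intro square_integrable_diff square_integrable_walsh_sum)
    then show "energy (\<lambda>\<omega>. U \<omega> - ?U m \<omega>) \<le> ennreal e" by simp
  qed
qed

lemma energy_walsh_sum:
  assumes "finite_coeffs c"
  shows "energy (walsh_sum c) < \<infinity>"
proof -
  have "L2_tendsto R (\<lambda>_::nat. walsh_sum c) (walsh_sum c) sequentially"
    by (simp add: L2_tendsto_def)
  then have "energy (walsh_sum c) \<le> ennreal (2 * (\<Sum>A | c A \<noteq> 0. real (card A) * (c A)\<^sup>2))"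
    by (rule energy_limit_le) (auto intro!: sum_integral_D_walsh_sum_square assms)
  then show ?thesis by (rule order.strict_trans1) simp
qed

lemma energy_add_le:
  assumes V: "square_integrable R V" and W: "square_integrable R W"
  shows "energy V \<le> 2 * energy (\<lambda>\<omega>. V \<omega> - W \<omega>) + 2 * energy W"
proof -
  have d: "square_integrable R (\<lambda>\<omega>. V \<omega> - W \<omega>)" using assms by (rule square_integrable_diff)
  have "energy V \<le> (\<Sum>k. 2 * L2sq R (D p k (\<lambda>\<omega>. V \<omega> - W \<omega>)) + 2 * L2sq R (D p k W))"
    unfolding energy_def
  proof (rule suminf_le[OF _ summableI summableI])
    fix k
    have "L2sq R (D p k V) = L2sq R (\<lambda>\<omega>. D p k (\<lambda>\<omega>. V \<omega> - W \<omega>) \<omega> + D p k W \<omega>)"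
      by (simp add: D_diff)
    also have "\<dots> \<le> 2 * L2sq R (D p k (\<lambda>\<omega>. V \<omega> - W \<omega>)) + 2 * L2sq R (D p k W)"
      using d W by (intro L2sq_add_le square_integrable_measurable square_integrable_D)
    finally show "L2sq R (D p k V) \<le> 2 * L2sq R (D p k (\<lambda>\<omega>. V \<omega> - W \<omega>)) + 2 * L2sq R (D p k W)" .
  qed
  also have "\<dots> = 2 * energy (\<lambda>\<omega>. V \<omega> - W \<omega>) + 2 * energy W"
    by (simp add: energy_def suminf_add[symmetric] summableI ennreal_suminf_cmult)
  finally show ?thesis .
qed

text \<open>The pairing of two gradients, again in weighted form, so that a fixed energy of G can be
  made to count little against a small energy of \<open>V\<close>.\<close>

lemma summable_integral_mult_D:
  assumes "square_integrable R G" "energy G < \<infinity>" "square_integrable R V" "energy V < \<infinity>" and r: "0 < r"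
  shows "summable (\<lambda>k. \<integral>\<omega>. D p k G \<omega> * D p k V \<omega> \<partial>R)"
    and "\<bar>\<Sum>k. \<integral>\<omega>. D p k G \<omega> * D p k V \<omega> \<partial>R\<bar>
      \<le> r * (\<Sum>k. \<integral>\<omega>. (D p k G \<omega>)\<^sup>2 \<partial>R) + (\<Sum>k. \<integral>\<omega>. (D p k V \<omega>)\<^sup>2 \<partial>R) / r"
proof -
  let ?a = "\<lambda>k. \<integral>\<omega>. D p k G \<omega> * D p k V \<omega> \<partial>R"
  let ?b = "\<lambda>k. r * (\<integral>\<omega>. (D p k G \<omega>)\<^sup>2 \<partial>R) + (\<integral>\<omega>. (D p k V \<omega>)\<^sup>2 \<partial>R) / r"
  note sG = energy_less_top_summable(1)[OF assms(2,1)] and sV = energy_less_top_summable(1)[OF assms(4,3)]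
  have le: "norm (?a k) \<le> ?b k" for k
    using abs_integral_mult_le[OF square_integrable_D[OF assms(1)] square_integrable_D[OF assms(3)] r] by simp
  have sb: "summable ?b" by (intro summable_add summable_mult summable_divide sG sV)
  show s: "summable ?a" by (rule summable_comparison_test'[OF sb, of 0]) (rule le)
  have "\<bar>suminf ?a\<bar> \<le> suminf ?b"
    using le sb by (intro order_trans[OF _ norm_suminf_le[of ?a ?b]]) auto
  also have "\<dots> = r * (\<Sum>k. \<integral>\<omega>. (D p k G \<omega>)\<^sup>2 \<partial>R) + (\<Sum>k. \<integral>\<omega>. (D p k V \<omega>)\<^sup>2 \<partial>R) / r"
    by (simp add: suminf_add[symmetric] suminf_mult suminf_divide summable_mult summable_divide sG sV)
  finally show "\<bar>suminf ?a\<bar> \<le> r * (\<Sum>k. \<integral>\<omega>. (D p k G \<omega>)\<^sup>2 \<partial>R) + (\<Sum>k. \<integral>\<omega>. (D p k V \<omega>)\<^sup>2 \<partial>R) / r" .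
qed

text \<open>For finite Walsh sums this is the adjoint identity. In the limit the expectation
  converges because the sums approach F in L^2, and the sum over k because their gradients approach
  that of the negated pseudo-inverse in energy. G enters only through square integrability and
  finite energy.\<close>

theorem integration_by_parts:
  assumes F: "has_chaos_kernels p F f" "(\<integral>\<omega>. F \<omega> \<partial>R) = 0"
    and G: "square_integrable R G" "energy G < \<infinity>"
  shows "square_integrable R (L_inv p F)" "energy (\<lambda>\<omega>. - L_inv p F \<omega>) < \<infinity>"
    "(\<lambda>k. \<integral>\<omega>. D p k G \<omega> * D p k (\<lambda>\<omega>. - L_inv p F \<omega>) \<omega> \<partial>R) sums (\<integral>\<omega>. F \<omega> * G \<omega> \<partial>R)"
proof -
  define U where "U \<omega> = - L_inv p F \<omega>" for \<omega>
  obtain c where c: "\<And>m. finite_coeffs (c m)" "\<And>m. c m {} = 0"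
    and W: "L2_tendsto R (\<lambda>m. walsh_sum (c m)) F sequentially"
    and U: "L2_tendsto R (\<lambda>m. walsh_sum (\<lambda>A. c m A / card A)) U sequentially"
    unfolding U_def[abs_def] by (rule neg_L_inv_approximation[OF F]) blast
  let ?U = "\<lambda>m. walsh_sum (\<lambda>A. c m A / card A)"
  note fcd = finite_coeffs_divide_card[OF c(1)]
  note Us = L2_tendstoD(1)[OF U]
  show "square_integrable R (L_inv p F)"
    using square_integrable_uminus[OF Us] by (simp add: U_def)
  have EU: "energy U < \<infinity>"
  proof -
    obtain N where N: "\<And>m. m \<ge> N \<Longrightarrow> energy (\<lambda>\<omega>. U \<omega> - ?U m \<omega>) \<le> ennreal 1"
      using energy_convergence[OF c W U, of 1] by auto
    have "energy U \<le> 2 * energy (\<lambda>\<omega>. U \<omega> - ?U N \<omega>) + 2 * energy (?U N)"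
      by (intro energy_add_le Us square_integrable_walsh_sum)
    also have "\<dots> < \<infinity>"
      using N[of N] energy_walsh_sum[OF fcd[of N]] by (auto simp: ennreal_mult_less_top intro: le_less_trans)
    finally show ?thesis .
  qed
  then show "energy (\<lambda>\<omega>. - L_inv p F \<omega>) < \<infinity>" by (simp add: U_def[abs_def])
  let ?g = "\<Sum>k. \<integral>\<omega>. (D p k G \<omega>)\<^sup>2 \<partial>R"
  have g0: "0 \<le> ?g" by (intro suminf_nonneg energy_less_top_summable G) simp
  have lim: "(\<lambda>m. \<integral>\<omega>. walsh_sum (c m) \<omega> * G \<omega> \<partial>R) \<longlonglongrightarrow> (\<integral>\<omega>. F \<omega> * G \<omega> \<partial>R)"
    by (intro L2_tendsto_integral_mult W G square_integrable_walsh_sum)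
  have fin: "(\<integral>\<omega>. walsh_sum (c m) \<omega> * G \<omega> \<partial>R) = (\<Sum>k. \<integral>\<omega>. D p k G \<omega> * D p k (?U m) \<omega> \<partial>R)" for m
  proof -
    let ?K = "\<Union>{A. c m A \<noteq> 0}"
    have fK: "finite ?K" using c(1)[of m] by (auto simp: finite_coeffs_def)
    have "walsh_sum (c m) = walsh_sum (\<lambda>A. real (card A) * (c m A / card A))"
    proof -
      \<comment> \<open>Multiplication by \<open>card A\<close> undoes the division because
        \<open>c m\<close> vanishes at the empty set, which a centred F permits.\<close>
      have "c m = (\<lambda>A. real (card A) * (c m A / card A))"
        using c(1,2)[of m] by (intro ext) (auto simp: finite_coeffs_def)
      then show ?thesis by simp
    qed
    moreover have "(\<Sum>k\<in>?K. \<integral>\<omega>. D p k G \<omega> * D p k (?U m) \<omega> \<partial>R)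
        = (\<integral>\<omega>. walsh_sum (\<lambda>A. real (card A) * (c m A / card A)) \<omega> * G \<omega> \<partial>R)"
      by (rule sum_integral_D_walsh_sum[OF fcd G(1) fK]) auto
    ultimately have "(\<integral>\<omega>. walsh_sum (c m) \<omega> * G \<omega> \<partial>R) = (\<Sum>k\<in>?K. \<integral>\<omega>. D p k G \<omega> * D p k (?U m) \<omega> \<partial>R)"
      by (simp only:)
    also have "\<dots> = (\<Sum>k. \<integral>\<omega>. D p k G \<omega> * D p k (?U m) \<omega> \<partial>R)"
    proof (rule suminf_finite[OF fK, symmetric])
      fix k assume "k \<notin> ?K"
      then have "D p k (?U m) \<omega> = 0" for \<omega>
        unfolding D_walsh_sum[OF fcd] by (intro sum.neutral) auto
      then show "(\<integral>\<omega>. D p k G \<omega> * D p k (?U m) \<omega> \<partial>R) = 0" by simp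
    qed
    finally show ?thesis .
  qed
  have "(\<lambda>m. \<Sum>k. \<integral>\<omega>. D p k G \<omega> * D p k (?U m) \<omega> \<partial>R) \<longlonglongrightarrow> (\<Sum>k. \<integral>\<omega>. D p k G \<omega> * D p k U \<omega> \<partial>R)"
  proof (rule LIMSEQ_I)
    fix e :: real assume "0 < e"
    \<comment> \<open>With this weight the energy of G contributes less than e / 2. The energy of
      the difference is then required to be at most r e / 2, which contributes at most e / 2 after
      division by r.\<close>
    define r where "r = e / (3 * (?g + 1))"
    have r: "0 < r" using g0 \<open>0 < e\<close> by (simp add: r_def)
    have rg: "r * ?g < e / 2" using g0 \<open>0 < e\<close> by (simp add: r_def field_simps add_pos_nonneg)
    obtain N where N: "\<And>m. m \<ge> N \<Longrightarrow> energy (\<lambda>\<omega>. U \<omega> - ?U m \<omega>) \<le> ennreal (r * e / 2)"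
      using energy_convergence[OF c W U, of "r * e / 2"] r \<open>0 < e\<close> by auto
    show "\<exists>N. \<forall>m\<ge>N. norm ((\<Sum>k. \<integral>\<omega>. D p k G \<omega> * D p k (?U m) \<omega> \<partial>R) - (\<Sum>k. \<integral>\<omega>. D p k G \<omega> * D p k U \<omega> \<partial>R)) < e"
    proof (intro exI[of _ N] allI impI)
      fix m assume m: "N \<le> m"
      let ?d = "\<lambda>\<omega>. U \<omega> - ?U m \<omega>"
      have ds: "square_integrable R ?d" by (intro square_integrable_diff Us square_integrable_walsh_sum)
      have dE: "energy ?d < \<infinity>" using N[OF m] by (rule order.strict_trans1) simp
      have "ennreal (\<Sum>k. \<integral>\<omega>. (D p k ?d \<omega>)\<^sup>2 \<partial>R) \<le> ennreal (r * e / 2)"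
        using N[OF m] by (simp add: energy_less_top_summable(2)[OF dE ds])
      then have "(\<Sum>k. \<integral>\<omega>. (D p k ?d \<omega>)\<^sup>2 \<partial>R) \<le> r * e / 2"
        using r \<open>0 < e\<close> by simp
      then have q: "(\<Sum>k. \<integral>\<omega>. (D p k ?d \<omega>)\<^sup>2 \<partial>R) / r \<le> e / 2"
        using r by (simp add: field_simps)
      have "(\<Sum>k. \<integral>\<omega>. D p k G \<omega> * D p k U \<omega> \<partial>R) - (\<Sum>k. \<integral>\<omega>. D p k G \<omega> * D p k (?U m) \<omega> \<partial>R)
          = (\<Sum>k. (\<integral>\<omega>. D p k G \<omega> * D p k U \<omega> \<partial>R) - (\<integral>\<omega>. D p k G \<omega> * D p k (?U m) \<omega> \<partial>R))"
        by (intro suminf_diff summable_integral_mult_D(1)[where r=1] G Us EU energy_walsh_sum[OF fcd]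
             square_integrable_walsh_sum) simp_all
      also have "\<dots> = (\<Sum>k. \<integral>\<omega>. D p k G \<omega> * D p k ?d \<omega> \<partial>R)"
      proof (intro arg_cong[where f=suminf] ext)
        fix k
        show "(\<integral>\<omega>. D p k G \<omega> * D p k U \<omega> \<partial>R) - (\<integral>\<omega>. D p k G \<omega> * D p k (?U m) \<omega> \<partial>R)
          = (\<integral>\<omega>. D p k G \<omega> * D p k ?d \<omega> \<partial>R)"
          unfolding D_diff right_diff_distrib
          by (intro Bochner_Integration.integral_diff[symmetric] integrable_mult_square_integrable
             square_integrable_D G Us square_integrable_walsh_sum)
      qed
      finally show "norm ((\<Sum>k. \<integral>\<omega>. D p k G \<omega> * D p k (?U m) \<omega> \<partial>R) - (\<Sum>k. \<integral>\<omega>. D p k G \<omega> * D p k U \<omega> \<partial>R)) < e"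
        using summable_integral_mult_D(2)[OF G ds dE r] q rg unfolding real_norm_def by linarith
    qed
  qed
  with lim have "(\<Sum>k. \<integral>\<omega>. D p k G \<omega> * D p k U \<omega> \<partial>R) = (\<integral>\<omega>. F \<omega> * G \<omega> \<partial>R)"
    unfolding fin by (rule LIMSEQ_unique[symmetric])
  then show "(\<lambda>k. \<integral>\<omega>. D p k G \<omega> * D p k (\<lambda>\<omega>. - L_inv p F \<omega>) \<omega> \<partial>R) sums (\<integral>\<omega>. F \<omega> * G \<omega> \<partial>R)"
    using summable_integral_mult_D(1)[OF G Us EU zero_less_one] unfolding U_def[abs_def, symmetric]
    by (simp add: sums_iff)
qed

end

section \<open>Taylor expansion of test functions\<close>

lemma DERIV_le_imp_le:
  fixes f g :: "real \<Rightarrow> real"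
  assumes "a \<le> b" "\<And>x. a \<le> x \<Longrightarrow> x \<le> b \<Longrightarrow> (f has_real_derivative f' x) (at x)"
    "\<And>x. a \<le> x \<Longrightarrow> x \<le> b \<Longrightarrow> (g has_real_derivative g' x) (at x)"
    "\<And>x. a \<le> x \<Longrightarrow> x \<le> b \<Longrightarrow> f' x \<le> g' x"
  shows "f b - f a \<le> g b - g a"
proof -
  have "g a - f a \<le> g b - f b"
  proof (rule DERIV_nonneg_imp_nondecreasing[of a b "\<lambda>x. g x - f x"])
    fix x assume "a \<le> x" "x \<le> b"
    then show "\<exists>y. ((\<lambda>x. g x - f x) has_real_derivative y) (at x) \<and> 0 \<le> y"
      using assms by (intro exI[of _ "g' x - f' x"] conjI DERIV_diff) auto
  qed (fact assms)
  then show ?thesis by simp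
qed

lemma abs_DERIV_le_imp_le:
  fixes f g :: "real \<Rightarrow> real"
  assumes "a \<le> b" "\<And>x. a \<le> x \<Longrightarrow> x \<le> b \<Longrightarrow> (f has_real_derivative f' x) (at x)"
    "\<And>x. a \<le> x \<Longrightarrow> x \<le> b \<Longrightarrow> (g has_real_derivative g' x) (at x)"
    "\<And>x. a \<le> x \<Longrightarrow> x \<le> b \<Longrightarrow> \<bar>f' x\<bar> \<le> g' x"
  shows "\<bar>f b - f a\<bar> \<le> g b - g a"
proof -
  have "f b - f a \<le> g b - g a"
    by (rule DERIV_le_imp_le[OF assms(1,2,3)]) (use assms(4) abs_le_D1 in blast)+
  moreover have "(- f b) - (- f a) \<le> g b - g a"
    by (rule DERIV_le_imp_le[OF assms(1) DERIV_minus[OF assms(2)] assms(3)]) (use assms(4) abs_le_D2 in blast)+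
  ultimately show ?thesis by linarith
qed

text \<open>A linear bound on the change of the second derivative takes the place of a bounded third
  derivative. Integrating L t once and twice gives the denominators 2 and 6.\<close>

lemma taylor_lipschitz_second_derivative:
  fixes \<phi> \<phi>1 \<phi>2 :: "real \<Rightarrow> real"
  assumes 1: "\<And>t. (\<phi> has_real_derivative \<phi>1 t) (at t)" and 2: "\<And>t. (\<phi>1 has_real_derivative \<phi>2 t) (at t)"
    and L: "\<And>t. 0 \<le> t \<Longrightarrow> \<bar>\<phi>2 t - \<phi>2 0\<bar> \<le> L * t"
  shows "\<bar>\<phi>1 1 - \<phi>1 0 - \<phi>2 0\<bar> \<le> L / 2"
    and "\<bar>\<phi> 1 - \<phi> 0 - \<phi>1 0 - \<phi>2 0 / 2\<bar> \<le> L / 6"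
proof -
  have e: "\<bar>\<phi>1 t - \<phi>1 0 - t * \<phi>2 0\<bar> \<le> L * t\<^sup>2 / 2" if "0 \<le> t" for t
  proof -
    have "\<bar>(\<phi>1 t - t * \<phi>2 0) - (\<phi>1 0 - 0 * \<phi>2 0)\<bar> \<le> L * t\<^sup>2 / 2 - L * 0\<^sup>2 / 2"
      using that L
      by (intro abs_DERIV_le_imp_le[where f'="\<lambda>t. \<phi>2 t - \<phi>2 0" and g'="\<lambda>t. L * t"])
         (auto intro!: derivative_eq_intros 2)
    then show ?thesis by (simp add: algebra_simps)
  qed
  show "\<bar>\<phi>1 1 - \<phi>1 0 - \<phi>2 0\<bar> \<le> L / 2"
    using e[of 1] by simp
  have "\<bar>(\<phi> 1 - 1 * \<phi>1 0 - 1\<^sup>2 / 2 * \<phi>2 0) - (\<phi> 0 - 0 * \<phi>1 0 - 0\<^sup>2 / 2 * \<phi>2 0)\<bar> \<le> L * 1 ^ 3 / 6 - L * 0 ^ 3 / 6"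
    using e
    by (intro abs_DERIV_le_imp_le[where f'="\<lambda>t. \<phi>1 t - \<phi>1 0 - t * \<phi>2 0" and g'="\<lambda>t. L * t\<^sup>2 / 2"])
       (auto intro!: derivative_eq_intros 1 simp: power2_eq_square)
  then show "\<bar>\<phi> 1 - \<phi> 0 - \<phi>1 0 - \<phi>2 0 / 2\<bar> \<le> L / 6" by (simp add: algebra_simps)
qed

text \<open>Serves for test functions along a line and for differentiating an expectation, where it
  takes the place of dominated convergence.\<close>

lemma DERIV_from_quadratic_bound:
  fixes f :: "real \<Rightarrow> real"
  assumes "\<And>h. \<bar>f (t + h) - f t - h * d\<bar> \<le> C * h\<^sup>2"
  shows "(f has_real_derivative d) (at t)"
  unfolding DERIV_def
proof (rule LIM_zero_cancel, rule tendsto_rabs_zero_cancel, rule tendsto_sandwich[OF _ _ tendsto_const])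
  show "eventually (\<lambda>h. \<bar>(f (t + h) - f t) / h - d\<bar> \<le> C * \<bar>h\<bar>) (at 0)"
  proof (rule eventually_at_filter[THEN iffD2], intro always_eventually allI impI)
    fix h :: real assume h: "h \<noteq> 0"
    have "\<bar>(f (t + h) - f t) / h - d\<bar> = \<bar>f (t + h) - f t - h * d\<bar> / \<bar>h\<bar>"
      using h by (simp add: abs_divide[symmetric] diff_divide_distrib)
    also have "\<dots> \<le> C * h\<^sup>2 / \<bar>h\<bar>" by (intro divide_right_mono assms) simp
    also have "\<dots> = C * \<bar>h\<bar>" using h by (simp add: power2_eq_square abs_if)
    finally show "\<bar>(f (t + h) - f t) / h - d\<bar> \<le> C * \<bar>h\<bar>" .
  qed
  have "((\<lambda>h. C * \<bar>h\<bar>) \<longlongrightarrow> C * \<bar>0\<bar>) (at (0::real))" by (intro tendsto_intros)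
  then show "((\<lambda>h. C * \<bar>h\<bar>) \<longlongrightarrow> 0) (at (0::real))" by simp
qed simp

text \<open>The norm that matches the test class: each partial derivative is bounded by 1
  separately, so a directional derivative along v is bounded by \<open>l1 v\<close>. It is also the
  source of the sums over j of absolute values in the second and third bound.\<close>

definition l1 :: "real ^ 'd::finite \<Rightarrow> real" where
  "l1 v = (\<Sum>i\<in>UNIV. \<bar>v $ i\<bar>)"

lemma l1_nonneg[simp]: "0 \<le> l1 v"
  by (simp add: l1_def sum_nonneg)

lemma l1_scaleR: "l1 (t *\<^sub>R v) = \<bar>t\<bar> * l1 v"
  by (simp add: l1_def abs_mult sum_distrib_left)

lemma l1_triangle: "l1 (v + w) \<le> l1 v + l1 w"
  unfolding l1_def sum.distrib[symmetric] by (intro sum_mono) (simp add: abs_triangle_ineq)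

lemma l1_le_norm: "l1 (v :: real ^ 'd::finite) \<le> real CARD('d) * norm v"
proof -
  have "l1 v \<le> (\<Sum>i::'d\<in>UNIV. norm v)" unfolding l1_def by (intro sum_mono component_le_norm_cart)
  then show ?thesis by simp
qed

lemma continuous_l1: "continuous_on UNIV (l1 :: real ^ 'd::finite \<Rightarrow> real)"
  unfolding l1_def by (intro continuous_intros)

lemma borel_measurable_l1[measurable]: "l1 \<in> borel_measurable borel"
  by (rule borel_measurable_continuous_onI[OF continuous_l1])

lemma sum_axis: "(\<Sum>i\<in>UNIV. v $ i *\<^sub>R axis i 1) = (v :: real ^ 'd::finite)"
  using basis_expansion[of v] by (simp add: scalar_mult_eq_scaleR)

lemma abs_sum_mult_le_l1:
  assumes "\<And>i. \<bar>a i\<bar> \<le> B"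
  shows "\<bar>\<Sum>i\<in>UNIV. v $ i * a i\<bar> \<le> l1 v * B"
proof -
  have "\<bar>\<Sum>i\<in>UNIV. v $ i * a i\<bar> \<le> (\<Sum>i\<in>UNIV. \<bar>v $ i * a i\<bar>)" by (rule sum_abs)
  also have "\<dots> \<le> (\<Sum>i\<in>UNIV. \<bar>v $ i\<bar> * B)"
    unfolding abs_mult by (intro sum_mono mult_left_mono assms) simp
  finally show ?thesis by (simp add: l1_def sum_distrib_right)
qed

section \<open>Expansions of test functions\<close>

locale test_function =
  fixes g :: "real ^ 'd::finite \<Rightarrow> real"
  assumes g_test: "g \<in> d4_test"
begin

abbreviation P :: "'d list \<Rightarrow> real ^ 'd \<Rightarrow> real" where "P is \<equiv> iter_partial is g"

lemma bounded_P:
  assumes "1 \<le> length is" "length is \<le> 4"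
  shows "\<bar>P is x\<bar> \<le> 1"
proof -
  have "ennreal \<bar>P is x\<bar> \<le> M_sup (length is) g"
    unfolding M_sup_def by (rule SUP_upper2[of "is"], simp, rule SUP_upper) simp
  also have "\<dots> \<le> 1" using g_test assms by (auto simp: d4_test_def)
  finally show ?thesis by simp
qed

lemma DERIV_P_axis:
  assumes "length is < 4"
  shows "((\<lambda>t. P is (x + t *\<^sub>R axis i 1)) has_real_derivative P (i # is) (x + t *\<^sub>R axis i 1)) (at t)"
proof -
  let ?y = "x + t *\<^sub>R axis i 1"
  have "(\<lambda>s. P is (?y + s *\<^sub>R axis i 1)) field_differentiable at 0"
    using g_test assms by (auto simp: d4_test_def partially_differentiable_def)
  then have "((\<lambda>s. P is (?y + s *\<^sub>R axis i 1)) has_real_derivative P (i # is) ?y) (at 0)"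
    by (simp add: partial_deriv_def DERIV_deriv_iff_field_differentiable)
  then show ?thesis
    using DERIV_shift[of "\<lambda>t. P is (x + t *\<^sub>R axis i 1)" "P (i # is) ?y" 0 t]
    by (simp add: algebra_simps)
qed

lemma P_axis_mvt:
  assumes "length is < 4"
  shows "\<exists>s. \<bar>s\<bar> \<le> \<bar>h\<bar> \<and> P is (x + h *\<^sub>R axis i 1) - P is x = h * P (i # is) (x + s *\<^sub>R axis i 1)"
proof -
  note d = DERIV_P_axis[OF assms, of x i]
  consider "h = 0" | "0 < h" | "h < 0" by linarith
  then show ?thesis
  proof cases
    case 2
    from MVT2[OF this d] obtain z where "0 < z" "z < h"
      "P is (x + h *\<^sub>R axis i 1) - P is (x + 0 *\<^sub>R axis i 1) = (h - 0) * P (i # is) (x + z *\<^sub>R axis i 1)"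
      by blast
    then show ?thesis by (intro exI[of _ z]) auto
  next
    case 3
    from MVT2[OF this d] obtain z where "h < z" "z < 0"
      "P is (x + 0 *\<^sub>R axis i 1) - P is (x + h *\<^sub>R axis i 1) = (0 - h) * P (i # is) (x + z *\<^sub>R axis i 1)"
      by blast
    then show ?thesis by (intro exI[of _ z]) auto
  qed auto
qed

text \<open>Only partial derivatives are available, so the displacement is made one axis at a time,
  with the mean value theorem on each. The induction is over the set of axes already used.\<close>

lemma P_lipschitz:
  assumes "length is < 4"
  shows "\<bar>P is (x + v) - P is x\<bar> \<le> l1 v"
proof -
  have "\<bar>P is (x + (\<Sum>i\<in>I. v $ i *\<^sub>R axis i 1)) - P is x\<bar> \<le> (\<Sum>i\<in>I. \<bar>v $ i\<bar>)" if "finite I" for I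
    using that
  proof (induction I)
    case (insert j I)
    let ?y = "x + (\<Sum>i\<in>I. v $ i *\<^sub>R axis i 1)"
    obtain s where "P is (?y + v $ j *\<^sub>R axis j 1) - P is ?y = v $ j * P (j # is) (?y + s *\<^sub>R axis j 1)"
      using P_axis_mvt[OF assms] by blast
    then have 1: "\<bar>P is (?y + v $ j *\<^sub>R axis j 1) - P is ?y\<bar> \<le> \<bar>v $ j\<bar>"
      using bounded_P[of "j # is"] assms by (simp add: abs_mult mult_left_le)
    have y: "x + (\<Sum>i\<in>insert j I. v $ i *\<^sub>R axis i 1) = ?y + v $ j *\<^sub>R axis j 1"
      using insert by (simp add: algebra_simps)
    have l: "(\<Sum>i\<in>insert j I. \<bar>v $ i\<bar>) = (\<Sum>i\<in>I. \<bar>v $ i\<bar>) + \<bar>v $ j\<bar>"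
      using insert by simp
    have arith: "\<bar>a - c\<bar> \<le> y + z" if "\<bar>a - b\<bar> \<le> z" "\<bar>b - c\<bar> \<le> y" for a b c y z :: real
      using that by linarith
    show ?case unfolding y l by (rule arith[OF 1 insert.IH])
  qed simp
  from this[of UNIV] show ?thesis by (simp add: sum_axis l1_def)
qed

text \<open>The same walk along the axes. The derivative met on each axis is compared with the one
  at the start by the Lipschitz bound one order higher. This upgrades partial derivatives to
  derivatives in every direction.\<close>

lemma P_first_order:
  assumes "length is < 3"
  shows "\<bar>P is (x + v) - P is x - (\<Sum>i\<in>UNIV. v $ i * P (i # is) x)\<bar> \<le> (l1 v)\<^sup>2"
proof -
  have "\<bar>P is (x + (\<Sum>i\<in>I. v $ i *\<^sub>R axis i 1)) - P is x - (\<Sum>i\<in>I. v $ i * P (i # is) x)\<bar>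
      \<le> (\<Sum>i\<in>I. \<bar>v $ i\<bar>)\<^sup>2" if "finite I" for I
    using that
  proof (induction I)
    case (insert j I)
    let ?w = "\<Sum>i\<in>I. v $ i *\<^sub>R axis i 1 :: real ^ 'd"
    let ?y = "x + ?w" and ?a = "\<Sum>i\<in>I. \<bar>v $ i\<bar>" and ?b = "\<bar>v $ j\<bar>"
    have a0: "0 \<le> ?a" by (simp add: sum_nonneg)
    obtain s where s: "\<bar>s\<bar> \<le> ?b"
      and eq: "P is (?y + v $ j *\<^sub>R axis j 1) - P is ?y = v $ j * P (j # is) (?y + s *\<^sub>R axis j 1)"
      using P_axis_mvt[of "is" "v $ j" ?y j] assms by auto
    have "l1 (?w + s *\<^sub>R axis j 1) \<le> l1 ?w + l1 (s *\<^sub>R axis j 1 :: real ^ 'd)" by (rule l1_triangle)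
    also have "l1 ?w = ?a"
    proof -
      have "?w $ k = (if k \<in> I then v $ k else 0)" for k
        using insert(1) by (simp add: axis_def if_distrib sum.delta cong: if_cong)
      then have "l1 ?w = (\<Sum>k\<in>UNIV. if k \<in> I then \<bar>v $ k\<bar> else 0)"
        unfolding l1_def by (intro sum.cong) auto
      also have "\<dots> = ?a" by (simp add: sum.If_cases)
      finally show ?thesis .
    qed
    also have "l1 (s *\<^sub>R axis j 1 :: real ^ 'd) = \<bar>s\<bar>"
      unfolding l1_scaleR by (simp add: l1_def axis_def if_distrib cong: if_cong)
    finally have l: "l1 (?w + s *\<^sub>R axis j 1) \<le> ?a + ?b" using s by linarith
    have "\<bar>P (j # is) (x + (?w + s *\<^sub>R axis j 1)) - P (j # is) x\<bar> \<le> ?a + ?b"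
      using P_lipschitz[of "j # is" x "?w + s *\<^sub>R axis j 1"] assms l by simp
    then have "?b * \<bar>P (j # is) (x + (?w + s *\<^sub>R axis j 1)) - P (j # is) x\<bar> \<le> ?b * (?a + ?b)"
      by (intro mult_left_mono) auto
    then have 1: "\<bar>P is (?y + v $ j *\<^sub>R axis j 1) - P is ?y - v $ j * P (j # is) x\<bar> \<le> ?b * (?a + ?b)"
      unfolding eq right_diff_distrib[symmetric] abs_mult by (simp add: add.assoc)
    have 2: "\<bar>P is ?y - P is x - (\<Sum>i\<in>I. v $ i * P (i # is) x)\<bar> \<le> ?a\<^sup>2" by (rule insert.IH)
    have 3: "?a\<^sup>2 + ?b * (?a + ?b) \<le> (?a + ?b)\<^sup>2"
      using a0 by (simp add: power2_eq_square algebra_simps)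
    have y: "x + (\<Sum>i\<in>insert j I. v $ i *\<^sub>R axis i 1) = ?y + v $ j *\<^sub>R axis j 1"
      using insert by (simp add: algebra_simps)
    have sums: "(\<Sum>i\<in>insert j I. v $ i * P (i # is) x) = v $ j * P (j # is) x + (\<Sum>i\<in>I. v $ i * P (i # is) x)"
      "(\<Sum>i\<in>insert j I. \<bar>v $ i\<bar>) = ?a + ?b"
      using insert by simp_all
    have arith: "\<bar>a - c - (u + w)\<bar> \<le> n" if "\<bar>a - b - u\<bar> \<le> k" "\<bar>b - c - w\<bar> \<le> m" "m + k \<le> n"
      for a b c u w k m n :: real
      using that by linarith
    show ?case unfolding y sums by (rule arith[OF 1 2 3])
  qed simp
  from this[of UNIV] show ?thesis by (simp add: sum_axis l1_def)
qed

lemma DERIV_P_line: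
  assumes "length is < 3"
  shows "((\<lambda>t. P is (x + t *\<^sub>R v)) has_real_derivative (\<Sum>i\<in>UNIV. v $ i * P (i # is) (x + t *\<^sub>R v))) (at t)"
proof (rule DERIV_from_quadratic_bound[where C="(l1 v)\<^sup>2"])
  fix h
  show "\<bar>P is (x + (t + h) *\<^sub>R v) - P is (x + t *\<^sub>R v) - h * (\<Sum>i\<in>UNIV. v $ i * P (i # is) (x + t *\<^sub>R v))\<bar> \<le> (l1 v)\<^sup>2 * h\<^sup>2"
    using P_first_order[OF assms, of "x + t *\<^sub>R v" "h *\<^sub>R v"]
    by (simp add: l1_scaleR power_mult_distrib scaleR_add_left add.assoc sum_distrib_left mult_ac)
qed

lemma continuous_P:
  assumes "length is < 4"
  shows "continuous_on UNIV (P is)"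
proof (rule continuous_onI)
  fix x :: "real ^ 'd" and e :: real assume "0 < e"
  let ?d = "e / (2 * real CARD('d))"
  have d: "0 < ?d" using \<open>0 < e\<close> by simp
  have "dist (P is y) (P is x) \<le> e" if "dist y x < ?d" for y
  proof -
    have "dist (P is y) (P is x) \<le> l1 (y - x)"
      using P_lipschitz[OF assms, of x "y - x"] by (simp add: dist_real_def)
    also have "\<dots> \<le> real CARD('d) * norm (y - x)" by (rule l1_le_norm)
    also have "\<dots> \<le> real CARD('d) * ?d"
      using that by (intro mult_left_mono) (auto simp: dist_norm)
    also have "\<dots> \<le> e" using \<open>0 < e\<close> by simp
    finally show ?thesis .
  qed
  with d show "\<exists>d>0. \<forall>y\<in>UNIV. dist y x < d \<longrightarrow> dist (P is y) (P is x) \<le> e" by blast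
qed

lemma borel_measurable_P[measurable]:
  "length is < 4 \<Longrightarrow> P is \<in> borel_measurable borel"
  by (intro borel_measurable_continuous_onI continuous_P)

text \<open>The partial derivatives of highest order enter only through the Lipschitz bound they
  give one order below. The spelling \<open>x + 0 *\<^sub>R v\<close> matches the value at 0 in the
  one-dimensional Taylor lemma.\<close>

lemma P_line_second_lipschitz:
  assumes "length is < 2" "0 \<le> t"
  shows "\<bar>(\<Sum>i\<in>UNIV. v $ i * (\<Sum>j\<in>UNIV. v $ j * P (j # i # is) (x + t *\<^sub>R v)))
      - (\<Sum>i\<in>UNIV. v $ i * (\<Sum>j\<in>UNIV. v $ j * P (j # i # is) (x + 0 *\<^sub>R v)))\<bar> \<le> l1 v ^ 3 * t"
proof -
  have "\<bar>\<Sum>i\<in>UNIV. v $ i * (\<Sum>j\<in>UNIV. v $ j * (P (j # i # is) (x + t *\<^sub>R v) - P (j # i # is) x))\<bar>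
      \<le> l1 v * (l1 v * (t * l1 v))"
    using P_lipschitz[of "_ # _ # is" x "t *\<^sub>R v"] assms
    by (intro abs_sum_mult_le_l1) (simp add: l1_scaleR)
  then show ?thesis
    by (simp add: sum_subtractf right_diff_distrib power3_eq_cube mult_ac)
qed

text \<open>Both are one-dimensional expansions along the segment from x to x + v; the second one
  expands the directional derivative at the far end.\<close>

lemma P_taylor2:
  assumes "length is < 2"
  shows "\<bar>P is (x + v) - P is x - (\<Sum>i\<in>UNIV. v $ i * P (i # is) x)
     - (\<Sum>i\<in>UNIV. v $ i * (\<Sum>j\<in>UNIV. v $ j * P (j # i # is) x)) / 2\<bar> \<le> l1 v ^ 3 / 6"
  and P_gradient_taylor1:
    "\<bar>(\<Sum>i\<in>UNIV. v $ i * P (i # is) (x + v)) - (\<Sum>i\<in>UNIV. v $ i * P (i # is) x)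
     - (\<Sum>i\<in>UNIV. v $ i * (\<Sum>j\<in>UNIV. v $ j * P (j # i # is) x))\<bar> \<le> l1 v ^ 3 / 2"
proof -
  let ?\<phi> = "\<lambda>t. P is (x + t *\<^sub>R v)"
  let ?\<phi>1 = "\<lambda>t. \<Sum>i\<in>UNIV. v $ i * P (i # is) (x + t *\<^sub>R v)"
  let ?\<phi>2 = "\<lambda>t. \<Sum>i\<in>UNIV. v $ i * (\<Sum>j\<in>UNIV. v $ j * P (j # i # is) (x + t *\<^sub>R v))"
  have 1: "(?\<phi> has_real_derivative ?\<phi>1 t) (at t)" for t
    using assms by (intro DERIV_P_line) simp
  have 2: "(?\<phi>1 has_real_derivative ?\<phi>2 t) (at t)" for t
    using assms by (intro DERIV_sum DERIV_cmult DERIV_P_line) simp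
  note * = taylor_lipschitz_second_derivative[OF 1 2 P_line_second_lipschitz[OF assms]]
  show "\<bar>P is (x + v) - P is x - (\<Sum>i\<in>UNIV. v $ i * P (i # is) x)
     - (\<Sum>i\<in>UNIV. v $ i * (\<Sum>j\<in>UNIV. v $ j * P (j # i # is) x)) / 2\<bar> \<le> l1 v ^ 3 / 6"
    using *(2) by simp
  show "\<bar>(\<Sum>i\<in>UNIV. v $ i * P (i # is) (x + v)) - (\<Sum>i\<in>UNIV. v $ i * P (i # is) x)
     - (\<Sum>i\<in>UNIV. v $ i * (\<Sum>j\<in>UNIV. v $ j * P (j # i # is) x))\<bar> \<le> l1 v ^ 3 / 2"
    using *(1) by simp
qed

text \<open>Averaging the gradient over the two values of a Rademacher variable with success
  probability \<open>p\<close> leaves a second-order error proportional to \<open>p - q\<close> only.\<close>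

lemma P_weighted_trapezoid:
  assumes "length is = 1" and pq: "p + q = 1"
  shows "\<bar>P is (x + v) - P is x - (\<Sum>j\<in>UNIV. v $ j * (p * P (j # is) (x + v) + q * P (j # is) x))\<bar>
     \<le> \<bar>p - q\<bar> / 2 * (l1 v)\<^sup>2 + 5 / 12 * l1 v ^ 3"
proof -
  let ?d1 = "\<Sum>i\<in>UNIV. v $ i * P (i # is) (x + v)" and ?d0 = "\<Sum>i\<in>UNIV. v $ i * P (i # is) x"
  have "\<bar>\<Sum>i\<in>UNIV. v $ i * (P (i # is) (x + v) - P (i # is) x)\<bar> \<le> l1 v * l1 v"
    using P_lipschitz[of "_ # is" x v] assms by (intro abs_sum_mult_le_l1) simp
  then have d: "\<bar>?d1 - ?d0\<bar> \<le> (l1 v)\<^sup>2"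
    by (simp add: sum_subtractf right_diff_distrib power2_eq_square)
  have t2: "\<bar>P is (x + v) - P is x - ?d0 - (\<Sum>i\<in>UNIV. v $ i * (\<Sum>j\<in>UNIV. v $ j * P (j # i # is) x)) / 2\<bar> \<le> l1 v ^ 3 / 6"
    using assms by (intro P_taylor2) simp
  have t1: "\<bar>?d1 - ?d0 - (\<Sum>i\<in>UNIV. v $ i * (\<Sum>j\<in>UNIV. v $ j * P (j # i # is) x))\<bar> \<le> l1 v ^ 3 / 2"
    using assms by (intro P_gradient_taylor1) simp
  \<comment> \<open>Trapezoidal rule: half of the gradient expansion cancels the second-order term,
    and the errors add up to 1/6 + 1/2 * 1/2 = 5/12.\<close>
  have trap: "\<bar>P is (x + v) - P is x - (?d0 + ?d1) / 2\<bar> \<le> 5 / 12 * l1 v ^ 3"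
  proof -
    have "\<bar>a - b - (c + d) / 2\<bar> \<le> 5 / 12 * l" if "\<bar>a - b - c - s / 2\<bar> \<le> l / 6" "\<bar>d - c - s\<bar> \<le> l / 2"
      for a b c d s l :: real
      using that unfolding abs_le_iff by (simp add: field_simps)
    from this[OF t2 t1] show ?thesis .
  qed
  have pqd: "\<bar>(p - q) / 2 * (?d1 - ?d0)\<bar> \<le> \<bar>p - q\<bar> / 2 * (l1 v)\<^sup>2"
    unfolding abs_mult using d by (intro mult_mono) auto
  \<comment> \<open>The weighted mean of the two gradients is their plain mean plus (p - q) / 2
    times their difference, and that difference is bounded by the squared l1 norm.\<close>
  have avg: "(\<Sum>j\<in>UNIV. v $ j * (p * P (j # is) (x + v) + q * P (j # is) x)) = (?d0 + ?d1) / 2 + (p - q) / 2 * (?d1 - ?d0)"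
  proof -
    have q: "q = 1 - p" using pq by simp
    have "(\<Sum>j\<in>UNIV. v $ j * (p * P (j # is) (x + v) + q * P (j # is) x)) = p * ?d1 + q * ?d0"
      by (simp add: sum.distrib sum_distrib_left algebra_simps)
    also have "\<dots> = (?d0 + ?d1) / 2 + (p - q) / 2 * (?d1 - ?d0)"
      unfolding q by (simp add: field_simps)
    finally show ?thesis .
  qed
  have arith: "\<bar>a - b - (c + d)\<bar> \<le> m + n" if "\<bar>d\<bar> \<le> m" "\<bar>a - b - c\<bar> \<le> n" for a b c d m n :: real
    using that by linarith
  show ?thesis unfolding avg by (rule arith[OF pqd trap])
qed

end

section \<open>Gaussian vectors\<close>

lemma abs_integral_le_integral:
  fixes f g :: "'a \<Rightarrow> real"
  assumes "integrable M f" "integrable M g" "\<And>x. x \<in> space M \<Longrightarrow> \<bar>f x\<bar> \<le> g x"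
  shows "\<bar>\<integral>x. f x \<partial>M\<bar> \<le> (\<integral>x. g x \<partial>M)"
proof -
  have "\<bar>\<integral>x. f x \<partial>M\<bar> \<le> (\<integral>x. \<bar>f x\<bar> \<partial>M)" by (rule integral_abs_bound)
  also have "\<dots> \<le> (\<integral>x. g x \<partial>M)" using assms by (intro integral_mono) auto
  finally show ?thesis .
qed

section \<open>The standard Gaussian density and its cosine transform\<close>

definition std_gauss :: "'a::euclidean_space \<Rightarrow> real" where
  "std_gauss u = (\<Prod>b\<in>Basis. std_normal_density (u \<bullet> b))"

lemma std_gauss_pos: "0 < std_gauss u"
  unfolding std_gauss_def by (intro prod_pos normal_density_pos) simp

lemma std_gauss_measurable[measurable]: "std_gauss \<in> borel_measurable borel"
  unfolding std_gauss_def by measurable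

lemma nn_integral_std_gauss: "(\<integral>\<^sup>+u. ennreal (std_gauss (u :: 'a::euclidean_space)) \<partial>lborel) = 1"
proof -
  have "(\<integral>\<^sup>+u. ennreal (std_gauss (u :: 'a)) \<partial>lborel) = (\<integral>\<^sup>+u. (\<Prod>b\<in>Basis. ennreal (std_normal_density (u \<bullet> b))) \<partial>(lborel :: 'a measure))"
    by (simp add: std_gauss_def prod_ennreal)
  also have "\<dots> = (\<Prod>b\<in>(Basis :: 'a set). \<integral>\<^sup>+x. ennreal (std_normal_density x) \<partial>lborel)"
    by (rule nn_integral_lborel_prod) auto
  also have "(\<integral>\<^sup>+x. ennreal (std_normal_density x) \<partial>lborel) = ennreal 1"
    by (subst nn_integral_eq_integral) auto
  finally show ?thesis by simp
qed

lemma integrable_std_gauss: "integrable lborel (std_gauss :: 'a::euclidean_space \<Rightarrow> real)"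
  using nn_integral_std_gauss[where 'a='a] std_gauss_pos[where 'a='a]
  by (intro integrableI_nonneg) (auto intro: less_imp_le)

lemma integral_std_gauss: "(\<integral>u. std_gauss (u :: 'a::euclidean_space) \<partial>lborel) = 1"
  using nn_integral_std_gauss std_gauss_pos
  by (subst integral_eq_nn_integral) (auto intro: less_imp_le)

text \<open>Complex values are allowed because the factors will be integrands of characteristic
  functions.\<close>

lemma lborel_integral_prod:
  fixes f :: "'a::euclidean_space \<Rightarrow> real \<Rightarrow> complex"
  assumes "\<And>b. b \<in> Basis \<Longrightarrow> integrable lborel (f b)"
  shows "(\<integral>x. (\<Prod>b\<in>Basis. f b (x \<bullet> b)) \<partial>lborel) = (\<Prod>b\<in>Basis. \<integral>x. f b x \<partial>lborel)"
proof -
  interpret product_sigma_finite "\<lambda>_::'a. lborel :: real measure" ..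
  have [measurable]: "f b \<in> borel_measurable borel" if "b \<in> Basis" for b
    using assms[OF that] by (auto dest: borel_measurable_integrable)
  have "(\<integral>x. (\<Prod>b\<in>Basis. f b (x \<bullet> b)) \<partial>lborel)
     = (\<integral>x. (\<Prod>b\<in>Basis. f b ((\<Sum>c\<in>Basis. x c *\<^sub>R c) \<bullet> b)) \<partial>(\<Pi>\<^sub>M b\<in>(Basis::'a set). lborel))"
    by (subst lborel_eq, subst integral_distr) measurable
  also have "\<dots> = (\<integral>x. (\<Prod>b\<in>Basis. f b (x b)) \<partial>(\<Pi>\<^sub>M b\<in>(Basis::'a set). lborel))"
    by (intro Bochner_Integration.integral_cong prod.cong refl) (simp add: inner_sum_left_Basis)
  also have "\<dots> = (\<Prod>b\<in>Basis. \<integral>x. f b x \<partial>lborel)"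
    by (rule product_integral_prod) (use assms in auto)
  finally show ?thesis .
qed

lemma integral_std_normal_iexp:
  "(\<integral>x. std_normal_density x *\<^sub>R iexp (t * x) \<partial>lborel) = complex_of_real (exp (- t\<^sup>2 / 2))"
proof -
  have "char std_normal_distribution t = (\<integral>x. std_normal_density x *\<^sub>R iexp (t * x) \<partial>lborel)"
    unfolding char_def by (subst integral_density) (auto simp: normal_density_nonneg)
  then show ?thesis by (simp add: char_std_normal_distribution)
qed

lemma sum_Basis_square: "(\<Sum>b\<in>Basis. - (z \<bullet> b)\<^sup>2 / 2) = - (norm (z :: 'a::euclidean_space))\<^sup>2 / 2"
  unfolding power2_norm_eq_inner euclidean_inner[of z z]
  by (simp add: power2_eq_square sum_negf sum_divide_distrib)

text \<open>The characteristic function of the standard Gaussian law factorises over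
  \<open>Basis\<close> into one-dimensional ones; the cosine is its real part.\<close>

lemma integral_std_gauss_cos:
  "(\<integral>u. std_gauss u * cos (u \<bullet> z) \<partial>lborel) = exp (- (norm (z :: 'a::euclidean_space))\<^sup>2 / 2)"
proof -
  have eq: "std_gauss u *\<^sub>R iexp (u \<bullet> z) = (\<Prod>b\<in>Basis. std_normal_density (u \<bullet> b) *\<^sub>R iexp ((z \<bullet> b) * (u \<bullet> b)))" for u :: 'a
  proof -
    have "u \<bullet> z = (\<Sum>b\<in>Basis. (z \<bullet> b) * (u \<bullet> b))"
      by (subst euclidean_inner) (simp add: mult.commute)
    then have "iexp (u \<bullet> z) = (\<Prod>b\<in>Basis. iexp ((z \<bullet> b) * (u \<bullet> b)))"
      by (simp add: sum_distrib_left exp_sum)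
    then show ?thesis
      by (simp add: std_gauss_def prod.distrib scaleR_conv_of_real)
  qed
  have i: "integrable lborel (\<lambda>u. std_gauss u *\<^sub>R iexp (u \<bullet> z))"
    using integrable_std_gauss std_gauss_pos
    by (intro Bochner_Integration.integrable_bound[OF integrable_std_gauss]) (auto simp: less_imp_le)
  have "(\<integral>u. std_gauss u *\<^sub>R iexp (u \<bullet> z) \<partial>lborel)
     = (\<Prod>b\<in>(Basis::'a set). \<integral>x. std_normal_density x *\<^sub>R iexp ((z \<bullet> b) * x) \<partial>lborel)"
    unfolding eq
  proof (rule lborel_integral_prod)
    fix b :: 'a
    show "integrable lborel (\<lambda>x. std_normal_density x *\<^sub>R iexp ((z \<bullet> b) * x))"
      by (intro Bochner_Integration.integrable_bound[OF integrable_normal_density[of 1 0]]) auto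
  qed
  also have "\<dots> = complex_of_real (\<Prod>b\<in>(Basis::'a set). exp (- (z \<bullet> b)\<^sup>2 / 2))"
    by (simp only: integral_std_normal_iexp of_real_prod)
  also have "(\<Prod>b\<in>(Basis::'a set). exp (- (z \<bullet> b)\<^sup>2 / 2)) = exp (\<Sum>b\<in>(Basis::'a set). - (z \<bullet> b)\<^sup>2 / 2)"
    by (simp add: exp_sum)
  also have "(\<Sum>b\<in>(Basis::'a set). - (z \<bullet> b)\<^sup>2 / 2) = - (norm z)\<^sup>2 / 2"
    by (rule sum_Basis_square)
  finally have *: "(\<integral>u. std_gauss u *\<^sub>R iexp (u \<bullet> z) \<partial>lborel) = complex_of_real (exp (- (norm z)\<^sup>2 / 2))" .
  have "(\<integral>u. std_gauss u * cos (u \<bullet> z) \<partial>lborel) = (\<integral>u. Re (std_gauss u *\<^sub>R iexp (u \<bullet> z)) \<partial>lborel)"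
    by (simp add: Re_exp)
  also have "\<dots> = Re (\<integral>u. std_gauss u *\<^sub>R iexp (u \<bullet> z) \<partial>lborel)"
    by (rule integral_Re[OF i])
  finally show ?thesis using * by simp
qed

text \<open>Together with the preceding lemma: up to a constant, the density is its own cosine
  transform. The constant occurs on both sides of the later comparison, so its value stays
  open.\<close>

lemma std_gauss_eq: "\<exists>C>0. \<forall>z::'a::euclidean_space. std_gauss z = C * exp (- (norm z)\<^sup>2 / 2)"
proof (intro exI conjI allI)
  let ?C = "\<Prod>b\<in>(Basis::'a set). 1 / sqrt (2 * pi)"
  show "0 < ?C" by (intro prod_pos) simp
  fix z :: 'a
  show "std_gauss z = ?C * exp (- (norm z)\<^sup>2 / 2)"
    unfolding std_gauss_def std_normal_density_def prod.distrib sum_Basis_square[symmetric] by (simp add: exp_sum)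
qed

section \<open>Characteristic functions determine expectations\<close>

lemma lborel_integral_scale_shift:
  fixes h :: "'a::euclidean_space \<Rightarrow> real"
  assumes c: "0 < c" and [measurable]: "h \<in> borel_measurable borel"
  shows "(\<integral>x. h x \<partial>lborel) = c ^ DIM('a) * (\<integral>x. h (t + c *\<^sub>R x) \<partial>lborel)"
proof -
  have "(\<integral>x. h x \<partial>lborel) = (\<integral>x. h x \<partial>density (distr lborel borel (\<lambda>x. t + c *\<^sub>R x)) (\<lambda>_. \<bar>c\<bar>^DIM('a)))"
    using lborel_affine[of c t] c by simp
  also have "\<dots> = (\<integral>x. c ^ DIM('a) *\<^sub>R h x \<partial>distr lborel borel (\<lambda>x. t + c *\<^sub>R x))"
    using c by (subst integral_density) auto
  also have "\<dots> = (\<integral>x. c ^ DIM('a) *\<^sub>R h (t + c *\<^sub>R x) \<partial>lborel)"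
    by (subst integral_distr) auto
  finally show ?thesis by simp
qed

lemma nn_integral_lborel_scale_shift:
  fixes h :: "'a::euclidean_space \<Rightarrow> ennreal"
  assumes c: "0 < c" and [measurable]: "h \<in> borel_measurable borel"
  shows "(\<integral>\<^sup>+x. h x \<partial>lborel) = ennreal (c ^ DIM('a)) * (\<integral>\<^sup>+x. h (t + c *\<^sub>R x) \<partial>lborel)"
proof -
  have "(\<integral>\<^sup>+x. h x \<partial>lborel) = (\<integral>\<^sup>+x. h x \<partial>density (distr lborel borel (\<lambda>x. t + c *\<^sub>R x)) (\<lambda>_. \<bar>c\<bar>^DIM('a)))"
    using lborel_affine[of c t] c by simp
  also have "\<dots> = ennreal (c ^ DIM('a)) * (\<integral>\<^sup>+x. h (t + c *\<^sub>R x) \<partial>lborel)"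
    using c by (subst nn_integral_density) (auto simp: nn_integral_distr nn_integral_cmult)
  finally show ?thesis .
qed

text \<open>The law of \<open>X\<close> smoothed by Gaussian noise of standard deviation \<open>s\<close> has density
  proportional to the expectation below, which is determined by the characteristic function
  of \<open>X\<close>.\<close>

lemma expectation_std_gauss_char:
  fixes X :: "'b \<Rightarrow> 'a::euclidean_space"
  assumes "prob_space M" and [measurable]: "X \<in> borel_measurable M"
    and C: "\<And>z::'a. std_gauss z = C * exp (- (norm z)\<^sup>2 / 2)"
  shows "(\<integral>x. std_gauss ((1/s) *\<^sub>R (w - X x)) \<partial>M) =
    C * (\<integral>u. std_gauss u * (cos ((1/s) * (u \<bullet> w)) * (\<integral>x. cos (((1/s) *\<^sub>R u) \<bullet> X x) \<partial>M)
        + sin ((1/s) * (u \<bullet> w)) * (\<integral>x. sin (((1/s) *\<^sub>R u) \<bullet> X x) \<partial>M)) \<partial>lborel)"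
proof -
  interpret prob_space M by fact
  interpret pair_sigma_finite M "lborel :: 'a measure" ..
  let ?f = "\<lambda>x u. std_gauss u * cos (u \<bullet> ((1/s) *\<^sub>R (w - X x)))"
  have int: "integrable (M \<Otimes>\<^sub>M lborel) (\<lambda>(x, u). ?f x u)"
  proof (rule Bochner_Integration.integrable_bound)
    have "norm (std_gauss u) = std_gauss u" for u :: 'a
      using std_gauss_pos[of u] by simp
    then have "(\<integral>\<^sup>+z. ennreal (norm (std_gauss (snd z))) \<partial>(M \<Otimes>\<^sub>M (lborel :: 'a measure))) = 1"
      using nn_integral_std_gauss[where 'a='a] emeasure_space_1
      by (subst lborel.nn_integral_fst[symmetric]) auto
    then show "integrable (M \<Otimes>\<^sub>M lborel) (\<lambda>z. std_gauss (snd z :: 'a))"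
      by (intro integrableI_bounded) auto
    show "AE z in M \<Otimes>\<^sub>M lborel. norm (case z of (x, u) \<Rightarrow> ?f x u) \<le> norm (std_gauss (snd z))"
      using std_gauss_pos by (intro AE_I2) (auto simp: abs_mult mult_left_le)
  qed measurable
  \<comment> \<open>Written as a cosine transform, the density carries X inside a cosine; exchanging
    the integrals then leaves only the characteristic function of X.\<close>
  have "(\<integral>x. std_gauss ((1/s) *\<^sub>R (w - X x)) \<partial>M) = (\<integral>x. C * (\<integral>u. ?f x u \<partial>lborel) \<partial>M)"
    by (simp only: C[of "(1/s) *\<^sub>R (w - X _)"] integral_std_gauss_cos)
  also have "\<dots> = C * (\<integral>x. (\<integral>u. ?f x u \<partial>lborel) \<partial>M)" by simp
  also have "(\<integral>x. (\<integral>u. ?f x u \<partial>lborel) \<partial>M) = (\<integral>u. (\<integral>x. ?f x u \<partial>M) \<partial>lborel)"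
    by (rule Fubini_integral[OF int, symmetric])
  also have "\<dots> = (\<integral>u. std_gauss u * (cos ((1/s) * (u \<bullet> w)) * (\<integral>x. cos (((1/s) *\<^sub>R u) \<bullet> X x) \<partial>M)
        + sin ((1/s) * (u \<bullet> w)) * (\<integral>x. sin (((1/s) *\<^sub>R u) \<bullet> X x) \<partial>M)) \<partial>lborel)"
  proof (rule Bochner_Integration.integral_cong[OF refl])
    fix u :: 'a
    have i: "integrable M (\<lambda>x. cos (((1/s) *\<^sub>R u) \<bullet> X x))" "integrable M (\<lambda>x. sin (((1/s) *\<^sub>R u) \<bullet> X x))"
      by (auto intro!: integrable_const_bound[where B=1])
    have "(\<integral>x. ?f x u \<partial>M) = (\<integral>x. std_gauss u * (cos ((1/s) * (u \<bullet> w)) * cos (((1/s) *\<^sub>R u) \<bullet> X x)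
        + sin ((1/s) * (u \<bullet> w)) * sin (((1/s) *\<^sub>R u) \<bullet> X x)) \<partial>M)"
    proof (rule Bochner_Integration.integral_cong[OF refl])
      fix x
      have "u \<bullet> ((1/s) *\<^sub>R (w - X x)) = (1/s) * (u \<bullet> w) - ((1/s) *\<^sub>R u) \<bullet> X x"
        by (simp add: inner_diff_right right_diff_distrib diff_divide_distrib)
      then show "?f x u = std_gauss u * (cos ((1/s) * (u \<bullet> w)) * cos (((1/s) *\<^sub>R u) \<bullet> X x)
        + sin ((1/s) * (u \<bullet> w)) * sin (((1/s) *\<^sub>R u) \<bullet> X x))"
        by (simp only: cos_diff)
    qed
    also have "\<dots> = std_gauss u * (cos ((1/s) * (u \<bullet> w)) * (\<integral>x. cos (((1/s) *\<^sub>R u) \<bullet> X x) \<partial>M)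
        + sin ((1/s) * (u \<bullet> w)) * (\<integral>x. sin (((1/s) *\<^sub>R u) \<bullet> X x) \<partial>M))"
      using i by simp
    finally show "(\<integral>x. ?f x u \<partial>M) = std_gauss u * (cos ((1/s) * (u \<bullet> w)) * (\<integral>x. cos (((1/s) *\<^sub>R u) \<bullet> X x) \<partial>M)
        + sin ((1/s) * (u \<bullet> w)) * (\<integral>x. sin (((1/s) *\<^sub>R u) \<bullet> X x) \<partial>M))" .
  qed
  finally show ?thesis .
qed

text \<open>The substitution w = X + s z and Fubini's theorem move X out of f and into the Gaussian
  kernel, where the preceding lemma applies.\<close>

lemma expectation_smoothed:
  fixes X :: "'b \<Rightarrow> 'a::euclidean_space" and f :: "'a \<Rightarrow> real"
  assumes "prob_space M" and [measurable]: "X \<in> borel_measurable M" "f \<in> borel_measurable borel"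
    and B: "\<And>x. \<bar>f x\<bar> \<le> B" and s: "0 < s"
  shows "(\<integral>x. (\<integral>z. f (X x + s *\<^sub>R z) * std_gauss z \<partial>lborel) \<partial>M)
     = (\<integral>w. f w * (\<integral>x. std_gauss ((1/s) *\<^sub>R (w - X x)) \<partial>M) \<partial>lborel) / s ^ DIM('a)"
proof -
  interpret prob_space M by fact
  interpret pair_sigma_finite M "lborel :: 'a measure" ..
  have B0: "0 \<le> B" using B[of 0] by linarith
  let ?g = "\<lambda>x w. f w * std_gauss ((1/s) *\<^sub>R (w - X x))"
  have cv: "(\<integral>w. ?g x w \<partial>lborel) = s ^ DIM('a) * (\<integral>z. f (X x + s *\<^sub>R z) * std_gauss z \<partial>lborel)" for x
    using s by (subst lborel_integral_scale_shift[OF s, where t="X x"]) auto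
  have int: "integrable (M \<Otimes>\<^sub>M lborel) (\<lambda>(x, w). ?g x w)"
  proof (rule integrableI_bounded)
    have "(\<integral>\<^sup>+z. ennreal (norm (case z of (x, w) \<Rightarrow> ?g x w)) \<partial>(M \<Otimes>\<^sub>M (lborel :: 'a measure)))
        = (\<integral>\<^sup>+x. (\<integral>\<^sup>+w. ennreal (norm (?g x w)) \<partial>lborel) \<partial>M)"
      by (subst lborel.nn_integral_fst[symmetric]) auto
    also have "\<dots> \<le> (\<integral>\<^sup>+x. ennreal (B * s ^ DIM('a)) \<partial>M)"
    proof (rule nn_integral_mono)
      fix x
      have "(\<integral>\<^sup>+w. ennreal (norm (?g x w)) \<partial>lborel) \<le> (\<integral>\<^sup>+w. ennreal B * ennreal (std_gauss ((1/s) *\<^sub>R (w - X x))) \<partial>lborel)"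
      proof (rule nn_integral_mono)
        fix w
        show "ennreal (norm (?g x w)) \<le> ennreal B * ennreal (std_gauss ((1/s) *\<^sub>R (w - X x)))"
          using B0 B[of w] std_gauss_pos[of "(1/s) *\<^sub>R (w - X x)"]
          by (subst ennreal_mult[symmetric]) (auto simp: abs_mult)
      qed
      also have "\<dots> = ennreal B * (\<integral>\<^sup>+w. ennreal (std_gauss ((1/s) *\<^sub>R (w - X x))) \<partial>lborel)"
        by (rule nn_integral_cmult) auto
      also have "(\<integral>\<^sup>+w. ennreal (std_gauss ((1/s) *\<^sub>R (w - X x))) \<partial>lborel) = ennreal (s ^ DIM('a)) * 1"
        using s by (subst nn_integral_lborel_scale_shift[OF s, where t="X x"]) (auto simp: nn_integral_std_gauss)
      finally show "(\<integral>\<^sup>+w. ennreal (norm (?g x w)) \<partial>lborel) \<le> ennreal (B * s ^ DIM('a))"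
        using B0 s by (simp add: ennreal_mult)
    qed
    also have "\<dots> < \<infinity>" by (simp add: emeasure_space_1)
    finally show "(\<integral>\<^sup>+z. ennreal (norm (case z of (x, w) \<Rightarrow> ?g x w)) \<partial>(M \<Otimes>\<^sub>M (lborel :: 'a measure))) < \<infinity>" .
  qed measurable
  have "s ^ DIM('a) * (\<integral>x. (\<integral>z. f (X x + s *\<^sub>R z) * std_gauss z \<partial>lborel) \<partial>M)
      = (\<integral>x. (\<integral>w. ?g x w \<partial>lborel) \<partial>M)" by (simp add: cv)
  also have "\<dots> = (\<integral>w. (\<integral>x. ?g x w \<partial>M) \<partial>lborel)"
    by (rule Fubini_integral[OF int, symmetric])
  finally show ?thesis using s by (simp add: field_simps)
qed

text \<open>As the noise level tends to 0 the smoothing disappears; dominated convergence is applied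
  first in the noise and then in X.\<close>

lemma expectation_smoothed_tendsto:
  fixes X :: "'b \<Rightarrow> 'a::euclidean_space" and f :: "'a \<Rightarrow> real"
  assumes "prob_space M" and [measurable]: "X \<in> borel_measurable M" and f: "continuous_on UNIV f"
    and B: "\<And>x. \<bar>f x\<bar> \<le> B"
  shows "(\<lambda>n. \<integral>x. (\<integral>z. f (X x + (1 / real (Suc n)) *\<^sub>R z) * std_gauss z \<partial>lborel) \<partial>M) \<longlonglongrightarrow> (\<integral>x. f (X x) \<partial>M)"
proof -
  interpret prob_space M by fact
  have [measurable]: "f \<in> borel_measurable borel" by (rule borel_measurable_continuous_onI[OF f])
  have lim0: "(\<lambda>n. 1 / real (Suc n)) \<longlonglongrightarrow> 0"
    by (rule LIMSEQ_inverse_real_of_nat[unfolded inverse_eq_divide])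
  have ib: "integrable lborel (\<lambda>z. B * std_gauss (z :: 'a))" by (simp add: integrable_std_gauss)
  have bd: "\<bar>f y * std_gauss z\<bar> \<le> B * std_gauss z" for y z :: 'a
    using B[of y] std_gauss_pos[of z] by (simp add: abs_mult)
  have inner: "(\<lambda>n. \<integral>z. f (y + (1 / real (Suc n)) *\<^sub>R z) * std_gauss z \<partial>lborel) \<longlonglongrightarrow> f y" for y
  proof -
    have "(\<lambda>n. \<integral>z. f (y + (1 / real (Suc n)) *\<^sub>R z) * std_gauss z \<partial>lborel) \<longlonglongrightarrow> (\<integral>z. f y * std_gauss (z :: 'a) \<partial>lborel)"
    proof (rule integral_dominated_convergence[where w="\<lambda>z. B * std_gauss z"])
      show "integrable lborel (\<lambda>z. B * std_gauss (z :: 'a))" by (rule ib)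
      show "AE z in lborel. (\<lambda>n. f (y + (1 / real (Suc n)) *\<^sub>R z) * std_gauss z) \<longlonglongrightarrow> f y * std_gauss z"
      proof (intro AE_I2 tendsto_mult tendsto_const)
        fix z :: 'a
        have "(\<lambda>n. y + (1 / real (Suc n)) *\<^sub>R z) \<longlonglongrightarrow> y + 0 *\<^sub>R z" by (intro tendsto_intros lim0)
        moreover have "isCont f y" using f by (simp add: continuous_on_eq_continuous_at)
        ultimately show "(\<lambda>n. f (y + (1 / real (Suc n)) *\<^sub>R z)) \<longlonglongrightarrow> f y"
          by (auto intro: isCont_tendsto_compose)
      qed
      show "AE z in lborel. norm (f (y + (1 / real (Suc n)) *\<^sub>R z) * std_gauss z) \<le> B * std_gauss z" for n
        using bd by (intro AE_I2) simp
    qed measurable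
    then show ?thesis by (simp add: integral_std_gauss)
  qed
  show ?thesis
  proof (rule integral_dominated_convergence[where w="\<lambda>_. B"])
    show "AE x in M. norm (\<integral>z. f (X x + (1 / real (Suc n)) *\<^sub>R z) * std_gauss z \<partial>lborel) \<le> B" for n
    proof (intro AE_I2)
      fix x
      have "norm (\<integral>z. f (X x + (1 / real (Suc n)) *\<^sub>R z) * std_gauss z \<partial>lborel) \<le> (\<integral>z. B * std_gauss (z::'a) \<partial>lborel)"
        unfolding real_norm_def
      proof (rule abs_integral_le_integral[OF _ ib])
        show "integrable lborel (\<lambda>z. f (X x + (1 / real (Suc n)) *\<^sub>R z) * std_gauss z)"
          using order_trans[OF bd abs_ge_self] by (intro Bochner_Integration.integrable_bound[OF ib]) auto
      qed (use bd in simp)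
      then show "norm (\<integral>z. f (X x + (1 / real (Suc n)) *\<^sub>R z) * std_gauss z \<partial>lborel) \<le> B"
        by (simp add: integral_std_gauss)
    qed
  qed (use inner in auto)
qed

text \<open>Both smoothed expectations are the same functional of the characteristic function, so
  they agree at every noise level, and the level then tends to 0.\<close>

theorem char_eq_imp_expectation_eq_bounded:
  fixes X :: "'b \<Rightarrow> 'a::euclidean_space" and X' :: "'c \<Rightarrow> 'a" and f :: "'a \<Rightarrow> real"
  assumes M: "prob_space M" "prob_space M'" and X[measurable]: "X \<in> borel_measurable M" "X' \<in> borel_measurable M'"
    and cos: "\<And>u. (\<integral>x. cos (u \<bullet> X x) \<partial>M) = (\<integral>x. cos (u \<bullet> X' x) \<partial>M')"
    and sin: "\<And>u. (\<integral>x. sin (u \<bullet> X x) \<partial>M) = (\<integral>x. sin (u \<bullet> X' x) \<partial>M')"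
    and f: "continuous_on UNIV f" and B: "\<And>x. \<bar>f x\<bar> \<le> B"
  shows "(\<integral>x. f (X x) \<partial>M) = (\<integral>x. f (X' x) \<partial>M')"
proof -
  have fm: "f \<in> borel_measurable borel" by (rule borel_measurable_continuous_onI[OF f])
  obtain C where C: "\<And>z::'a. std_gauss z = C * exp (- (norm z)\<^sup>2 / 2)" using std_gauss_eq by blast
  have "(\<integral>x. (\<integral>z. f (X x + s *\<^sub>R z) * std_gauss z \<partial>lborel) \<partial>M) = (\<integral>x. (\<integral>z. f (X' x + s *\<^sub>R z) * std_gauss z \<partial>lborel) \<partial>M')"
    if "0 < s" for s
    unfolding expectation_smoothed[OF M(1) X(1) fm B that] expectation_smoothed[OF M(2) X(2) fm B that]
       expectation_std_gauss_char[OF M(1) X(1) C] expectation_std_gauss_char[OF M(2) X(2) C] cos sin ..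
  then have eq: "(\<integral>x. (\<integral>z. f (X x + (1 / real (Suc n)) *\<^sub>R z) * std_gauss z \<partial>lborel) \<partial>M)
      = (\<integral>x. (\<integral>z. f (X' x + (1 / real (Suc n)) *\<^sub>R z) * std_gauss z \<partial>lborel) \<partial>M')" for n
    by simp
  show ?thesis
    using expectation_smoothed_tendsto[OF M(1) X(1) f B] expectation_smoothed_tendsto[OF M(2) X(2) f B]
    unfolding eq by (rule LIMSEQ_unique)
qed

text \<open>Test functions are Lipschitz but need not be bounded, so f is clipped at -n and n and
  the clipping removed by dominated convergence.\<close>

theorem char_eq_imp_expectation_eq:
  fixes X :: "'b \<Rightarrow> 'a::euclidean_space" and X' :: "'c \<Rightarrow> 'a" and f :: "'a \<Rightarrow> real"
  assumes M: "prob_space M" "prob_space M'" and X[measurable]: "X \<in> borel_measurable M" "X' \<in> borel_measurable M'"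
    and cos: "\<And>u. (\<integral>x. cos (u \<bullet> X x) \<partial>M) = (\<integral>x. cos (u \<bullet> X' x) \<partial>M')"
    and sin: "\<And>u. (\<integral>x. sin (u \<bullet> X x) \<partial>M) = (\<integral>x. sin (u \<bullet> X' x) \<partial>M')"
    and f: "continuous_on UNIV f" and i: "integrable M (\<lambda>x. f (X x))" "integrable M' (\<lambda>x. f (X' x))"
  shows "(\<integral>x. f (X x) \<partial>M) = (\<integral>x. f (X' x) \<partial>M')"
proof -
  have [measurable]: "f \<in> borel_measurable borel" by (rule borel_measurable_continuous_onI[OF f])
  let ?t = "\<lambda>n::nat. \<lambda>x. max (- real n) (min (real n) (f x))"
  have eq: "(\<integral>x. ?t n (X x) \<partial>M) = (\<integral>x. ?t n (X' x) \<partial>M')" for n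
    by (rule char_eq_imp_expectation_eq_bounded[OF M X cos sin, where B="real n"])
       (auto intro!: continuous_on_max continuous_on_min f)
  have lim: "(\<lambda>n. ?t n x) \<longlonglongrightarrow> f x" for x
  proof (rule tendsto_eventually)
    obtain n0 :: nat where "\<bar>f x\<bar> \<le> n0" using real_arch_simple by blast
    then show "eventually (\<lambda>n. ?t n x = f x) sequentially"
      by (auto simp: eventually_sequentially intro!: exI[of _ n0])
  qed
  have "(\<lambda>n. \<integral>x. ?t n (X x) \<partial>M) \<longlonglongrightarrow> (\<integral>x. f (X x) \<partial>M)"
    by (rule integral_dominated_convergence[where w="\<lambda>x. \<bar>f (X x)\<bar>"]) (use i lim in auto)
  moreover have "(\<lambda>n. \<integral>x. ?t n (X' x) \<partial>M') \<longlonglongrightarrow> (\<integral>x. f (X' x) \<partial>M')"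
    by (rule integral_dominated_convergence[where w="\<lambda>x. \<bar>f (X' x)\<bar>"]) (use i lim in auto)
  ultimately show ?thesis unfolding eq by (rule LIMSEQ_unique)
qed

section \<open>Centred Gaussian variables\<close>

lemma gaussian_var_centred_cases:
  assumes "prob_space M" "gaussian_var M Z" "(\<integral>x. Z x \<partial>M) = 0"
  obtains (normal) s where "0 < s" "distributed M lborel (\<lambda>x. Z x / s) std_normal_density"
  | (degenerate) "Z \<in> borel_measurable M" "AE x in M. Z x = 0"
proof -
  interpret prob_space M by fact
  from assms(2) consider m s where "s > 0" "distributed M lborel Z (normal_density m s)"
    | m where "Z \<in> borel_measurable M" "AE x in M. Z x = m"
    unfolding gaussian_var_def by blast
  then show thesis
  proof cases
    case (1 m s)
    have "m = 0" using normal_distributed_expectation[OF 1] assms(3) by simp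
    with 1 have "distributed M lborel (\<lambda>x. Z x / s) std_normal_density"
      using normal_standard_normal_convert[of s Z m] by simp
    with 1(1) show thesis by (rule normal)
  next
    case (2 m)
    have "(\<integral>x. Z x \<partial>M) = (\<integral>x. m \<partial>M)" using 2 by (intro integral_cong_AE) auto
    then have "m = 0" using assms(3) by (simp add: prob_space)
    with 2 show thesis by (intro degenerate) auto
  qed
qed

lemma gaussian_var_integrable_power:
  assumes "prob_space M" "gaussian_var M Z" "(\<integral>x. Z x \<partial>M) = 0"
  shows "integrable M (\<lambda>x. \<bar>Z x\<bar> ^ k)"
proof -
  interpret prob_space M by fact
  from assms show ?thesis
  proof (cases rule: gaussian_var_centred_cases)
    case (normal s)
    have "integrable M (\<lambda>x. \<bar>Z x / s\<bar> ^ k)"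
      using integrable_std_normal_moment_abs[of k]
      by (subst distributed_integrable[OF normal(2), symmetric]) auto
    then have "integrable M (\<lambda>x. s ^ k * \<bar>Z x / s\<bar> ^ k)" by simp
    then show ?thesis using normal(1) by (simp add: power_mult_distrib[symmetric] abs_mult)
  next
    case degenerate
    then have "integrable M (\<lambda>x. \<bar>Z x\<bar> ^ k) \<longleftrightarrow> integrable M (\<lambda>x. \<bar>0\<bar> ^ k :: real)"
      by (intro integrable_cong_AE) auto
    then show ?thesis by simp
  qed
qed

text \<open>Expressed through the variance, the formula covers both cases at once: a point mass at 0
  has variance 0.\<close>

lemma gaussian_var_char:
  assumes "prob_space M" "gaussian_var M Z" "(\<integral>x. Z x \<partial>M) = 0"
  shows "(\<integral>x. cos (Z x) \<partial>M) = exp (- (\<integral>x. (Z x)\<^sup>2 \<partial>M) / 2)" and "(\<integral>x. sin (Z x) \<partial>M) = 0"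
proof -
  interpret prob_space M by fact
  have "(\<integral>x. cos (Z x) \<partial>M) = exp (- (\<integral>x. (Z x)\<^sup>2 \<partial>M) / 2) \<and> (\<integral>x. sin (Z x) \<partial>M) = 0"
    using assms
  proof (cases rule: gaussian_var_centred_cases)
    case (normal s)
    have v: "(\<integral>x. (Z x)\<^sup>2 \<partial>M) = s\<^sup>2"
    proof -
      have "(\<integral>x. (Z x / s)\<^sup>2 \<partial>M) = 1"
        using standard_normal_distributed_variance[OF normal(2)] unfolding standard_normal_distributed_expectation[OF normal(2)] by simp
      then have "(\<integral>x. (Z x)\<^sup>2 \<partial>M) / s\<^sup>2 = 1" by (simp only: power_divide integral_divide_zero)
      then show ?thesis using normal(1) by (auto simp: divide_eq_eq)
    qed
    let ?f = "\<lambda>x. std_normal_density x *\<^sub>R iexp (s * x)"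
    have i: "integrable lborel ?f"
      by (intro Bochner_Integration.integrable_bound[OF integrable_normal_density[of 1 0]]) auto
    have "(\<integral>x. cos (Z x) \<partial>M) = (\<integral>x. cos (s * (Z x / s)) \<partial>M)" using normal(1) by simp
    also have "\<dots> = (\<integral>x. std_normal_density x * cos (s * x) \<partial>lborel)"
      by (subst distributed_integral[OF normal(2), symmetric]) auto
    also have "\<dots> = (\<integral>x. Re (?f x) \<partial>lborel)" by (simp add: Re_exp)
    also have "\<dots> = exp (- s\<^sup>2 / 2)" unfolding integral_Re[OF i] integral_std_normal_iexp by simp
    finally have c: "(\<integral>x. cos (Z x) \<partial>M) = exp (- s\<^sup>2 / 2)" .
    have "(\<integral>x. sin (Z x) \<partial>M) = (\<integral>x. sin (s * (Z x / s)) \<partial>M)" using normal(1) by simp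
    also have "\<dots> = (\<integral>x. std_normal_density x * sin (s * x) \<partial>lborel)"
      by (subst distributed_integral[OF normal(2), symmetric]) auto
    also have "\<dots> = (\<integral>x. Im (?f x) \<partial>lborel)" by (simp add: Im_exp)
    also have "\<dots> = 0" unfolding integral_Im[OF i] integral_std_normal_iexp by simp
    finally show ?thesis using c v by simp
  next
    case degenerate
    note [measurable] = degenerate(1)
    have "(\<integral>x. cos (Z x) \<partial>M) = (\<integral>x. 1 \<partial>M)" "(\<integral>x. sin (Z x) \<partial>M) = (\<integral>x. 0 \<partial>M)" "(\<integral>x. (Z x)\<^sup>2 \<partial>M) = (\<integral>x. 0 \<partial>M)"
      by (intro integral_cong_AE; use degenerate in auto)+
    then show ?thesis by (simp add: prob_space)
  qed
  then show "(\<integral>x. cos (Z x) \<partial>M) = exp (- (\<integral>x. (Z x)\<^sup>2 \<partial>M) / 2)" "(\<integral>x. sin (Z x) \<partial>M) = 0" by auto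
qed

text \<open>Every component is at most the largest one, whose k-th power is among the
  summands.\<close>

lemma l1_power_le: "l1 v ^ k \<le> real CARD('d) ^ k * (\<Sum>i\<in>UNIV. \<bar>(v :: real ^ 'd::finite) $ i\<bar> ^ k)"
proof -
  have "Max (range (\<lambda>i. \<bar>v $ i\<bar>)) \<in> range (\<lambda>i. \<bar>v $ i\<bar>)" by (intro Max_in) auto
  then obtain i where i: "\<bar>v $ i\<bar> = Max (range (\<lambda>i. \<bar>v $ i\<bar>))" by (elim imageE) simp
  have "l1 v \<le> (\<Sum>j::'d\<in>UNIV. \<bar>v $ i\<bar>)" unfolding l1_def by (intro sum_mono) (simp add: i)
  then have "l1 v ^ k \<le> (real CARD('d) * \<bar>v $ i\<bar>) ^ k" by (intro power_mono) auto
  also have "\<dots> \<le> real CARD('d) ^ k * (\<Sum>i\<in>UNIV. \<bar>v $ i\<bar> ^ k)"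
    unfolding power_mult_distrib by (intro mult_left_mono member_le_sum) auto
  finally show ?thesis .
qed

section \<open>Integrals over independent pairs\<close>

context pair_prob_space
begin

lemma
  fixes \<phi> :: "'a \<Rightarrow> real" and \<psi> :: "'b \<Rightarrow> real"
  assumes "integrable M1 \<phi>" "integrable M2 \<psi>"
  shows integrable_pair_mult: "integrable (M1 \<Otimes>\<^sub>M M2) (\<lambda>z. \<phi> (fst z) * \<psi> (snd z))"
    and integral_pair_mult:
      "(\<integral>z. \<phi> (fst z) * \<psi> (snd z) \<partial>(M1 \<Otimes>\<^sub>M M2)) = (\<integral>x. \<phi> x \<partial>M1) * (\<integral>y. \<psi> y \<partial>M2)"
proof -
  have [measurable]: "\<phi> \<in> borel_measurable M1" "\<psi> \<in> borel_measurable M2" using assms by auto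
  show *: "integrable (M1 \<Otimes>\<^sub>M M2) (\<lambda>z. \<phi> (fst z) * \<psi> (snd z))"
    by (rule Fubini_integrable) (use assms in \<open>auto simp: abs_mult\<close>)
  show "(\<integral>z. \<phi> (fst z) * \<psi> (snd z) \<partial>(M1 \<Otimes>\<^sub>M M2)) = (\<integral>x. \<phi> x \<partial>M1) * (\<integral>y. \<psi> y \<partial>M2)"
    using integral_fst'[OF *] by simp
qed

lemma
  fixes \<phi> :: "'a \<Rightarrow> real"
  assumes "integrable M1 \<phi>"
  shows integrable_pair_fst: "integrable (M1 \<Otimes>\<^sub>M M2) (\<lambda>z. \<phi> (fst z))"
    and integral_pair_fst: "(\<integral>z. \<phi> (fst z) \<partial>(M1 \<Otimes>\<^sub>M M2)) = (\<integral>x. \<phi> x \<partial>M1)"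
  using integrable_pair_mult[OF assms, of "\<lambda>_. 1"] integral_pair_mult[OF assms, of "\<lambda>_. 1"]
  by (simp_all add: M2.prob_space)

lemma
  fixes \<psi> :: "'b \<Rightarrow> real"
  assumes "integrable M2 \<psi>"
  shows integrable_pair_snd: "integrable (M1 \<Otimes>\<^sub>M M2) (\<lambda>z. \<psi> (snd z))"
    and integral_pair_snd: "(\<integral>z. \<psi> (snd z) \<partial>(M1 \<Otimes>\<^sub>M M2)) = (\<integral>x. \<psi> x \<partial>M2)"
  using integrable_pair_mult[OF _ assms, of "\<lambda>_. 1"] integral_pair_mult[OF _ assms, of "\<lambda>_. 1"]
  by (simp_all add: M1.prob_space)

end

section \<open>Gaussian vectors: rotation invariance and integration by parts\<close>

locale gaussian_vector = M: prob_space M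
  for M :: "'b measure" and N :: "'b \<Rightarrow> real ^ 'd::finite" and S :: "real ^ 'd ^ 'd" +
  assumes N: "centred_gaussian_vector M N S"
begin

lemma N_measurable[measurable]: "N \<in> borel_measurable M"
  using N by (simp add: centred_gaussian_vector_def)

lemma N_component_measurable[measurable]: "(\<lambda>x. N x $ i) \<in> borel_measurable M"
proof -
  have "(\<lambda>x. N x \<bullet> axis i 1) \<in> borel_measurable M" by measurable
  then show ?thesis by (simp add: inner_axis)
qed

lemma N_component_mean: "(\<integral>x. N x $ i \<partial>M) = 0"
  and N_component_cov: "(\<integral>x. N x $ i * N x $ j \<partial>M) = S $ i $ j"
  using N by (simp_all add: centred_gaussian_vector_def)

lemma N_component_gaussian: "gaussian_var M (\<lambda>x. N x $ i)"
proof -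
  have "gaussian_var M (\<lambda>x. axis i 1 \<bullet> N x)" using N by (simp add: centred_gaussian_vector_def)
  then show ?thesis by (simp add: inner_axis')
qed

lemma integrable_N_power: "integrable M (\<lambda>x. \<bar>N x $ i\<bar> ^ k)"
  using M.prob_space_axioms N_component_gaussian N_component_mean by (rule gaussian_var_integrable_power)

lemma integrable_N: "integrable M (\<lambda>x. N x $ i)"
  using integrable_N_power[of i 1] by (simp add: integrable_abs_iff)

lemma square_integrable_N: "square_integrable M (\<lambda>x. N x $ i)"
  using integrable_N_power[of i 2] by (simp add: square_integrable_def)

lemma integrable_l1_power: "integrable M (\<lambda>x. l1 (N x) ^ k)"
proof (rule Bochner_Integration.integrable_bound)
  show "integrable M (\<lambda>x. real CARD('d) ^ k * (\<Sum>i\<in>UNIV. \<bar>N x $ i\<bar> ^ k))"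
    by (intro integrable_mult_right Bochner_Integration.integrable_sum integrable_N_power)
qed (use l1_power_le in \<open>auto simp: sum_nonneg abs_mult\<close>)

lemma integral_inner_N: "(\<integral>x. u \<bullet> N x \<partial>M) = 0"
  using integrable_N by (simp add: inner_vec_def N_component_mean)

lemma char_N:
  "(\<integral>x. cos (u \<bullet> N x) \<partial>M) = exp (- (\<integral>x. (u \<bullet> N x)\<^sup>2 \<partial>M) / 2)" "(\<integral>x. sin (u \<bullet> N x) \<partial>M) = 0"
  using gaussian_var_char[OF M.prob_space_axioms, of "\<lambda>x. u \<bullet> N x"] N integral_inner_N[of u]
  by (simp_all add: centred_gaussian_vector_def)

sublocale MM: pair_prob_space M M ..

text \<open>Independence multiplies the variance of the projection on u by a^2 + b^2 = 1, so the
  characteristic functions agree. Only projections occur, hence a singular covariance matrix is no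
  obstacle.\<close>

lemma gaussian_stability:
  fixes f :: "real ^ 'd \<Rightarrow> real"
  assumes ab: "a\<^sup>2 + b\<^sup>2 = 1" and f: "continuous_on UNIV f"
    and i: "integrable M (\<lambda>x. f (N x))" "integrable (M \<Otimes>\<^sub>M M) (\<lambda>z. f (a *\<^sub>R N (fst z) + b *\<^sub>R N (snd z)))"
  shows "(\<integral>z. f (a *\<^sub>R N (fst z) + b *\<^sub>R N (snd z)) \<partial>(M \<Otimes>\<^sub>M M)) = (\<integral>x. f (N x) \<partial>M)"
proof (rule char_eq_imp_expectation_eq[OF _ M.prob_space_axioms _ _ _ _ f i(2,1)])
  show "prob_space (M \<Otimes>\<^sub>M M)" by (rule MM.prob_space_axioms)
  fix u :: "real ^ 'd"
  let ?A = "\<lambda>x. (a *\<^sub>R u) \<bullet> N x" and ?B = "\<lambda>x. (b *\<^sub>R u) \<bullet> N x"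
  have prod: "(\<integral>z. g (fst z) * h (snd z) \<partial>(M \<Otimes>\<^sub>M M)) = (\<integral>x. g x \<partial>M) * (\<integral>x. h x \<partial>M)"
    "integrable (M \<Otimes>\<^sub>M M) (\<lambda>z. g (fst z) * h (snd z))"
    if "g \<in> borel_measurable M" "h \<in> borel_measurable M" "\<And>x. \<bar>g x\<bar> \<le> 1" "\<And>x. \<bar>h x\<bar> \<le> 1" for g h :: "'b \<Rightarrow> real"
  proof -
    note [measurable] = that(1,2)
    show i: "integrable (M \<Otimes>\<^sub>M M) (\<lambda>z. g (fst z) * h (snd z))"
      using that by (intro MM.integrable_const_bound[where B=1] AE_I2) (auto simp: abs_mult intro!: mult_le_one)
    show "(\<integral>z. g (fst z) * h (snd z) \<partial>(M \<Otimes>\<^sub>M M)) = (\<integral>x. g x \<partial>M) * (\<integral>x. h x \<partial>M)"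
      using MM.integral_fst'[OF i] by simp
  qed
  have split: "u \<bullet> (a *\<^sub>R N (fst z) + b *\<^sub>R N (snd z)) = ?A (fst z) + ?B (snd z)" for z
    by (simp add: inner_add_right)
  have v: "(\<integral>x. (?A x)\<^sup>2 \<partial>M) = a\<^sup>2 * (\<integral>x. (u \<bullet> N x)\<^sup>2 \<partial>M)" "(\<integral>x. (?B x)\<^sup>2 \<partial>M) = b\<^sup>2 * (\<integral>x. (u \<bullet> N x)\<^sup>2 \<partial>M)"
    by (simp_all add: power_mult_distrib)
  have "(\<integral>z. cos (u \<bullet> (a *\<^sub>R N (fst z) + b *\<^sub>R N (snd z))) \<partial>(M \<Otimes>\<^sub>M M))
      = (\<integral>x. cos (?A x) \<partial>M) * (\<integral>x. cos (?B x) \<partial>M) - (\<integral>x. sin (?A x) \<partial>M) * (\<integral>x. sin (?B x) \<partial>M)"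
    unfolding split cos_add
    using prod[of "\<lambda>x. cos (?A x)" "\<lambda>x. cos (?B x)"] prod[of "\<lambda>x. sin (?A x)" "\<lambda>x. sin (?B x)"]
    by (subst Bochner_Integration.integral_diff) (simp_all del: inner_scaleR_left)
  also have "\<dots> = exp (- (a\<^sup>2 + b\<^sup>2) * (\<integral>x. (u \<bullet> N x)\<^sup>2 \<partial>M) / 2)"
    unfolding char_N v by (simp add: exp_add[symmetric] algebra_simps add_divide_distrib)
  also have "\<dots> = (\<integral>x. cos (u \<bullet> N x) \<partial>M)" by (simp add: ab char_N)
  finally show "(\<integral>z. cos (u \<bullet> (a *\<^sub>R N (fst z) + b *\<^sub>R N (snd z))) \<partial>(M \<Otimes>\<^sub>M M)) = (\<integral>x. cos (u \<bullet> N x) \<partial>M)" .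
  have "(\<integral>z. sin (u \<bullet> (a *\<^sub>R N (fst z) + b *\<^sub>R N (snd z))) \<partial>(M \<Otimes>\<^sub>M M))
      = (\<integral>x. sin (?A x) \<partial>M) * (\<integral>x. cos (?B x) \<partial>M) + (\<integral>x. cos (?A x) \<partial>M) * (\<integral>x. sin (?B x) \<partial>M)"
    unfolding split sin_add
    using prod[of "\<lambda>x. sin (?A x)" "\<lambda>x. cos (?B x)"] prod[of "\<lambda>x. cos (?A x)" "\<lambda>x. sin (?B x)"]
    by (subst Bochner_Integration.integral_add) (simp_all del: inner_scaleR_left)
  also have "\<dots> = 0" unfolding char_N by simp
  also have "0 = (\<integral>x. sin (u \<bullet> N x) \<partial>M)" by (simp add: char_N)
  finally show "(\<integral>z. sin (u \<bullet> (a *\<^sub>R N (fst z) + b *\<^sub>R N (snd z))) \<partial>(M \<Otimes>\<^sub>M M)) = (\<integral>x. sin (u \<bullet> N x) \<partial>M)" .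
qed measurable

text \<open>Rotating \<open>(N, N')\<close> for an independent copy \<open>N'\<close> by a small angle leaves the law of the
  first component unchanged; the second-order term of this invariance is the identity below.\<close>

theorem gaussian_integration_by_parts:
  assumes "test_function g"
  shows "(\<integral>x. (\<Sum>i\<in>UNIV. N x $ i * iter_partial [i] g (a + c *\<^sub>R N x)) \<partial>M)
    = c * (\<Sum>i\<in>UNIV. \<Sum>j\<in>UNIV. S $ i $ j * (\<integral>x. iter_partial [j, i] g (a + c *\<^sub>R N x) \<partial>M))"
proof -
  interpret test_function g by fact
  define z where "z x = a + c *\<^sub>R N x" for x
  have z_meas[measurable]: "z \<in> borel_measurable M" unfolding z_def by measurable
  have Pm[measurable]: "(\<lambda>x. P is (z x)) \<in> borel_measurable M" if "length is < 4" for "is"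
    using measurable_compose[OF z_meas borel_measurable_P[OF that]] .
  have Ps: "square_integrable M (\<lambda>x. P is (z x))" if "1 \<le> length is" "length is < 4" for "is"
    using that bounded_P by (intro M.square_integrable_bounded[where B=1] Pm) auto
  have iP: "integrable M (\<lambda>x. P is (z x))" if "1 \<le> length is" "length is < 4" for "is"
    by (rule M.square_integrable_imp_integrable[OF Ps[OF that]])
  have NPs: "square_integrable M (\<lambda>x. N x $ i * P is (z x))" if "1 \<le> length is" "length is < 4" for i "is"
    using that bounded_P[of "is"] Pm[of "is"]
    by (intro square_integrable_mono[OF square_integrable_N[of i]]) (auto simp: abs_mult mult_left_le)
  have iNP: "integrable M (\<lambda>x. N x $ i * P is (z x))" if "1 \<le> length is" "length is < 4" for i "is"
    by (rule M.square_integrable_imp_integrable[OF NPs[OF that]])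
  have iNN: "integrable M (\<lambda>x. N x $ i * N x $ j)" for i j
    by (intro integrable_mult_square_integrable square_integrable_N)
  have iNNP: "integrable M (\<lambda>x. N x $ i * (N x $ j * P is (z x)))" if "1 \<le> length is" "length is < 4" for i j "is"
    by (intro integrable_mult_square_integrable square_integrable_N NPs that)
  \<comment> \<open>\<open>A\<close> is the left-hand side and \<open>s\<close> the double sum on
    the right; \<open>b\<close> is the second-order term of N itself, which will be negligible for
    small angles.\<close>
  define A where "A = (\<Sum>i\<in>UNIV. \<integral>x. N x $ i * P [i] (z x) \<partial>M)"
  define s where "s = (\<Sum>i\<in>UNIV. \<Sum>j\<in>UNIV. S $ i $ j * (\<integral>x. P [j, i] (z x) \<partial>M))"
  define b where "b = (\<Sum>i\<in>UNIV. \<Sum>j\<in>UNIV. \<integral>x. N x $ i * (N x $ j * P [j, i] (z x)) \<partial>M)"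
  define L where "L w = l1 (N (fst w)) + l1 (N (snd w))" for w :: "'b \<times> 'b"
  \<comment> \<open>Order 1 is used for the integrability of g, order 3 for the Taylor
    remainder.\<close>
  have iL: "integrable (M \<Otimes>\<^sub>M M) (\<lambda>w. L w ^ k)" if "k \<le> 3" for k
  proof (rule Bochner_Integration.integrable_bound)
    show "integrable (M \<Otimes>\<^sub>M M) (\<lambda>w. 2 ^ k * (l1 (N (fst w)) ^ k + l1 (N (snd w)) ^ k))"
      using MM.integrable_pair_fst[OF integrable_l1_power[of k]] MM.integrable_pair_snd[OF integrable_l1_power[of k]] by simp
    show "(\<lambda>w. L w ^ k) \<in> borel_measurable (M \<Otimes>\<^sub>M M)" unfolding L_def by measurable
    have "(x + y) ^ k \<le> 2 ^ k * (x ^ k + y ^ k)" if "0 \<le> x" "0 \<le> y" for x y :: real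
    proof -
      have "(x + y) ^ k \<le> (2 * max x y) ^ k" using that by (intro power_mono) auto
      also have "\<dots> \<le> 2 ^ k * (x ^ k + y ^ k)"
        using that by (simp add: power_mult_distrib max_def)
      finally show ?thesis .
    qed
    then show "AE w in M \<Otimes>\<^sub>M M. norm (L w ^ k) \<le> norm (2 ^ k * (l1 (N (fst w)) ^ k + l1 (N (snd w)) ^ k))"
      unfolding L_def by (intro AE_I2) (simp add: abs_mult)
  qed
  define K where "K = (\<integral>w. L w ^ 3 \<partial>(M \<Otimes>\<^sub>M M))"
  \<comment> \<open>With this d, adding d N + h N' to N produces a rotated vector of the same law.
    The expected increment of g is therefore 0, and the first two Taylor terms cancel up to the
    cubic remainder.\<close>
  have key: "\<bar>c * d * A + (c\<^sup>2 * (d\<^sup>2 * b + h\<^sup>2 * s)) / 2\<bar> \<le> \<bar>c\<bar> ^ 3 * h ^ 3 * K / 6"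
    if h: "0 < h" "h < 1" and d: "d = sqrt (1 - h\<^sup>2) - 1" for h d
  proof -
    define v where "v w = c *\<^sub>R (d *\<^sub>R N (fst w) + h *\<^sub>R N (snd w))" for w :: "'b \<times> 'b"
    have h2: "h\<^sup>2 \<le> h" using h by (auto simp: power2_eq_square mult_left_le)
    then have h2: "h\<^sup>2 \<le> 1" "h\<^sup>2 \<le> h" using h by auto
    have dh: "\<bar>d\<bar> \<le> h"
    proof -
      have "1 - h\<^sup>2 \<le> sqrt (1 - h\<^sup>2)" using h2 sqrt_le_D[of "1 - h\<^sup>2"]
        by (intro real_le_rsqrt) (auto simp: power2_eq_square mult_left_le)
      moreover have "sqrt (1 - h\<^sup>2) \<le> 1" by simp
      ultimately show ?thesis using h2(2) unfolding d by linarith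
    qed
    have lv: "l1 (v w) \<le> \<bar>c\<bar> * h * L w" for w
    proof -
      have "l1 (v w) = \<bar>c\<bar> * l1 (d *\<^sub>R N (fst w) + h *\<^sub>R N (snd w))" by (simp add: v_def l1_scaleR)
      also have "\<dots> \<le> \<bar>c\<bar> * (l1 (d *\<^sub>R N (fst w)) + l1 (h *\<^sub>R N (snd w)))"
        by (intro mult_left_mono l1_triangle) simp
      also have "\<dots> \<le> \<bar>c\<bar> * (h * l1 (N (fst w)) + h * l1 (N (snd w)))"
        using dh h by (intro mult_left_mono add_mono) (auto simp: l1_scaleR intro!: mult_right_mono)
      finally show ?thesis by (simp add: L_def algebra_simps)
    qed
    have v_meas[measurable]: "v \<in> borel_measurable (M \<Otimes>\<^sub>M M)" unfolding v_def by measurable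
    let ?T1 = "\<lambda>w. \<Sum>i\<in>UNIV. v w $ i * P [i] (z (fst w))"
    let ?T2 = "\<lambda>w. \<Sum>i\<in>UNIV. v w $ i * (\<Sum>j\<in>UNIV. v w $ j * P [j, i] (z (fst w)))"
    \<comment> \<open>The part that is linear in N' vanishes by independence and centring.\<close>
    have T1: "(\<integral>w. ?T1 w \<partial>(M \<Otimes>\<^sub>M M)) = c * d * A" and iT1: "integrable (M \<Otimes>\<^sub>M M) ?T1"
    proof -
      have eq: "?T1 w = (\<Sum>i\<in>UNIV. c * d * (N (fst w) $ i * P [i] (z (fst w)))
          + c * h * (P [i] (z (fst w)) * N (snd w) $ i))" for w
        by (intro sum.cong) (simp_all add: v_def algebra_simps)
      have i: "integrable (M \<Otimes>\<^sub>M M) (\<lambda>w. N (fst w) $ i * P [i] (z (fst w)))"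
        "integrable (M \<Otimes>\<^sub>M M) (\<lambda>w. P [i] (z (fst w)) * N (snd w) $ i)" for i
        using MM.integrable_pair_fst[OF iNP[of "[i]" i]] MM.integrable_pair_mult[OF iP[of "[i]"] integrable_N[of i]] by simp_all
      have e: "(\<integral>w. N (fst w) $ i * P [i] (z (fst w)) \<partial>(M \<Otimes>\<^sub>M M)) = (\<integral>x. N x $ i * P [i] (z x) \<partial>M)"
        "(\<integral>w. P [i] (z (fst w)) * N (snd w) $ i \<partial>(M \<Otimes>\<^sub>M M)) = 0" for i
        using MM.integral_pair_fst[OF iNP[of "[i]" i]] MM.integral_pair_mult[OF iP[of "[i]"] integrable_N[of i]]
        by (simp_all add: N_component_mean)
      show "integrable (M \<Otimes>\<^sub>M M) ?T1" unfolding eq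
        by (intro Bochner_Integration.integrable_sum Bochner_Integration.integrable_add integrable_mult_right i)
      show "(\<integral>w. ?T1 w \<partial>(M \<Otimes>\<^sub>M M)) = c * d * A" unfolding eq using i
        by (simp add: e A_def sum_distrib_left del: foldr.simps)
    qed
    \<comment> \<open>The mixed terms vanish for the same reason; the term quadratic in N' brings in
      the covariance matrix.\<close>
    have T2: "(\<integral>w. ?T2 w \<partial>(M \<Otimes>\<^sub>M M)) = c\<^sup>2 * (d\<^sup>2 * b + h\<^sup>2 * s)" and iT2: "integrable (M \<Otimes>\<^sub>M M) ?T2"
    proof -
      have eq: "?T2 w = (\<Sum>i\<in>UNIV. \<Sum>j\<in>UNIV. c\<^sup>2 * d\<^sup>2 * (N (fst w) $ i * (N (fst w) $ j * P [j, i] (z (fst w))))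
          + c\<^sup>2 * d * h * ((N (fst w) $ i * P [j, i] (z (fst w))) * N (snd w) $ j)
          + c\<^sup>2 * d * h * ((N (fst w) $ j * P [j, i] (z (fst w))) * N (snd w) $ i)
          + c\<^sup>2 * h\<^sup>2 * (P [j, i] (z (fst w)) * (N (snd w) $ i * N (snd w) $ j)))" for w
        unfolding sum_distrib_left
        by (intro sum.cong refl) (simp add: v_def algebra_simps power2_eq_square)
      have i: "integrable (M \<Otimes>\<^sub>M M) (\<lambda>w. N (fst w) $ i * (N (fst w) $ j * P [j, i] (z (fst w))))"
        "integrable (M \<Otimes>\<^sub>M M) (\<lambda>w. (N (fst w) $ i * P [j, i] (z (fst w))) * N (snd w) $ j)"
        "integrable (M \<Otimes>\<^sub>M M) (\<lambda>w. (N (fst w) $ j * P [j, i] (z (fst w))) * N (snd w) $ i)"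
        "integrable (M \<Otimes>\<^sub>M M) (\<lambda>w. P [j, i] (z (fst w)) * (N (snd w) $ i * N (snd w) $ j))" for i j
        using MM.integrable_pair_fst[OF iNNP[of "[j,i]" i j]] MM.integrable_pair_mult[OF iNP[of "[j,i]" i] integrable_N[of j]]
          MM.integrable_pair_mult[OF iNP[of "[j,i]" j] integrable_N[of i]] MM.integrable_pair_mult[OF iP[of "[j,i]"] iNN[of i j]] by simp_all
      have e: "(\<integral>w. N (fst w) $ i * (N (fst w) $ j * P [j, i] (z (fst w))) \<partial>(M \<Otimes>\<^sub>M M)) = (\<integral>x. N x $ i * (N x $ j * P [j, i] (z x)) \<partial>M)"
        "(\<integral>w. (N (fst w) $ i * P [j, i] (z (fst w))) * N (snd w) $ j \<partial>(M \<Otimes>\<^sub>M M)) = 0"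
        "(\<integral>w. (N (fst w) $ j * P [j, i] (z (fst w))) * N (snd w) $ i \<partial>(M \<Otimes>\<^sub>M M)) = 0"
        "(\<integral>w. P [j, i] (z (fst w)) * (N (snd w) $ i * N (snd w) $ j) \<partial>(M \<Otimes>\<^sub>M M)) = S $ i $ j * (\<integral>x. P [j, i] (z x) \<partial>M)" for i j
        using MM.integral_pair_fst[OF iNNP[of "[j,i]" i j]] MM.integral_pair_mult[OF iNP[of "[j,i]" i] integrable_N[of j]]
          MM.integral_pair_mult[OF iNP[of "[j,i]" j] integrable_N[of i]] MM.integral_pair_mult[OF iP[of "[j,i]"] iNN[of i j]]
        by (simp_all add: N_component_mean N_component_cov mult.commute)
      show "integrable (M \<Otimes>\<^sub>M M) ?T2" unfolding eq
        by (intro Bochner_Integration.integrable_sum Bochner_Integration.integrable_add integrable_mult_right i)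
      have "(\<integral>w. ?T2 w \<partial>(M \<Otimes>\<^sub>M M)) = (\<Sum>i\<in>UNIV. \<Sum>j\<in>UNIV.
          c\<^sup>2 * d\<^sup>2 * (\<integral>x. N x $ i * (N x $ j * P [j, i] (z x)) \<partial>M)
          + c\<^sup>2 * h\<^sup>2 * (S $ i $ j * (\<integral>x. P [j, i] (z x) \<partial>M)))"
        unfolding eq
      proof (subst Bochner_Integration.integral_sum, goal_cases)
        case 2
        show ?case
        proof (intro sum.cong refl, subst Bochner_Integration.integral_sum, goal_cases)
          case (2 i)
          show ?case
          proof (intro sum.cong refl)
            fix j
            show "(\<integral>w. c\<^sup>2 * d\<^sup>2 * (N (fst w) $ i * (N (fst w) $ j * P [j, i] (z (fst w))))
              + c\<^sup>2 * d * h * ((N (fst w) $ i * P [j, i] (z (fst w))) * N (snd w) $ j)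
              + c\<^sup>2 * d * h * ((N (fst w) $ j * P [j, i] (z (fst w))) * N (snd w) $ i)
              + c\<^sup>2 * h\<^sup>2 * (P [j, i] (z (fst w)) * (N (snd w) $ i * N (snd w) $ j)) \<partial>(M \<Otimes>\<^sub>M M))
              = c\<^sup>2 * d\<^sup>2 * (\<integral>x. N x $ i * (N x $ j * P [j, i] (z x)) \<partial>M)
              + c\<^sup>2 * h\<^sup>2 * (S $ i $ j * (\<integral>x. P [j, i] (z x) \<partial>M))"
              by (simp only: i e Bochner_Integration.integral_add integrable_mult_right
                Bochner_Integration.integrable_add integral_mult_right_zero mult_zero_right add_0_right)
          qed
        qed (intro Bochner_Integration.integrable_add integrable_mult_right i)
      qed (intro Bochner_Integration.integrable_sum Bochner_Integration.integrable_add integrable_mult_right i)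
      also have "\<dots> = c\<^sup>2 * (d\<^sup>2 * b + h\<^sup>2 * s)"
        by (simp only: sum.distrib sum_distrib_left[symmetric] b_def[symmetric] s_def[symmetric])
           (simp only: distrib_left mult.assoc)
      finally show "(\<integral>w. ?T2 w \<partial>(M \<Otimes>\<^sub>M M)) = c\<^sup>2 * (d\<^sup>2 * b + h\<^sup>2 * s)" .
    qed
    have g_meas: "P [] \<in> borel_measurable borel" by (rule borel_measurable_P) simp
    have lip: "\<bar>g (y + u) - g y\<bar> \<le> l1 u" for y u using P_lipschitz[of "[]" y u] by simp
    have ig: "integrable M (\<lambda>x. g (z x))"
    proof (rule Bochner_Integration.integrable_bound)
      show "integrable M (\<lambda>x. \<bar>g a\<bar> + \<bar>c\<bar> * l1 (N x) ^ 1)" using integrable_l1_power[of 1] by simp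
      show "AE x in M. norm (g (z x)) \<le> norm (\<bar>g a\<bar> + \<bar>c\<bar> * l1 (N x) ^ 1)"
      proof (intro AE_I2)
        fix x
        show "norm (g (z x)) \<le> norm (\<bar>g a\<bar> + \<bar>c\<bar> * l1 (N x) ^ 1)"
          using lip[of a "c *\<^sub>R N x"] unfolding z_def by (simp add: l1_scaleR)
      qed
      show "(\<lambda>x. g (z x)) \<in> borel_measurable M" using Pm[of "[]"] by simp
    qed
    note ig1 = MM.integrable_pair_fst[OF ig]
    have ig2: "integrable (M \<Otimes>\<^sub>M M) (\<lambda>w. g (z (fst w) + v w))"
    proof (rule Bochner_Integration.integrable_bound)
      show "integrable (M \<Otimes>\<^sub>M M) (\<lambda>w. \<bar>g (z (fst w))\<bar> + \<bar>c\<bar> * h * L w ^ 1)" using ig1 iL[of 1] by simp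
      show "AE w in M \<Otimes>\<^sub>M M. norm (g (z (fst w) + v w)) \<le> norm (\<bar>g (z (fst w))\<bar> + \<bar>c\<bar> * h * L w ^ 1)"
      proof (intro AE_I2)
        fix w
        show "norm (g (z (fst w) + v w)) \<le> norm (\<bar>g (z (fst w))\<bar> + \<bar>c\<bar> * h * L w ^ 1)"
          using lip[of "z (fst w)" "v w"] lv[of w] by simp
      qed
      have "(\<lambda>w. P [] (z (fst w) + v w)) \<in> borel_measurable (M \<Otimes>\<^sub>M M)"
        by (rule measurable_compose[OF _ g_meas]) measurable
      then show "(\<lambda>w. g (z (fst w) + v w)) \<in> borel_measurable (M \<Otimes>\<^sub>M M)" by simp
    qed
    let ?f = "\<lambda>y. g (a + c *\<^sub>R y)"
    have zv: "a + c *\<^sub>R (sqrt (1 - h\<^sup>2) *\<^sub>R N (fst w) + h *\<^sub>R N (snd w)) = z (fst w) + v w" for w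
      unfolding z_def v_def d by (simp add: algebra_simps)
    have fc: "continuous_on UNIV ?f"
      using continuous_P[of "[]"] by (auto intro!: continuous_on_compose2[of UNIV g] continuous_intros)
    have "(\<integral>w. ?f (sqrt (1 - h\<^sup>2) *\<^sub>R N (fst w) + h *\<^sub>R N (snd w)) \<partial>(M \<Otimes>\<^sub>M M)) = (\<integral>x. ?f (N x) \<partial>M)"
    proof (rule gaussian_stability[OF _ fc])
      show "(sqrt (1 - h\<^sup>2))\<^sup>2 + h\<^sup>2 = 1" using h2 by simp
      show "integrable M (\<lambda>x. ?f (N x))" using ig by (simp add: z_def)
      show "integrable (M \<Otimes>\<^sub>M M) (\<lambda>w. ?f (sqrt (1 - h\<^sup>2) *\<^sub>R N (fst w) + h *\<^sub>R N (snd w)))"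
        unfolding zv by (rule ig2)
    qed
    then have inv: "(\<integral>w. g (z (fst w) + v w) \<partial>(M \<Otimes>\<^sub>M M)) = (\<integral>w. g (z (fst w)) \<partial>(M \<Otimes>\<^sub>M M))"
      unfolding zv MM.integral_pair_fst[OF ig] by (simp add: z_def)
    have tay: "\<bar>g (z (fst w) + v w) - g (z (fst w)) - ?T1 w - ?T2 w / 2\<bar> \<le> \<bar>c\<bar> ^ 3 * h ^ 3 / 6 * L w ^ 3" for w
    proof -
      have "\<bar>g (z (fst w) + v w) - g (z (fst w)) - ?T1 w - ?T2 w / 2\<bar> \<le> l1 (v w) ^ 3 / 6"
        using P_taylor2[of "[]" "z (fst w)" "v w"] by simp
      also have "\<dots> \<le> (\<bar>c\<bar> * h * L w) ^ 3 / 6"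
        using lv[of w] by (intro divide_right_mono power_mono) auto
      finally show ?thesis by (simp add: power_mult_distrib)
    qed
    have "\<bar>\<integral>w. g (z (fst w) + v w) - g (z (fst w)) - ?T1 w - ?T2 w / 2 \<partial>(M \<Otimes>\<^sub>M M)\<bar>
        \<le> (\<integral>w. \<bar>c\<bar> ^ 3 * h ^ 3 / 6 * L w ^ 3 \<partial>(M \<Otimes>\<^sub>M M))"
    proof (rule abs_integral_le_integral)
      show "integrable (M \<Otimes>\<^sub>M M) (\<lambda>w. g (z (fst w) + v w) - g (z (fst w)) - ?T1 w - ?T2 w / 2)"
        by (intro Bochner_Integration.integrable_diff integrable_divide ig1 ig2 iT1 iT2)
    qed (use iL[of 3] tay in auto)
    also have "(\<integral>w. g (z (fst w) + v w) - g (z (fst w)) - ?T1 w - ?T2 w / 2 \<partial>(M \<Otimes>\<^sub>M M))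
        = - (c * d * A) - (c\<^sup>2 * (d\<^sup>2 * b + h\<^sup>2 * s)) / 2"
      unfolding T1[symmetric] T2[symmetric] using ig1 ig2 iT1 iT2 inv by (simp del: foldr.simps)
    finally have "\<bar>- (c * d * A) - (c\<^sup>2 * (d\<^sup>2 * b + h\<^sup>2 * s)) / 2\<bar> \<le> \<bar>c\<bar> ^ 3 * h ^ 3 * K / 6"
      unfolding integral_mult_right_zero K_def[symmetric] by simp
    moreover have "\<bar>x + y\<bar> \<le> r" if "\<bar>- x - y\<bar> \<le> r" for x y r :: real
      using that by linarith
    ultimately show ?thesis by blast
  qed
  \<comment> \<open>The estimate \<open>key\<close> is divided by h^2 and h tends to 0: d / h^2
    tends to -1/2, d^2 / h^2 tends to 0, and the remainder is of order h.\<close>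
  have "c * A = c\<^sup>2 * s"
  proof -
    let ?l = "\<lambda>h. \<bar>- c * A / (1 + sqrt (1 - h\<^sup>2)) + c\<^sup>2 * (h\<^sup>2 * b / (1 + sqrt (1 - h\<^sup>2))\<^sup>2 + s) / 2\<bar>"
    have le: "?l h \<le> \<bar>c\<bar> ^ 3 * h * K / 6" if h: "0 < h" "h < 1" for h
    proof -
      define r where "r = 1 + sqrt (1 - h\<^sup>2)"
      have h1: "h\<^sup>2 \<le> 1" using h by (simp add: power_le_one)
      then have r: "0 < r" by (simp add: r_def add_pos_nonneg)
      \<comment> \<open>Rationalising makes the division by h^2 exact and leaves an expression that
        is continuous at h = 0.\<close>
      have d: "sqrt (1 - h\<^sup>2) - 1 = - h\<^sup>2 / r"
      proof -
        have "(sqrt (1 - h\<^sup>2) - 1) * r = - h\<^sup>2"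
          using h1 by (simp add: r_def algebra_simps power2_eq_square[symmetric] real_sqrt_pow2)
        then show ?thesis using r by (simp add: field_simps)
      qed
      have "h\<^sup>2 * \<bar>- c * A / r + c\<^sup>2 * (h\<^sup>2 * b / r\<^sup>2 + s) / 2\<bar> = \<bar>h\<^sup>2 * (- c * A / r + c\<^sup>2 * (h\<^sup>2 * b / r\<^sup>2 + s) / 2)\<bar>"
        by (simp add: abs_mult)
      also have "h\<^sup>2 * (- c * A / r + c\<^sup>2 * (h\<^sup>2 * b / r\<^sup>2 + s) / 2)
          = c * (- h\<^sup>2 / r) * A + (c\<^sup>2 * ((- h\<^sup>2 / r)\<^sup>2 * b + h\<^sup>2 * s)) / 2"
        using r by (simp add: field_simps power2_eq_square)
      also have "\<bar>\<dots>\<bar> \<le> \<bar>c\<bar> ^ 3 * h ^ 3 * K / 6"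
        using key[OF h refl] unfolding d .
      also have "\<dots> = h\<^sup>2 * (\<bar>c\<bar> ^ 3 * h * K / 6)" by (simp add: power2_eq_square power3_eq_cube)
      finally show ?thesis using h unfolding r_def by (simp add: mult_le_cancel_left_pos)
    qed
    have l1: "((\<lambda>h. ?l h) \<longlongrightarrow> ?l 0) (at_right 0)"
      by (intro tendsto_intros) auto
    have l2: "((\<lambda>h. \<bar>c\<bar> ^ 3 * h * K / 6) \<longlongrightarrow> \<bar>c\<bar> ^ 3 * 0 * K / 6) (at_right 0)"
      by (intro tendsto_intros) auto
    have ev: "eventually (\<lambda>h. ?l h \<le> \<bar>c\<bar> ^ 3 * h * K / 6) (at_right 0)"
      unfolding eventually_at_right_field by (intro exI[of _ 1]) (use le in auto)
    have "?l 0 \<le> \<bar>c\<bar> ^ 3 * 0 * K / 6"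
      by (rule tendsto_le[OF _ l2 l1 ev]) simp
    then show ?thesis by simp
  qed
  \<comment> \<open>For c = 0 the limit says nothing; then the gradient is taken at the fixed point
    a, and N has mean 0.\<close>
  moreover have "A = 0" if "c = 0"
    using that unfolding A_def z_def by (simp add: N_component_mean)
  ultimately have "A = c * s" by (cases "c = 0") (auto simp: power2_eq_square)
  moreover have "(\<integral>x. (\<Sum>i\<in>UNIV. N x $ i * P [i] (z x)) \<partial>M) = A"
    unfolding A_def by (intro Bochner_Integration.integral_sum iNP) auto
  ultimately show ?thesis by (simp only: s_def z_def)
qed

end

section \<open>The smart path\<close>

text \<open>If the series of absolute values diverges, the right-hand side is infinite, so plain
  summability suffices.\<close>

lemma ennreal_abs_suminf_le:
  fixes a :: "nat \<Rightarrow> real"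
  assumes "summable a"
  shows "ennreal \<bar>suminf a\<bar> \<le> (\<Sum>k. ennreal \<bar>a k\<bar>)"
proof (cases "(\<Sum>k. ennreal \<bar>a k\<bar>) = \<infinity>")
  case False
  then have s: "summable (\<lambda>k. \<bar>a k\<bar>)" by (intro summable_suminf_not_top) auto
  have "ennreal \<bar>suminf a\<bar> \<le> ennreal (\<Sum>k. \<bar>a k\<bar>)"
    by (intro ennreal_leI summable_rabs s)
  also have "\<dots> = (\<Sum>k. ennreal \<bar>a k\<bar>)" using s by (intro suminf_ennreal2[symmetric]) auto
  finally show ?thesis .
qed simp

text \<open>The integral of a non-integrable function is 0 by convention, so no integrability has to
  be checked on application.\<close>

lemma norm_integral_le_nn_integral: "ennreal (norm (\<integral>x. f x \<partial>M)) \<le> (\<integral>\<^sup>+x. norm (f x) \<partial>M)"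
  by (cases "integrable M f") (simp_all add: integral_norm_bound_ennreal not_integrable_integral_eq)

lemma AE_summable_of_summable_integral:
  fixes f :: "nat \<Rightarrow> 'a \<Rightarrow> real"
  assumes i: "\<And>k. integrable M (f k)" and s: "summable (\<lambda>k. \<integral>x. \<bar>f k x\<bar> \<partial>M)"
  shows "AE x in M. summable (\<lambda>k. \<bar>f k x\<bar>)"
proof -
  have [measurable]: "f k \<in> borel_measurable M" for k using i by auto
  have "(\<integral>\<^sup>+x. (\<Sum>k. ennreal \<bar>f k x\<bar>) \<partial>M) = (\<Sum>k. ennreal (\<integral>x. \<bar>f k x\<bar> \<partial>M))"
    using i by (simp add: nn_integral_suminf nn_integral_eq_integral)
  also have "\<dots> \<noteq> \<infinity>" using s by (simp add: suminf_ennreal2)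
  finally have "AE x in M. (\<Sum>k. ennreal \<bar>f k x\<bar>) \<noteq> \<infinity>"
    by (intro nn_integral_noteq_infinite) auto
  then show ?thesis by eventually_elim (auto intro!: summable_suminf_not_top)
qed

lemma borel_measurable_vec_lambda:
  fixes F :: "'d::finite \<Rightarrow> 'a \<Rightarrow> real"
  assumes [measurable]: "\<And>i. F i \<in> borel_measurable M"
  shows "(\<lambda>x. \<chi> i. F i x) \<in> borel_measurable M"
proof -
  have "(\<lambda>x. \<chi> i. F i x) = (\<lambda>x. \<Sum>i\<in>UNIV. F i x *\<^sub>R axis i 1)"
    using sum_axis[of "\<chi> i. F i _"] by (intro ext) (metis (no_types, lifting) sum.cong vec_lambda_beta)
  then show ?thesis by simp
qed

lemma (in rademacher_seq) D_uminus: "D p k (\<lambda>\<omega>. - V \<omega>) \<omega> = - D p k V \<omega>"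
  by (simp add: D_def algebra_simps)

section \<open>Gradients of functions of the Rademacher vector\<close>

locale rademacher_vector = rademacher_seq p + test_function g
  for p :: "nat \<Rightarrow> real" and g :: "real ^ 'd::finite \<Rightarrow> real" +
  fixes F :: "'d \<Rightarrow> (nat \<Rightarrow> real) \<Rightarrow> real"
  assumes dom: "\<And>i. F i \<in> dom_D p" and centred: "\<And>i. (\<integral>\<omega>. F i \<omega> \<partial>rademacher p) = 0"
begin

definition V :: "(nat \<Rightarrow> real) \<Rightarrow> real ^ 'd" where "V \<omega> = (\<chi> i. F i \<omega>)"

definition U :: "'d \<Rightarrow> (nat \<Rightarrow> real) \<Rightarrow> real" where "U i \<omega> = - L_inv p (F i) \<omega>"

text \<open>Up to the factor sqrt (p (1 - p)), this is the l1 norm of the jump of \<open>V\<close>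
  at coordinate k.\<close>

definition W :: "nat \<Rightarrow> (nat \<Rightarrow> real) \<Rightarrow> real" where "W k \<omega> = (\<Sum>j\<in>UNIV. \<bar>D p k (F j) \<omega>\<bar>)"

lemma square_integrable_F: "square_integrable R (F i)"
  using dom[of i] by (simp add: dom_D_def)

lemma F_measurable[measurable]: "F i \<in> borel_measurable R"
  using square_integrable_F by auto

lemma energy_F: "energy (F i) < \<infinity>"
  using dom centred by (rule dom_D_energy)

lemma V_measurable[measurable]: "V \<in> borel_measurable R"
  unfolding V_def by (rule borel_measurable_vec_lambda) measurable

lemma U_props:
  shows square_integrable_U: "square_integrable R (U i)" and energy_U: "energy (U i) < \<infinity>"
    and F_by_parts: "square_integrable R G \<Longrightarrow> energy G < \<infinity> \<Longrightarrow>
      (\<lambda>k. \<integral>\<omega>. D p k G \<omega> * D p k (U i) \<omega> \<partial>R) sums (\<integral>\<omega>. F i \<omega> * G \<omega> \<partial>R)"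
proof -
  obtain f where f: "has_chaos_kernels p (F i) f" using dom[of i] by (auto simp: dom_D_def)
  have U: "U i = (\<lambda>\<omega>. - L_inv p (F i) \<omega>)" by (simp add: U_def fun_eq_iff)
  note * = integration_by_parts[OF f centred]
  \<comment> \<open>Two of the conclusions of integration by parts do not mention G; G = 0 serves to
    obtain them.\<close>
  have 0: "square_integrable R (\<lambda>\<omega>. 0)" "energy (\<lambda>\<omega>. 0) < \<infinity>"
    by (simp_all add: energy_def D_def)
  show "square_integrable R (U i)" unfolding U by (intro square_integrable_uminus *(1)[OF 0])
  show "energy (U i) < \<infinity>" unfolding U by (rule *(2)[OF 0])
  show "square_integrable R G \<Longrightarrow> energy G < \<infinity> \<Longrightarrow>
      (\<lambda>k. \<integral>\<omega>. D p k G \<omega> * D p k (U i) \<omega> \<partial>R) sums (\<integral>\<omega>. F i \<omega> * G \<omega> \<partial>R)"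
    unfolding U by (rule *(3))
qed

lemma D_F_measurable[measurable]: "D p k (F i) \<in> borel_measurable R" "D p k (U i) \<in> borel_measurable R"
  using square_integrable_F[of i] square_integrable_U[of i] by (auto intro!: square_integrable_measurable)

lemma W_measurable[measurable]: "W k \<in> borel_measurable R"
  unfolding W_def by measurable

lemma integrable_DD: "integrable R (\<lambda>\<omega>. D p k (F j) \<omega> * D p k (U i) \<omega>)"
  by (intro integrable_mult_square_integrable square_integrable_D square_integrable_F square_integrable_U)

lemma integrable_DD_bounded:
  assumes [measurable]: "H \<in> borel_measurable R" and "\<And>\<omega>. \<bar>H \<omega>\<bar> \<le> 1"
  shows "integrable R (\<lambda>\<omega>. D p k (F j) \<omega> * D p k (U i) \<omega> * H \<omega>)"
  using integrable_DD[of k j i] by (rule Bochner_Integration.integrable_bound) (use assms in \<open>auto simp: abs_mult mult_left_le\<close>)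

text \<open>Finite energies of \<open>F j\<close> and \<open>U i\<close> make the inner product of
  their gradients converge absolutely in L^1, hence almost surely.\<close>

lemma summable_integral_abs_DD: "summable (\<lambda>k. \<integral>\<omega>. \<bar>D p k (F j) \<omega> * D p k (U i) \<omega>\<bar> \<partial>R)"
proof (rule summable_comparison_test'[where N=0])
  show "summable (\<lambda>k. (\<integral>\<omega>. (D p k (F j) \<omega>)\<^sup>2 \<partial>R) + (\<integral>\<omega>. (D p k (U i) \<omega>)\<^sup>2 \<partial>R))"
    by (intro summable_add energy_less_top_summable(1) energy_F energy_U square_integrable_F square_integrable_U)
  fix k
  have "(\<integral>\<omega>. \<bar>D p k (F j) \<omega>\<bar> * \<bar>D p k (U i) \<omega>\<bar> \<partial>R) \<le> (\<integral>\<omega>. (D p k (F j) \<omega>)\<^sup>2 \<partial>R) + (\<integral>\<omega>. (D p k (U i) \<omega>)\<^sup>2 \<partial>R)"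
    using abs_integral_mult_le[OF square_integrable_abs[OF square_integrable_D[OF square_integrable_F]]
        square_integrable_abs[OF square_integrable_D[OF square_integrable_U]], of 1 k j k i] by simp
  then show "norm (\<integral>\<omega>. \<bar>D p k (F j) \<omega> * D p k (U i) \<omega>\<bar> \<partial>R)
      \<le> (\<integral>\<omega>. (D p k (F j) \<omega>)\<^sup>2 \<partial>R) + (\<integral>\<omega>. (D p k (U i) \<omega>)\<^sup>2 \<partial>R)"
    by (simp add: abs_mult)
qed

lemma AE_summable_DD: "AE \<omega> in R. summable (\<lambda>k. \<bar>D p k (F j) \<omega> * D p k (U i) \<omega>\<bar>)"
  by (rule AE_summable_of_summable_integral[OF integrable_DD summable_integral_abs_DD])

text \<open>Exchange of the sum over k with the expectation. The series converges only almost
  surely; elsewhere \<open>suminf\<close> may have an unspecified value, which the integral does not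
  see.\<close>

lemma sums_integral_DD:
  assumes [measurable]: "H \<in> borel_measurable R" and H: "\<And>\<omega>. \<bar>H \<omega>\<bar> \<le> 1"
  shows "(\<lambda>k. \<integral>\<omega>. D p k (F j) \<omega> * D p k (U i) \<omega> * H \<omega> \<partial>R) sums
      (\<integral>\<omega>. (\<Sum>k. D p k (F j) \<omega> * D p k (U i) \<omega>) * H \<omega> \<partial>R)"
    and "integrable R (\<lambda>\<omega>. (\<Sum>k. D p k (F j) \<omega> * D p k (U i) \<omega>) * H \<omega>)"
proof -
  let ?f = "\<lambda>k \<omega>. D p k (F j) \<omega> * D p k (U i) \<omega> * H \<omega>"
  note i = integrable_DD_bounded[OF assms]
  have le: "\<bar>?f k \<omega>\<bar> \<le> \<bar>D p k (F j) \<omega> * D p k (U i) \<omega>\<bar>" for k \<omega>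
    using H[of \<omega>] by (simp add: abs_mult mult_left_le)
  have ae: "AE \<omega> in R. summable (\<lambda>k. norm (?f k \<omega>))"
    using AE_summable_DD[of j i]
    by eventually_elim (rule summable_comparison_test'[where N=0], assumption, use le in simp)
  have s: "summable (\<lambda>k. \<integral>\<omega>. norm (?f k \<omega>) \<partial>R)"
  proof (rule summable_comparison_test'[OF summable_integral_abs_DD[of j i], of 0])
    fix k
    show "norm (\<integral>\<omega>. norm (?f k \<omega>) \<partial>R) \<le> (\<integral>\<omega>. \<bar>D p k (F j) \<omega> * D p k (U i) \<omega>\<bar> \<partial>R)"
      using i integrable_DD le by (simp add: integral_mono)
  qed
  have eq: "AE \<omega> in R. (\<Sum>k. ?f k \<omega>) = (\<Sum>k. D p k (F j) \<omega> * D p k (U i) \<omega>) * H \<omega>"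
    using AE_summable_DD[of j i] by eventually_elim (intro suminf_mult2[symmetric], rule summable_rabs_cancel)
  have "integrable R (\<lambda>\<omega>. \<Sum>k. ?f k \<omega>)" by (rule integrable_suminf[OF i ae s])
  then show "integrable R (\<lambda>\<omega>. (\<Sum>k. D p k (F j) \<omega> * D p k (U i) \<omega>) * H \<omega>)"
    using eq by (subst integrable_cong_AE[symmetric]) auto
  have "(\<lambda>k. \<integral>\<omega>. ?f k \<omega> \<partial>R) sums (\<integral>\<omega>. (\<Sum>k. ?f k \<omega>) \<partial>R)" by (rule sums_integral[OF i ae s])
  also have "(\<integral>\<omega>. (\<Sum>k. ?f k \<omega>) \<partial>R) = (\<integral>\<omega>. (\<Sum>k. D p k (F j) \<omega> * D p k (U i) \<omega>) * H \<omega> \<partial>R)"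
    using eq by (intro integral_cong_AE) auto
  finally show "(\<lambda>k. \<integral>\<omega>. ?f k \<omega> \<partial>R) sums
      (\<integral>\<omega>. (\<Sum>k. D p k (F j) \<omega> * D p k (U i) \<omega>) * H \<omega> \<partial>R)" .
qed

abbreviation sd :: "nat \<Rightarrow> real" where "sd k \<equiv> sqrt (p k * (1 - p k))"

lemma V_increment:
  "V (fun_upd \<omega> k 1) - V (fun_upd \<omega> k (-1)) = (\<chi> j. D p k (F j) \<omega> / sd k)"
  using p_pos[of k] p_less[of k] by (simp add: V_def D_def vec_eq_iff)

lemma l1_V_increment: "l1 (\<chi> j. D p k (F j) \<omega> / sd k) = W k \<omega> / sd k"
  using pq_pos[of k] by (simp add: l1_def W_def abs_divide sum_divide_distrib)

text \<open>For s <= 1 the Lipschitz bound on \<open>P is\<close> dominates the gradient of the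
  composition at k by \<open>W k\<close>, so its energy is controlled by the energies of the
  components.\<close>

lemma energy_composition:
  assumes "length is = 1" "0 \<le> s" "s \<le> 1"
  shows "square_integrable R (\<lambda>\<omega>. P is (s *\<^sub>R V \<omega> + a))" "energy (\<lambda>\<omega>. P is (s *\<^sub>R V \<omega> + a)) < \<infinity>"
proof -
  let ?G = "\<lambda>\<omega>. P is (s *\<^sub>R V \<omega> + a)"
  have [measurable]: "P is \<in> borel_measurable borel" using assms by (intro borel_measurable_P) simp
  show sG: "square_integrable R ?G"
    using bounded_P[of "is"] assms(1) by (intro square_integrable_bounded[where B=1]) auto
  have DW: "\<bar>D p k ?G \<omega>\<bar> \<le> W k \<omega>" for k \<omega>
  proof -
    let ?v = "\<chi> j. D p k (F j) \<omega> / sd k"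
    have eq: "s *\<^sub>R V (fun_upd \<omega> k 1) + a = s *\<^sub>R V (fun_upd \<omega> k (-1)) + a + s *\<^sub>R ?v"
      using V_increment[of \<omega> k] by (simp add: algebra_simps flip: scaleR_add_right)
    have "\<bar>?G (fun_upd \<omega> k 1) - ?G (fun_upd \<omega> k (-1))\<bar> \<le> l1 (s *\<^sub>R ?v)"
      unfolding eq using assms by (intro P_lipschitz) simp
    also have "\<dots> \<le> W k \<omega> / sd k"
      unfolding l1_scaleR l1_V_increment[symmetric] using assms by (simp add: mult_left_le_one_le)
    finally have "sd k * \<bar>?G (fun_upd \<omega> k 1) - ?G (fun_upd \<omega> k (-1))\<bar> \<le> sd k * (W k \<omega> / sd k)"
      using pq_pos[of k] by (intro mult_left_mono) auto
    then show ?thesis using pq_pos[of k] p_pos[of k] p_less[of k] by (simp add: D_def abs_mult)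
  qed
  have "L2sq R (D p k ?G) \<le> ennreal CARD('d) * (\<Sum>j\<in>UNIV. L2sq R (D p k (F j)))" for k
  proof -
    have "L2sq R (D p k ?G) \<le> L2sq R (\<lambda>\<omega>. \<Sum>j\<in>UNIV. \<bar>D p k (F j) \<omega>\<bar>)"
    proof (intro nn_integral_mono ennreal_leI)
      fix \<omega>
      show "(D p k ?G \<omega>)\<^sup>2 \<le> (\<Sum>j\<in>UNIV. \<bar>D p k (F j) \<omega>\<bar>)\<^sup>2"
        using DW[of k \<omega>] power_mono[of "\<bar>D p k ?G \<omega>\<bar>" "W k \<omega>" 2] by (simp add: W_def)
    qed
    also have "\<dots> \<le> of_nat (card (UNIV :: 'd set)) * (\<Sum>j\<in>UNIV. L2sq R (\<lambda>\<omega>. \<bar>D p k (F j) \<omega>\<bar>))"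
      by (intro L2sq_sum_le) measurable
    finally show ?thesis by (simp add: ennreal_of_nat_eq_real_of_nat)
  qed
  then have "energy ?G \<le> (\<Sum>k. ennreal CARD('d) * (\<Sum>j\<in>UNIV. L2sq R (D p k (F j))))"
    unfolding energy_def by (intro suminf_le summableI)
  also have "\<dots> = ennreal CARD('d) * (\<Sum>j\<in>UNIV. energy (F j))"
    unfolding energy_def ennreal_suminf_cmult by (simp add: suminf_sum[OF summableI])
  also have "\<dots> < \<infinity>" using energy_F by (simp add: ennreal_mult_less_top)
  finally show "energy ?G < \<infinity>" .
qed

text \<open>The error in \<open>P_weighted_trapezoid\<close> for a jump of l1 norm s W / sqrt (p (1
  - p)), multiplied by the factor sqrt (p (1 - p)) of \<open>D\<close>.\<close>

definition rem :: "real \<Rightarrow> nat \<Rightarrow> (nat \<Rightarrow> real) \<Rightarrow> real" where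
  "rem s k \<omega> = s\<^sup>2 / 2 * (\<bar>p k - (1 - p k)\<bar> / sd k * (W k \<omega>)\<^sup>2) + 5 / 12 * s ^ 3 * (1 / (p k * (1 - p k)) * W k \<omega> ^ 3)"

lemma rem_nonneg: "0 \<le> s \<Longrightarrow> 0 \<le> rem s k \<omega>"
  using pq_pos[of k] by (auto simp: rem_def W_def intro!: add_nonneg_nonneg mult_nonneg_nonneg sum_nonneg divide_nonneg_nonneg)

text \<open>The weights p and 1 - p are those of resampling coordinate k. Under the expectation the
  average will therefore turn back into the second derivative at s V + a itself.\<close>

lemma D_composition:
  assumes "length is = 1" "0 \<le> s"
  shows "\<bar>D p k (\<lambda>\<omega>. P is (s *\<^sub>R V \<omega> + a)) \<omega> - s * (\<Sum>j\<in>UNIV. D p k (F j) \<omega> *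
      (p k * P (j # is) (s *\<^sub>R V (fun_upd \<omega> k 1) + a) + (1 - p k) * P (j # is) (s *\<^sub>R V (fun_upd \<omega> k (-1)) + a)))\<bar>
    \<le> rem s k \<omega>"
proof -
  let ?x = "s *\<^sub>R V (fun_upd \<omega> k (-1)) + a"
  let ?u = "\<chi> j. D p k (F j) \<omega> / sd k"
  have sk: "0 < sd k" "sd k * sd k = p k * (1 - p k)" using pq_pos[of k] by auto
  have eq: "s *\<^sub>R V (fun_upd \<omega> k 1) + a = ?x + s *\<^sub>R ?u"
    using V_increment[of \<omega> k] by (simp add: algebra_simps flip: scaleR_add_right)
  have "\<bar>P is (?x + s *\<^sub>R ?u) - P is ?x - (\<Sum>j\<in>UNIV. (s *\<^sub>R ?u) $ j * (p k * P (j # is) (?x + s *\<^sub>R ?u) + (1 - p k) * P (j # is) ?x))\<bar>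
     \<le> \<bar>p k - (1 - p k)\<bar> / 2 * (l1 (s *\<^sub>R ?u))\<^sup>2 + 5 / 12 * l1 (s *\<^sub>R ?u) ^ 3"
    using assms(1) by (intro P_weighted_trapezoid) auto
  then have "sd k * \<bar>P is (?x + s *\<^sub>R ?u) - P is ?x - (\<Sum>j\<in>UNIV. (s *\<^sub>R ?u) $ j * (p k * P (j # is) (?x + s *\<^sub>R ?u) + (1 - p k) * P (j # is) ?x))\<bar>
     \<le> sd k * (\<bar>p k - (1 - p k)\<bar> / 2 * (l1 (s *\<^sub>R ?u))\<^sup>2 + 5 / 12 * l1 (s *\<^sub>R ?u) ^ 3)"
    using sk by (intro mult_left_mono) auto
  also have "\<dots> = rem s k \<omega>"
  proof -
    have l: "l1 (s *\<^sub>R ?u) = s * (W k \<omega> / sd k)"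
      using assms unfolding l1_scaleR l1_V_increment by simp
    have "x * (y / 2 * (s * (w / x))\<^sup>2 + 5 / 12 * (s * (w / x)) ^ 3)
        = s\<^sup>2 / 2 * (y / x * w\<^sup>2) + 5 / 12 * s ^ 3 * (1 / (x * x) * w ^ 3)" if "x \<noteq> 0" for x y w :: real
      using that by (simp add: field_simps power2_eq_square power3_eq_cube)
    from this[of "sd k" "\<bar>p k - (1 - p k)\<bar>" "W k \<omega>"] sk p_pos[of k] p_less[of k] show ?thesis
      unfolding l rem_def by simp
  qed
  also have "sd k * \<bar>P is (?x + s *\<^sub>R ?u) - P is ?x - (\<Sum>j\<in>UNIV. (s *\<^sub>R ?u) $ j * (p k * P (j # is) (?x + s *\<^sub>R ?u) + (1 - p k) * P (j # is) ?x))\<bar>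
    = \<bar>sd k * (P is (?x + s *\<^sub>R ?u) - P is ?x) - (\<Sum>j\<in>UNIV. sd k * ((s *\<^sub>R ?u) $ j * (p k * P (j # is) (?x + s *\<^sub>R ?u) + (1 - p k) * P (j # is) ?x)))\<bar>"
    using sk(1) by (simp only: abs_mult_pos' right_diff_distrib sum_distrib_left less_imp_le)
  also have "(\<Sum>j\<in>UNIV. sd k * ((s *\<^sub>R ?u) $ j * (p k * P (j # is) (?x + s *\<^sub>R ?u) + (1 - p k) * P (j # is) ?x)))
    = s * (\<Sum>j\<in>UNIV. D p k (F j) \<omega> * (p k * P (j # is) (?x + s *\<^sub>R ?u) + (1 - p k) * P (j # is) ?x))"
    unfolding sum_distrib_left using p_pos[of k] p_less[of k] by (intro sum.cong refl) simp
  finally show ?thesis unfolding eq D_def .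
qed

definition X :: "'d \<Rightarrow> 'd \<Rightarrow> (nat \<Rightarrow> real) \<Rightarrow> real" where
  "X i j \<omega> = (\<Sum>k. D p k (F j) \<omega> * D p k (U i) \<omega>)"

lemma X_measurable[measurable]: "X i j \<in> borel_measurable R"
  unfolding X_def by measurable

text \<open>Integration by parts, compared term by term in k with the second-order expression. Since
  gradients at k do not depend on coordinate k, resampling matches the main terms and only the
  remainders survive.\<close>

lemma component_estimate:
  assumes s: "0 \<le> s" "s \<le> 1"
  shows "ennreal \<bar>(\<integral>\<omega>. F i \<omega> * P [i] (s *\<^sub>R V \<omega> + a) \<partial>R)
      - s * (\<Sum>j\<in>UNIV. \<integral>\<omega>. X i j \<omega> * P [j, i] (s *\<^sub>R V \<omega> + a) \<partial>R)\<bar>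
    \<le> (\<Sum>k. \<integral>\<^sup>+\<omega>. ennreal (rem s k \<omega> * \<bar>D p k (U i) \<omega>\<bar>) \<partial>R)"
proof -
  let ?G = "\<lambda>\<omega>. P [i] (s *\<^sub>R V \<omega> + a)" and ?H = "\<lambda>j \<omega>. P [j, i] (s *\<^sub>R V \<omega> + a)"
  have Pm[measurable]: "P [j, i] \<in> borel_measurable borel" for j by (intro borel_measurable_P) simp
  have Hm: "?H j \<in> borel_measurable R" for j by measurable
  have H1: "\<bar>?H j \<omega>\<bar> \<le> 1" for j \<omega> using bounded_P[of "[j, i]"] by simp
  have G: "square_integrable R ?G" "energy ?G < \<infinity>" using energy_composition[of "[i]" s a] s by simp_all
  define T where "T k = (\<integral>\<omega>. D p k ?G \<omega> * D p k (U i) \<omega> \<partial>R)" for k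
  define Q where "Q j k = (\<integral>\<omega>. D p k (F j) \<omega> * D p k (U i) \<omega> * ?H j \<omega> \<partial>R)" for j k
  have T: "T sums (\<integral>\<omega>. F i \<omega> * ?G \<omega> \<partial>R)" unfolding T_def[abs_def] by (rule F_by_parts[OF G])
  have Q: "Q j sums (\<integral>\<omega>. X i j \<omega> * ?H j \<omega> \<partial>R)" for j
    unfolding Q_def[abs_def] X_def[abs_def] by (rule sums_integral_DD(1)[OF Hm H1])
  have sums: "(\<lambda>k. T k - s * (\<Sum>j\<in>UNIV. Q j k)) sums
      ((\<integral>\<omega>. F i \<omega> * ?G \<omega> \<partial>R) - s * (\<Sum>j\<in>UNIV. \<integral>\<omega>. X i j \<omega> * ?H j \<omega> \<partial>R))"
    by (intro sums_diff T sums_mult sums_sum Q)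
  have term_le: "ennreal \<bar>T k - s * (\<Sum>j\<in>UNIV. Q j k)\<bar> \<le> (\<integral>\<^sup>+\<omega>. ennreal (rem s k \<omega> * \<bar>D p k (U i) \<omega>\<bar>) \<partial>R)" for k
  proof -
    let ?H' = "\<lambda>j \<omega>. p k * ?H j (fun_upd \<omega> k 1) + (1 - p k) * ?H j (fun_upd \<omega> k (-1))"
    have iH: "integrable R (\<lambda>\<omega>. D p k (F j) \<omega> * D p k (U i) \<omega> * ?H j \<omega>)" for j
      by (rule integrable_DD_bounded[OF Hm H1])
    have iu: "integrable R (\<lambda>\<omega>. D p k (F j) \<omega> * D p k (U i) \<omega> * ?H j (fun_upd \<omega> k c))" if "c \<in> {-1, 1}" for j c
      using integrable_upd[OF iH[of j] that, of k] by simp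
    have i': "integrable R (\<lambda>\<omega>. D p k (F j) \<omega> * D p k (U i) \<omega> * ?H' j \<omega>)" for j
    proof -
      have "integrable R (\<lambda>\<omega>. p k * (D p k (F j) \<omega> * D p k (U i) \<omega> * ?H j (fun_upd \<omega> k 1))
          + (1 - p k) * (D p k (F j) \<omega> * D p k (U i) \<omega> * ?H j (fun_upd \<omega> k (-1))))"
        using iu by (intro Bochner_Integration.integrable_add integrable_mult_right) auto
      then show ?thesis by (simp only: distrib_left mult.left_commute)
    qed
    \<comment> \<open>\<open>D_upd\<close> frees both gradients from coordinate k, so resampling it
      averages only the factor \<open>?H j\<close>.\<close>
    have Q': "Q j k = (\<integral>\<omega>. D p k (F j) \<omega> * D p k (U i) \<omega> * ?H' j \<omega> \<partial>R)" for j
    proof -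
      have "Q j k = p k * (\<integral>\<omega>. D p k (F j) \<omega> * D p k (U i) \<omega> * ?H j (fun_upd \<omega> k 1) \<partial>R)
         + (1 - p k) * (\<integral>\<omega>. D p k (F j) \<omega> * D p k (U i) \<omega> * ?H j (fun_upd \<omega> k (-1)) \<partial>R)"
        unfolding Q_def using resample_integral[OF iH[of j], of 1 k] by simp
      also have "\<dots> = (\<integral>\<omega>. p k * (D p k (F j) \<omega> * D p k (U i) \<omega> * ?H j (fun_upd \<omega> k 1))
          + (1 - p k) * (D p k (F j) \<omega> * D p k (U i) \<omega> * ?H j (fun_upd \<omega> k (-1))) \<partial>R)"
        using iu[of 1 j] iu[of "-1" j] by (simp del: foldr.simps)
      also have "\<dots> = (\<integral>\<omega>. D p k (F j) \<omega> * D p k (U i) \<omega> * ?H' j \<omega> \<partial>R)"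
        by (simp only: distrib_left mult.left_commute)
      finally show ?thesis .
    qed
    have iT: "integrable R (\<lambda>\<omega>. D p k ?G \<omega> * D p k (U i) \<omega>)"
      by (intro integrable_mult_square_integrable square_integrable_D G square_integrable_U)
    have "T k - s * (\<Sum>j\<in>UNIV. Q j k)
       = (\<integral>\<omega>. D p k ?G \<omega> * D p k (U i) \<omega> - s * (\<Sum>j\<in>UNIV. D p k (F j) \<omega> * D p k (U i) \<omega> * ?H' j \<omega>) \<partial>R)"
      unfolding T_def Q' using iT i'
      by (subst Bochner_Integration.integral_diff) (auto simp del: foldr.simps)
    also have "\<dots> = (\<integral>\<omega>. (D p k ?G \<omega> - s * (\<Sum>j\<in>UNIV. D p k (F j) \<omega> * ?H' j \<omega>)) * D p k (U i) \<omega> \<partial>R)"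
    proof (intro Bochner_Integration.integral_cong refl)
      fix \<omega>
      have "(\<Sum>j\<in>UNIV. D p k (F j) \<omega> * D p k (U i) \<omega> * ?H' j \<omega>) = (\<Sum>j\<in>UNIV. D p k (F j) \<omega> * ?H' j \<omega>) * D p k (U i) \<omega>"
        unfolding sum_distrib_right by (intro sum.cong refl) (simp only: mult_ac)
      then show "D p k ?G \<omega> * D p k (U i) \<omega> - s * (\<Sum>j\<in>UNIV. D p k (F j) \<omega> * D p k (U i) \<omega> * ?H' j \<omega>)
          = (D p k ?G \<omega> - s * (\<Sum>j\<in>UNIV. D p k (F j) \<omega> * ?H' j \<omega>)) * D p k (U i) \<omega>"
        by (simp only: left_diff_distrib mult.assoc)
    qed
    finally have "ennreal \<bar>T k - s * (\<Sum>j\<in>UNIV. Q j k)\<bar>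
      = ennreal (norm (\<integral>\<omega>. (D p k ?G \<omega> - s * (\<Sum>j\<in>UNIV. D p k (F j) \<omega> * ?H' j \<omega>)) * D p k (U i) \<omega> \<partial>R))"
      by simp
    also have "\<dots> \<le> (\<integral>\<^sup>+\<omega>. norm ((D p k ?G \<omega> - s * (\<Sum>j\<in>UNIV. D p k (F j) \<omega> * ?H' j \<omega>)) * D p k (U i) \<omega>) \<partial>R)"
      by (rule norm_integral_le_nn_integral)
    also have "\<dots> \<le> (\<integral>\<^sup>+\<omega>. ennreal (rem s k \<omega> * \<bar>D p k (U i) \<omega>\<bar>) \<partial>R)"
    proof (intro nn_integral_mono ennreal_leI)
      fix \<omega>
      show "norm ((D p k ?G \<omega> - s * (\<Sum>j\<in>UNIV. D p k (F j) \<omega> * ?H' j \<omega>)) * D p k (U i) \<omega>) \<le> rem s k \<omega> * \<bar>D p k (U i) \<omega>\<bar>"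
        unfolding real_norm_def abs_mult using D_composition[of "[i]" s k a \<omega>] s
        by (intro mult_right_mono) auto
    qed
    finally show ?thesis .
  qed
  have "ennreal \<bar>(\<integral>\<omega>. F i \<omega> * ?G \<omega> \<partial>R) - s * (\<Sum>j\<in>UNIV. \<integral>\<omega>. X i j \<omega> * ?H j \<omega> \<partial>R)\<bar>
      = ennreal \<bar>\<Sum>k. T k - s * (\<Sum>j\<in>UNIV. Q j k)\<bar>"
    using sums by (simp only: sums_iff)
  also have "\<dots> \<le> (\<Sum>k. ennreal \<bar>T k - s * (\<Sum>j\<in>UNIV. Q j k)\<bar>)"
    using sums by (intro ennreal_abs_suminf_le) (simp only: sums_iff)
  also have "\<dots> \<le> (\<Sum>k. \<integral>\<^sup>+\<omega>. ennreal (rem s k \<omega> * \<bar>D p k (U i) \<omega>\<bar>) \<partial>R)"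
    by (intro suminf_le term_le summableI)
  finally show ?thesis .
qed

lemma ennreal_abs_sum_le: "ennreal \<bar>\<Sum>i\<in>I. a i\<bar> \<le> (\<Sum>i\<in>I. ennreal \<bar>a i\<bar>)"
  by (subst sum_ennreal) (auto intro: ennreal_leI sum_abs)

text \<open>Second derivatives are bounded by 1, so replacing the inner product by a constant costs
  at most their L^1 distance.\<close>

lemma covariance_estimate:
  shows "ennreal \<bar>(\<integral>\<omega>. X i j \<omega> * P [j, i] (s *\<^sub>R V \<omega> + a) \<partial>R) - c * (\<integral>\<omega>. P [j, i] (s *\<^sub>R V \<omega> + a) \<partial>R)\<bar>
    \<le> (\<integral>\<^sup>+\<omega>. ennreal \<bar>c - X i j \<omega>\<bar> \<partial>R)"
proof -
  let ?H = "\<lambda>\<omega>. P [j, i] (s *\<^sub>R V \<omega> + a)"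
  have [measurable]: "P [j, i] \<in> borel_measurable borel" by (intro borel_measurable_P) simp
  have Hm: "?H \<in> borel_measurable R" by measurable
  have H1: "\<bar>?H \<omega>\<bar> \<le> 1" for \<omega> using bounded_P[of "[j, i]"] by simp
  have i: "integrable R (\<lambda>\<omega>. X i j \<omega> * ?H \<omega>)" "integrable R ?H"
    using sums_integral_DD(2)[OF Hm H1] square_integrable_imp_integrable[OF square_integrable_bounded[OF Hm H1]]
    by (simp_all only: X_def)
  have "(\<integral>\<omega>. X i j \<omega> * ?H \<omega> \<partial>R) - c * (\<integral>\<omega>. ?H \<omega> \<partial>R) = (\<integral>\<omega>. (X i j \<omega> - c) * ?H \<omega> \<partial>R)"
    using i by (simp add: left_diff_distrib del: foldr.simps)
  then have "ennreal \<bar>(\<integral>\<omega>. X i j \<omega> * ?H \<omega> \<partial>R) - c * (\<integral>\<omega>. ?H \<omega> \<partial>R)\<bar> = ennreal (norm (\<integral>\<omega>. (X i j \<omega> - c) * ?H \<omega> \<partial>R))"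
    by simp
  also have "\<dots> \<le> (\<integral>\<^sup>+\<omega>. norm ((X i j \<omega> - c) * ?H \<omega>) \<partial>R)"
    by (rule norm_integral_le_nn_integral)
  also have "\<dots> \<le> (\<integral>\<^sup>+\<omega>. ennreal \<bar>c - X i j \<omega>\<bar> \<partial>R)"
    using H1 by (intro nn_integral_mono ennreal_leI) (simp add: abs_mult abs_minus_commute[of c] mult_left_le del: foldr.simps)
  finally show ?thesis .
qed

section \<open>The three bounds\<close>

definition A1 :: "real ^ 'd ^ 'd \<Rightarrow> ennreal" where
  "A1 S = ennreal (1/2) * (\<Sum>i\<in>UNIV. \<Sum>j\<in>UNIV. \<integral>\<^sup>+ \<omega>. ennreal \<bar>S $ i $ j - X i j \<omega>\<bar> \<partial>R)"

definition A2 :: ennreal where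
  "A2 = ennreal (1/4) * (\<integral>\<^sup>+ \<omega>. (\<Sum>k. ennreal
     (\<bar>p k - (1 - p k)\<bar> / sd k * (W k \<omega>)\<^sup>2 * (\<Sum>i\<in>UNIV. \<bar>D p k (U i) \<omega>\<bar>))) \<partial>R)"

definition A3 :: ennreal where
  "A3 = ennreal (5/24) * (\<integral>\<^sup>+ \<omega>. (\<Sum>k. ennreal
     (1 / (p k * (1 - p k)) * W k \<omega> ^ 3 * (\<Sum>i\<in>UNIV. \<bar>D p k (U i) \<omega>\<bar>))) \<partial>R)"

text \<open>For 0 <= s <= 1 both s^2 and s^3 are at most s, so a factor s comes out; writing it as 2
  s halves 1/2 and 5/12 to 1/4 and 5/24.\<close>

lemma sum_rem_le:
  assumes s: "0 \<le> s" "s \<le> 1"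
  shows "(\<Sum>i\<in>UNIV. \<Sum>k. \<integral>\<^sup>+\<omega>. ennreal (rem s k \<omega> * \<bar>D p k (U i) \<omega>\<bar>) \<partial>R) \<le> ennreal (2 * s) * (A2 + A3)"
proof -
  let ?u = "\<lambda>k \<omega>. \<Sum>i\<in>UNIV. \<bar>D p k (U i) \<omega>\<bar>"
  let ?b = "\<lambda>k \<omega>. \<bar>p k - (1 - p k)\<bar> / sd k * (W k \<omega>)\<^sup>2 * ?u k \<omega>"
  let ?c = "\<lambda>k \<omega>. 1 / (p k * (1 - p k)) * W k \<omega> ^ 3 * ?u k \<omega>"
  have W0: "0 \<le> W k \<omega>" for k \<omega> by (simp add: W_def sum_nonneg)
  have b0: "0 \<le> ?b k \<omega>" and c0: "0 \<le> ?c k \<omega>" for k \<omega>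
    using pq_pos[of k] W0[of k \<omega>] by (auto intro!: mult_nonneg_nonneg sum_nonneg divide_nonneg_nonneg)
  have le: "ennreal (s\<^sup>2 / 2 * b + 5 / 12 * s ^ 3 * c) \<le> ennreal (2 * s) * (ennreal (1/4) * ennreal b + ennreal (5/24) * ennreal c)"
    if "0 \<le> b" "0 \<le> c" for b c
  proof -
    have "s\<^sup>2 \<le> s" using s by (simp add: power2_eq_square mult_left_le)
    moreover have "s ^ 3 \<le> s" using s power_decreasing[of 1 3 s] by simp
    ultimately have "s\<^sup>2 * b \<le> s * b" "s ^ 3 * c \<le> s * c" using that by (simp_all add: mult_right_mono)
    then have "s\<^sup>2 / 2 * b + 5 / 12 * s ^ 3 * c \<le> (2 * s) * (1/4 * b + 5/24 * c)"
    proof -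
      have "s\<^sup>2 / 2 * b + 5 / 12 * s ^ 3 * c = (s\<^sup>2 * b) / 2 + 5 / 12 * (s ^ 3 * c)"
        "(2 * s) * (1/4 * b + 5/24 * c) = (s * b) / 2 + 5 / 12 * (s * c)"
        by (simp_all add: algebra_simps)
      with \<open>s\<^sup>2 * b \<le> s * b\<close> \<open>s ^ 3 * c \<le> s * c\<close> show ?thesis by linarith
    qed
    then have "ennreal (s\<^sup>2 / 2 * b + 5 / 12 * s ^ 3 * c) \<le> ennreal ((2 * s) * (1/4 * b + 5/24 * c))"
      by (rule ennreal_leI)
    also have "\<dots> = ennreal (2 * s) * (ennreal (1/4) * ennreal b + ennreal (5/24) * ennreal c)"
      using s that by (simp only: ennreal_mult ennreal_plus mult_nonneg_nonneg add_nonneg_nonneg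
        zero_le_numeral divide_nonneg_nonneg zero_le_one)
    finally show ?thesis .
  qed
  have [measurable]: "rem s k \<in> borel_measurable R" for k unfolding rem_def by measurable
  have "(\<Sum>i\<in>UNIV. \<Sum>k. \<integral>\<^sup>+\<omega>. ennreal (rem s k \<omega> * \<bar>D p k (U i) \<omega>\<bar>) \<partial>R)
      = (\<Sum>k. \<integral>\<^sup>+\<omega>. (\<Sum>i\<in>UNIV. ennreal (rem s k \<omega> * \<bar>D p k (U i) \<omega>\<bar>)) \<partial>R)"
    by (simp add: suminf_sum[OF summableI] nn_integral_sum del: sum_ennreal)
  also have "\<dots> \<le> (\<Sum>k. \<integral>\<^sup>+\<omega>. ennreal (2 * s) * (ennreal (1/4) * ennreal (?b k \<omega>) + ennreal (5/24) * ennreal (?c k \<omega>)) \<partial>R)"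
  proof (intro suminf_le summableI nn_integral_mono)
    fix k \<omega>
    have "(\<Sum>i\<in>UNIV. ennreal (rem s k \<omega> * \<bar>D p k (U i) \<omega>\<bar>)) = ennreal (rem s k \<omega> * ?u k \<omega>)"
      using rem_nonneg[OF s(1)] by (subst sum_ennreal) (auto simp: sum_distrib_left)
    also have "\<dots> = ennreal (s\<^sup>2 / 2 * ?b k \<omega> + 5 / 12 * s ^ 3 * ?c k \<omega>)"
      by (simp only: rem_def distrib_right mult.assoc)
    also have "\<dots> \<le> ennreal (2 * s) * (ennreal (1/4) * ennreal (?b k \<omega>) + ennreal (5/24) * ennreal (?c k \<omega>))"
      by (rule le[OF b0 c0])
    finally show "(\<Sum>i\<in>UNIV. ennreal (rem s k \<omega> * \<bar>D p k (U i) \<omega>\<bar>))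
      \<le> ennreal (2 * s) * (ennreal (1/4) * ennreal (?b k \<omega>) + ennreal (5/24) * ennreal (?c k \<omega>))"
.
  qed
  also have "\<dots> = ennreal (2 * s) * (A2 + A3)"
    unfolding A2_def A3_def
    by (simp add: nn_integral_cmult nn_integral_add nn_integral_suminf ennreal_suminf_cmult suminf_add[OF summableI summableI, symmetric])
  finally show ?thesis .
qed

text \<open>The shift a will be cos t times N at a fixed outcome, and s will be sin t: the
  Rademacher part of the derivative is compared with the covariance term conditionally on N.\<close>

lemma malliavin_estimate:
  assumes s: "0 \<le> s" "s \<le> 1"
  shows "ennreal \<bar>(\<integral>\<omega>. (\<Sum>i\<in>UNIV. F i \<omega> * P [i] (s *\<^sub>R V \<omega> + a)) \<partial>R)
      - s * (\<Sum>i\<in>UNIV. \<Sum>j\<in>UNIV. S $ i $ j * (\<integral>\<omega>. P [j, i] (s *\<^sub>R V \<omega> + a) \<partial>R))\<bar>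
    \<le> ennreal (2 * s) * (A1 S + A2 + A3)"
proof -
  let ?f = "\<lambda>i. \<integral>\<omega>. F i \<omega> * P [i] (s *\<^sub>R V \<omega> + a) \<partial>R"
  let ?x = "\<lambda>i j. \<integral>\<omega>. X i j \<omega> * P [j, i] (s *\<^sub>R V \<omega> + a) \<partial>R"
  let ?c = "\<lambda>i j. S $ i $ j * (\<integral>\<omega>. P [j, i] (s *\<^sub>R V \<omega> + a) \<partial>R)"
  have "(\<integral>\<omega>. (\<Sum>i\<in>UNIV. F i \<omega> * P [i] (s *\<^sub>R V \<omega> + a)) \<partial>R) = (\<Sum>i\<in>UNIV. ?f i)"
    using energy_composition(1)[of "[_]" s a] s
    by (intro Bochner_Integration.integral_sum integrable_mult_square_integrable square_integrable_F) auto
  \<comment> \<open>The first sum is the error of integration by parts, bounded by \<open>A2\<close>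
    and \<open>A3\<close>; the second replaces inner products by covariances, at the price of
    \<open>A1\<close>.\<close>
  then have "\<bar>(\<integral>\<omega>. (\<Sum>i\<in>UNIV. F i \<omega> * P [i] (s *\<^sub>R V \<omega> + a)) \<partial>R) - s * (\<Sum>i\<in>UNIV. \<Sum>j\<in>UNIV. ?c i j)\<bar>
      = \<bar>(\<Sum>i\<in>UNIV. ?f i - s * (\<Sum>j\<in>UNIV. ?x i j)) + s * (\<Sum>i\<in>UNIV. \<Sum>j\<in>UNIV. ?x i j - ?c i j)\<bar>"
    by (simp add: sum_subtractf sum_distrib_left right_diff_distrib del: foldr.simps)
  also have "\<dots> \<le> \<bar>\<Sum>i\<in>UNIV. ?f i - s * (\<Sum>j\<in>UNIV. ?x i j)\<bar> + s * \<bar>\<Sum>i\<in>UNIV. \<Sum>j\<in>UNIV. ?x i j - ?c i j\<bar>"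
    using s by (intro order_trans[OF abs_triangle_ineq] add_left_mono) (simp add: abs_mult del: foldr.simps)
  finally have "ennreal \<bar>(\<integral>\<omega>. (\<Sum>i\<in>UNIV. F i \<omega> * P [i] (s *\<^sub>R V \<omega> + a)) \<partial>R) - s * (\<Sum>i\<in>UNIV. \<Sum>j\<in>UNIV. ?c i j)\<bar>
      \<le> ennreal \<bar>\<Sum>i\<in>UNIV. ?f i - s * (\<Sum>j\<in>UNIV. ?x i j)\<bar> + ennreal s * ennreal \<bar>\<Sum>i\<in>UNIV. \<Sum>j\<in>UNIV. ?x i j - ?c i j\<bar>"
    using s by (simp add: ennreal_leI del: foldr.simps flip: ennreal_plus ennreal_mult)
  also have "\<dots> \<le> ennreal (2 * s) * (A2 + A3) + ennreal s * (\<Sum>i\<in>UNIV. \<Sum>j\<in>UNIV. \<integral>\<^sup>+ \<omega>. ennreal \<bar>S $ i $ j - X i j \<omega>\<bar> \<partial>R)"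
  proof (intro add_mono mult_left_mono)
    have "ennreal \<bar>\<Sum>i\<in>UNIV. ?f i - s * (\<Sum>j\<in>UNIV. ?x i j)\<bar> \<le> (\<Sum>i\<in>UNIV. ennreal \<bar>?f i - s * (\<Sum>j\<in>UNIV. ?x i j)\<bar>)"
      by (rule ennreal_abs_sum_le)
    also have "\<dots> \<le> (\<Sum>i\<in>UNIV. \<Sum>k. \<integral>\<^sup>+\<omega>. ennreal (rem s k \<omega> * \<bar>D p k (U i) \<omega>\<bar>) \<partial>R)"
      by (intro sum_mono component_estimate s)
    also have "\<dots> \<le> ennreal (2 * s) * (A2 + A3)" by (rule sum_rem_le[OF s])
    finally show "ennreal \<bar>\<Sum>i\<in>UNIV. ?f i - s * (\<Sum>j\<in>UNIV. ?x i j)\<bar> \<le> ennreal (2 * s) * (A2 + A3)" .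
    have "ennreal \<bar>\<Sum>i\<in>UNIV. \<Sum>j\<in>UNIV. ?x i j - ?c i j\<bar> \<le> (\<Sum>i\<in>UNIV. ennreal \<bar>\<Sum>j\<in>UNIV. ?x i j - ?c i j\<bar>)"
      by (rule ennreal_abs_sum_le)
    also have "\<dots> \<le> (\<Sum>i\<in>UNIV. \<Sum>j\<in>UNIV. ennreal \<bar>?x i j - ?c i j\<bar>)"
      by (intro sum_mono ennreal_abs_sum_le)
    also have "\<dots> \<le> (\<Sum>i\<in>UNIV. \<Sum>j\<in>UNIV. \<integral>\<^sup>+ \<omega>. ennreal \<bar>S $ i $ j - X i j \<omega>\<bar> \<partial>R)"
      by (intro sum_mono covariance_estimate)
    finally show "ennreal \<bar>\<Sum>i\<in>UNIV. \<Sum>j\<in>UNIV. ?x i j - ?c i j\<bar> \<le> (\<Sum>i\<in>UNIV. \<Sum>j\<in>UNIV. \<integral>\<^sup>+ \<omega>. ennreal \<bar>S $ i $ j - X i j \<omega>\<bar> \<partial>R)" .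
  qed simp
  also have "ennreal s * (\<Sum>i\<in>UNIV. \<Sum>j\<in>UNIV. \<integral>\<^sup>+ \<omega>. ennreal \<bar>S $ i $ j - X i j \<omega>\<bar> \<partial>R) = ennreal (2 * s) * A1 S"
    unfolding A1_def using s by (subst mult.assoc[symmetric], subst ennreal_mult[symmetric]) simp_all
  finally show ?thesis by (simp add: distrib_left ac_simps)
qed

lemma l1_V: "l1 (V \<omega>) = (\<Sum>i\<in>UNIV. \<bar>F i \<omega>\<bar>)"
  by (simp add: l1_def V_def)

lemma square_integrable_l1_V: "square_integrable R (\<lambda>\<omega>. l1 (V \<omega>))"
  unfolding l1_V by (intro square_integrable_sum square_integrable_abs square_integrable_F)

end

section \<open>Differentiation along the path\<close>

lemma DERIV_bounded_lipschitz:
  fixes f :: "real \<Rightarrow> real"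
  assumes "\<And>x. (f has_real_derivative f' x) (at x)" "\<And>x. \<bar>f' x\<bar> \<le> 1"
  shows "\<bar>f (x + h) - f x\<bar> \<le> \<bar>h\<bar>"
proof -
  have "norm (f (x + h) - f x) \<le> 1 * norm (x + h - x)"
    by (rule field_differentiable_bound[of UNIV f f']) (use assms in auto)
  then show ?thesis by simp
qed

lemma DERIV_lipschitz_first_order:
  fixes f :: "real \<Rightarrow> real"
  assumes f: "\<And>x. (f has_real_derivative f' x) (at x)" and f': "\<And>x y. \<bar>f' (x + y) - f' x\<bar> \<le> \<bar>y\<bar>"
  shows "\<bar>f (x + h) - f x - h * f' x\<bar> \<le> h\<^sup>2"
proof -
  have "norm ((f (x + h) - f' x * (x + h)) - (f x - f' x * x)) \<le> \<bar>h\<bar> * norm (x + h - x)"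
  proof (rule field_differentiable_bound[of "closed_segment x (x + h)" _ "\<lambda>y. f' y - f' x"])
    fix y assume "y \<in> closed_segment x (x + h)"
    then have "\<bar>y - x\<bar> \<le> \<bar>h\<bar>" by (auto simp: closed_segment_eq_real_ivl split: if_splits)
    then show "norm (f' y - f' x) \<le> \<bar>h\<bar>" using f'[of x "y - x"] by simp
    show "((\<lambda>y. f y - f' x * y) has_field_derivative f' y - f' x) (at y within closed_segment x (x + h))"
      by (auto intro!: derivative_eq_intros has_field_derivative_at_within[OF f])
  qed auto
  then show ?thesis by (simp add: algebra_simps power2_eq_square abs_mult_self_eq)
qed

text \<open>Uniform errors for the two coefficients of the path: the first pair bounds the
  displacement, the second pair its deviation from linear motion.\<close>

lemma sin_cos_increments:
  "\<bar>sin (x + h) - sin x\<bar> \<le> \<bar>h\<bar>" "\<bar>cos (x + h) - cos x\<bar> \<le> \<bar>h\<bar>"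
  "\<bar>sin (x + h) - sin x - h * cos x\<bar> \<le> h\<^sup>2" "\<bar>cos (x + h) - cos x - h * (- sin x)\<bar> \<le> h\<^sup>2" for x h :: real
proof -
  show s: "\<bar>sin (x + h) - sin x\<bar> \<le> \<bar>h\<bar>" for x h :: real
    by (rule DERIV_bounded_lipschitz[OF DERIV_sin]) simp
  show c: "\<bar>cos (x + h) - cos x\<bar> \<le> \<bar>h\<bar>" for x h :: real
    by (rule DERIV_bounded_lipschitz[OF DERIV_cos]) simp
  show "\<bar>sin (x + h) - sin x - h * cos x\<bar> \<le> h\<^sup>2"
    by (rule DERIV_lipschitz_first_order[OF DERIV_sin c])
  show "\<bar>cos (x + h) - cos x - h * (- sin x)\<bar> \<le> h\<^sup>2"
    by (rule DERIV_lipschitz_first_order[OF DERIV_cos]) (use s in \<open>simp add: abs_minus_commute\<close>)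
qed

context rademacher_vector
begin

theorem smart_path:
  assumes gv: "gaussian_vector M N S"
  shows "ennreal \<bar>(\<integral>\<omega>. g (V \<omega>) \<partial>R) - (\<integral>y. g (N y) \<partial>M)\<bar> \<le> A1 S + A2 + A3"
proof (cases "A1 S + A2 + A3 = \<infinity>")
  case False
  then obtain \<alpha> where \<alpha>: "0 \<le> \<alpha>" "A1 S + A2 + A3 = ennreal \<alpha>"
    by (cases "A1 S + A2 + A3") auto
  interpret G: gaussian_vector M N S by fact
  interpret RM: pair_prob_space R M ..
  let ?RM = "R \<Otimes>\<^sub>M M"
  \<comment> \<open>At t = 0 this is N and at t = pi/2 it is the Rademacher vector; the product
    space makes the two independent.\<close>
  define Z where "Z t w = sin t *\<^sub>R V (fst w) + cos t *\<^sub>R N (snd w)" for t w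
  have Z_meas[measurable]: "Z t \<in> borel_measurable ?RM" for t unfolding Z_def by measurable
  have Pm: "P is \<in> borel_measurable borel" if "length is < 4" for "is" by (intro borel_measurable_P that)
  have PZm: "(\<lambda>w. P is (Z t w)) \<in> borel_measurable ?RM" if "length is < 4" for "is" t
    by (rule measurable_compose[OF Z_meas Pm[OF that]])
  define L where "L w = l1 (V (fst w)) + l1 (N (snd w))" for w
  have L_meas[measurable]: "L \<in> borel_measurable ?RM" unfolding L_def by measurable
  have L0: "0 \<le> L w" for w by (simp add: L_def)
  have iVN: "integrable R (\<lambda>\<omega>. l1 (V \<omega>))" "integrable M (\<lambda>y. l1 (N y))"
    using square_integrable_imp_integrable[OF square_integrable_l1_V] G.integrable_l1_power[of 1] by simp_all
  have iL: "integrable ?RM L"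
    unfolding L_def by (intro Bochner_Integration.integrable_add RM.integrable_pair_fst RM.integrable_pair_snd iVN)
  have iL2: "integrable ?RM (\<lambda>w. (L w)\<^sup>2)"
  proof (rule Bochner_Integration.integrable_bound)
    show "integrable ?RM (\<lambda>w. 2 * (l1 (V (fst w)))\<^sup>2 + 2 * (l1 (N (snd w)))\<^sup>2)"
      using RM.integrable_pair_fst[of "\<lambda>\<omega>. (l1 (V \<omega>))\<^sup>2"] RM.integrable_pair_snd[OF G.integrable_l1_power[of 2]] square_integrable_l1_V
      by (simp add: square_integrable_def)
    show "AE w in ?RM. norm ((L w)\<^sup>2) \<le> norm (2 * (l1 (V (fst w)))\<^sup>2 + 2 * (l1 (N (snd w)))\<^sup>2)"
      unfolding L_def by (intro AE_I2) (use square_add_le in auto)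
  qed measurable
  define d where "d t w = (\<Sum>i\<in>UNIV. (cos t * V (fst w) $ i - sin t * N (snd w) $ i) * P [i] (Z t w))" for t w
  have lip: "\<bar>g (y + u) - g y\<bar> \<le> l1 u" for y u using P_lipschitz[of "[]" y u] by simp
  have g_meas[measurable]: "g \<in> borel_measurable borel" using Pm[of "[]"] by simp
  have igZ: "integrable ?RM (\<lambda>w. g (Z t w))" for t
  proof (rule Bochner_Integration.integrable_bound)
    show "integrable ?RM (\<lambda>w. \<bar>g 0\<bar> + L w)" using iL by simp
    show "AE w in ?RM. norm (g (Z t w)) \<le> norm (\<bar>g 0\<bar> + L w)"
    proof (intro AE_I2)
      fix w
      have "l1 (Z t w) \<le> l1 (sin t *\<^sub>R V (fst w)) + l1 (cos t *\<^sub>R N (snd w))" unfolding Z_def by (rule l1_triangle)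
      also have "\<dots> \<le> L w" unfolding L_def l1_scaleR by (intro add_mono mult_left_le_one_le) auto
      finally show "norm (g (Z t w)) \<le> norm (\<bar>g 0\<bar> + L w)" using lip[of 0 "Z t w"] L0[of w] by simp
    qed
  qed measurable
  have iVP: "integrable ?RM (\<lambda>w. V (fst w) $ i * P [i] (Z t w))" for i t
  proof (rule Bochner_Integration.integrable_bound)
    show "integrable ?RM (\<lambda>w. F i (fst w))"
      by (intro RM.integrable_pair_fst square_integrable_imp_integrable square_integrable_F)
    show "(\<lambda>w. V (fst w) $ i * P [i] (Z t w)) \<in> borel_measurable ?RM"
      using PZm[of "[i]" t] by (simp add: V_def)
    show "AE w in ?RM. norm (V (fst w) $ i * P [i] (Z t w)) \<le> norm (F i (fst w))"
      using bounded_P[of "[i]"] by (intro AE_I2) (simp add: V_def abs_mult mult_left_le)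
  qed
  have iNP: "integrable ?RM (\<lambda>w. N (snd w) $ i * P [i] (Z t w))" for i t
  proof (rule Bochner_Integration.integrable_bound)
    show "integrable ?RM (\<lambda>w. N (snd w) $ i)" by (intro RM.integrable_pair_snd G.integrable_N)
    show "(\<lambda>w. N (snd w) $ i * P [i] (Z t w)) \<in> borel_measurable ?RM"
      using PZm[of "[i]" t] by simp
    show "AE w in ?RM. norm (N (snd w) $ i * P [i] (Z t w)) \<le> norm (N (snd w) $ i)"
      using bounded_P[of "[i]"] by (intro AE_I2) (simp add: abs_mult mult_left_le)
  qed
  have iP2: "integrable ?RM (\<lambda>w. P [j, i] (Z t w))" for i j t
    using PZm[of "[j, i]" t] bounded_P[of "[j, i]"] by (intro RM.integrable_const_bound[where B=1]) auto
  have id: "integrable ?RM (d t)" for t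
    unfolding d_def left_diff_distrib mult.assoc
    by (intro Bochner_Integration.integrable_sum Bochner_Integration.integrable_diff integrable_mult_right iVP iNP)
  define h where "h t = (\<integral>w. g (Z t w) \<partial>?RM)" for t
  \<comment> \<open>Differentiation under the expectation by a quadratic error bound, whose
    coefficient is integrable because both vectors have second moments.\<close>
  have deriv: "(h has_real_derivative (\<integral>w. d t w \<partial>?RM)) (at t)" for t
  proof (rule DERIV_from_quadratic_bound[where C="\<integral>w. (L w)\<^sup>2 + L w \<partial>?RM"])
    fix r :: real
    have pt: "\<bar>g (Z (t + r) w) - g (Z t w) - r * d t w\<bar> \<le> r\<^sup>2 * ((L w)\<^sup>2 + L w)" for w
    proof -
      let ?u = "Z (t + r) w - Z t w"
      \<comment> \<open>The deviation of the displacement from its linear part r (cos t V - sin t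
        N).\<close>
      let ?e = "\<chi> i. (sin (t + r) - sin t - r * cos t) * V (fst w) $ i + (cos (t + r) - cos t - r * (- sin t)) * N (snd w) $ i"
      have "l1 ?u = l1 ((sin (t + r) - sin t) *\<^sub>R V (fst w) + (cos (t + r) - cos t) *\<^sub>R N (snd w))"
        unfolding Z_def by (simp add: algebra_simps)
      also have "\<dots> \<le> l1 ((sin (t + r) - sin t) *\<^sub>R V (fst w)) + l1 ((cos (t + r) - cos t) *\<^sub>R N (snd w))"
        by (rule l1_triangle)
      also have "\<dots> \<le> \<bar>r\<bar> * l1 (V (fst w)) + \<bar>r\<bar> * l1 (N (snd w))"
        unfolding l1_scaleR by (intro add_mono mult_right_mono sin_cos_increments) auto
      also have "\<dots> = \<bar>r\<bar> * L w" by (simp add: L_def distrib_left)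
      finally have lu: "(l1 ?u)\<^sup>2 \<le> r\<^sup>2 * (L w)\<^sup>2"
        using power_mono[of "l1 ?u" "\<bar>r\<bar> * L w" 2] by (simp add: power_mult_distrib)
      have 1: "\<bar>g (Z (t + r) w) - g (Z t w) - (\<Sum>i\<in>UNIV. ?u $ i * P [i] (Z t w))\<bar> \<le> (l1 ?u)\<^sup>2"
        using P_first_order[of "[]" "Z t w" ?u] by simp
      have "(\<Sum>i\<in>UNIV. ?u $ i * P [i] (Z t w)) - r * d t w = (\<Sum>i\<in>UNIV. ?e $ i * P [i] (Z t w))"
        unfolding d_def sum_distrib_left sum_subtractf[symmetric]
        by (intro sum.cong refl) (simp add: Z_def algebra_simps)
      moreover have "\<bar>\<Sum>i\<in>UNIV. ?e $ i * P [i] (Z t w)\<bar> \<le> l1 ?e * 1"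
        using bounded_P[of "[_]"] by (intro abs_sum_mult_le_l1) simp
      moreover have "l1 ?e \<le> r\<^sup>2 * L w"
      proof -
        have e: "?e = (sin (t + r) - sin t - r * cos t) *\<^sub>R V (fst w) + (cos (t + r) - cos t - r * (- sin t)) *\<^sub>R N (snd w)"
          by (simp add: vec_eq_iff)
        have "l1 ?e \<le> l1 ((sin (t + r) - sin t - r * cos t) *\<^sub>R V (fst w)) + l1 ((cos (t + r) - cos t - r * (- sin t)) *\<^sub>R N (snd w))"
          unfolding e by (rule l1_triangle)
        also have "\<dots> \<le> r\<^sup>2 * l1 (V (fst w)) + r\<^sup>2 * l1 (N (snd w))"
          unfolding l1_scaleR by (intro add_mono mult_right_mono sin_cos_increments) auto
        finally show ?thesis by (simp add: L_def distrib_left)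
      qed
      ultimately have 2: "\<bar>(\<Sum>i\<in>UNIV. ?u $ i * P [i] (Z t w)) - r * d t w\<bar> \<le> r\<^sup>2 * L w" by linarith
      have "\<bar>x - z\<bar> \<le> b + c" if "\<bar>x - y\<bar> \<le> a" "\<bar>y - z\<bar> \<le> c" "a \<le> b" for x y z a b c :: real
        using that by linarith
      from this[OF 1 2 lu] show ?thesis by (simp add: distrib_left)
    qed
    have "\<bar>\<integral>w. g (Z (t + r) w) - g (Z t w) - r * d t w \<partial>?RM\<bar> \<le> (\<integral>w. r\<^sup>2 * ((L w)\<^sup>2 + L w) \<partial>?RM)"
      by (rule abs_integral_le_integral) (use igZ id iL iL2 pt in auto)
    also have "(\<integral>w. g (Z (t + r) w) - g (Z t w) - r * d t w \<partial>?RM) = h (t + r) - h t - r * (\<integral>w. d t w \<partial>?RM)"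
      unfolding h_def using igZ id by simp
    finally show "\<bar>h (t + r) - h t - r * (\<integral>w. d t w \<partial>?RM)\<bar> \<le> (\<integral>w. (L w)\<^sup>2 + L w \<partial>?RM) * r\<^sup>2"
      by (simp add: mult.commute)
  qed
  have bound: "\<bar>\<integral>w. d t w \<partial>?RM\<bar> \<le> 2 * sin t * cos t * \<alpha>" if t: "0 \<le> t" "t \<le> pi / 2" for t
  proof -
    have sc: "0 \<le> sin t" "sin t \<le> 1" "0 \<le> cos t" using t by (auto intro: sin_ge_zero cos_ge_zero)
    let ?VP = "\<lambda>w. \<Sum>i\<in>UNIV. V (fst w) $ i * P [i] (Z t w)" and ?NP = "\<lambda>w. \<Sum>i\<in>UNIV. N (snd w) $ i * P [i] (Z t w)"
    let ?SP = "\<lambda>w. \<Sum>i\<in>UNIV. \<Sum>j\<in>UNIV. S $ i $ j * P [j, i] (Z t w)"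
    have iV: "integrable ?RM ?VP" and iN: "integrable ?RM ?NP" and iS: "integrable ?RM ?SP"
      by (intro Bochner_Integration.integrable_sum integrable_mult_right iVP iNP iP2)+
    have dsplit: "(\<integral>w. d t w \<partial>?RM) = cos t * (\<integral>w. ?VP w \<partial>?RM) - sin t * (\<integral>w. ?NP w \<partial>?RM)"
    proof -
      have "d t w = cos t * ?VP w - sin t * ?NP w" for w
        unfolding d_def by (simp only: left_diff_distrib mult.assoc sum_subtractf sum_distrib_left)
      then have "d t = (\<lambda>w. cos t * ?VP w - sin t * ?NP w)" by (rule ext)
      then show ?thesis using iV iN by (simp del: foldr.simps)
    qed
    \<comment> \<open>At a fixed Rademacher outcome, Gaussian integration by parts applies with
      shift sin t V and scale cos t. That scale matches the factor in front of the Rademacher part,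
      so cos t can be taken out of the whole derivative.\<close>
    have NP: "(\<integral>w. ?NP w \<partial>?RM) = cos t * (\<integral>w. ?SP w \<partial>?RM)"
    proof -
      have "(\<integral>w. ?NP w \<partial>?RM) = (\<integral>\<omega>. (\<integral>y. ?NP (\<omega>, y) \<partial>M) \<partial>R)" by (rule RM.integral_fst'[OF iN, symmetric])
      also have "\<dots> = (\<integral>\<omega>. cos t * (\<integral>y. ?SP (\<omega>, y) \<partial>M) \<partial>R)"
      proof (intro Bochner_Integration.integral_cong refl)
        fix \<omega>
        have m: "(\<lambda>y. P [j, i] (sin t *\<^sub>R V \<omega> + cos t *\<^sub>R N y)) \<in> borel_measurable M" for i j
          by (rule measurable_compose[OF _ Pm]) simp_all
        have i: "integrable M (\<lambda>y. P [j, i] (sin t *\<^sub>R V \<omega> + cos t *\<^sub>R N y))" for i j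
          using bounded_P[of "[j, i]"] m[of j i] by (intro G.M.integrable_const_bound[where B=1]) auto
        have "(\<integral>y. ?NP (\<omega>, y) \<partial>M)
            = cos t * (\<Sum>i\<in>UNIV. \<Sum>j\<in>UNIV. S $ i $ j * (\<integral>y. P [j, i] (sin t *\<^sub>R V \<omega> + cos t *\<^sub>R N y) \<partial>M))"
          unfolding Z_def fst_conv snd_conv by (rule G.gaussian_integration_by_parts) (rule test_function_axioms)
        also have "\<dots> = cos t * (\<integral>y. ?SP (\<omega>, y) \<partial>M)"
          unfolding Z_def fst_conv snd_conv using i by (simp del: foldr.simps)
        finally show "(\<integral>y. ?NP (\<omega>, y) \<partial>M) = cos t * (\<integral>y. ?SP (\<omega>, y) \<partial>M)" .
      qed
      also have "\<dots> = cos t * (\<integral>w. ?SP w \<partial>?RM)" using RM.integral_fst'[OF iS] by (simp del: foldr.simps)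
      finally show ?thesis .
    qed
    let ?E = "\<lambda>w. ?VP w - sin t * ?SP w"
    have iE: "integrable ?RM ?E" by (intro Bochner_Integration.integrable_diff integrable_mult_right iV iS)
    have dE: "(\<integral>w. d t w \<partial>?RM) = cos t * (\<integral>w. ?E w \<partial>?RM)"
      unfolding dsplit NP using iV iS by (simp add: algebra_simps del: foldr.simps)
    \<comment> \<open>The bound does not depend on the outcome y of N, so it survives averaging over
      y.\<close>
    have inner: "\<bar>\<integral>\<omega>. ?E (\<omega>, y) \<partial>R\<bar> \<le> 2 * sin t * \<alpha>" for y
    proof -
      have m: "(\<lambda>\<omega>. P is (sin t *\<^sub>R V \<omega> + cos t *\<^sub>R N y)) \<in> borel_measurable R" if "length is < 4" for "is"
        by (rule measurable_compose[OF _ Pm[OF that]]) simp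
      have s: "square_integrable R (\<lambda>\<omega>. P is (sin t *\<^sub>R V \<omega> + cos t *\<^sub>R N y))" if "1 \<le> length is" "length is < 4" for "is"
        using bounded_P[of "is"] m[of "is"] that by (intro square_integrable_bounded[where B=1]) auto
      have i1: "integrable R (\<lambda>\<omega>. F i \<omega> * P [i] (sin t *\<^sub>R V \<omega> + cos t *\<^sub>R N y))" for i
        by (intro integrable_mult_square_integrable square_integrable_F s) auto
      have i2: "integrable R (\<lambda>\<omega>. P [j, i] (sin t *\<^sub>R V \<omega> + cos t *\<^sub>R N y))" for i j
        by (intro square_integrable_imp_integrable s) auto
      have "(\<integral>\<omega>. ?E (\<omega>, y) \<partial>R) = (\<integral>\<omega>. (\<Sum>i\<in>UNIV. F i \<omega> * P [i] (sin t *\<^sub>R V \<omega> + cos t *\<^sub>R N y)) \<partial>R)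
         - sin t * (\<Sum>i\<in>UNIV. \<Sum>j\<in>UNIV. S $ i $ j * (\<integral>\<omega>. P [j, i] (sin t *\<^sub>R V \<omega> + cos t *\<^sub>R N y) \<partial>R))"
      proof -
        have V: "V \<omega> $ i = F i \<omega>" for \<omega> i by (simp add: V_def)
        show ?thesis unfolding Z_def fst_conv snd_conv V using i1 i2 by (simp del: foldr.simps)
      qed
      then have "ennreal \<bar>\<integral>\<omega>. ?E (\<omega>, y) \<partial>R\<bar> \<le> ennreal (2 * sin t) * ennreal \<alpha>"
        using malliavin_estimate[OF sc(1,2), of "cos t *\<^sub>R N y" S] by (simp only: \<alpha>(2))
      also have "\<dots> = ennreal (2 * sin t * \<alpha>)" using sc \<alpha>(1) by (simp add: ennreal_mult)
      finally show ?thesis using sc \<alpha>(1) by (simp add: ennreal_le_iff)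
    qed
    have "(\<integral>w. ?E w \<partial>?RM) = (\<integral>y. (\<integral>\<omega>. ?E (\<omega>, y) \<partial>R) \<partial>M)"
      using RM.integral_snd[of "\<lambda>\<omega> y. ?E (\<omega>, y)"] iE by (simp add: split_beta' del: foldr.simps)
    moreover have "\<bar>\<integral>y. (\<integral>\<omega>. ?E (\<omega>, y) \<partial>R) \<partial>M\<bar> \<le> (\<integral>y. 2 * sin t * \<alpha> \<partial>M)"
    proof (rule abs_integral_le_integral)
      show "integrable M (\<lambda>y. \<integral>\<omega>. ?E (\<omega>, y) \<partial>R)"
        using RM.integrable_snd[of "\<lambda>\<omega> y. ?E (\<omega>, y)"] iE by (simp add: split_beta' del: foldr.simps)
    qed (use inner in auto)
    ultimately have "\<bar>\<integral>w. ?E w \<partial>?RM\<bar> \<le> 2 * sin t * \<alpha>" by (simp add: G.M.prob_space del: foldr.simps)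
    then have "\<bar>cos t * (\<integral>w. ?E w \<partial>?RM)\<bar> \<le> cos t * (2 * sin t * \<alpha>)"
      unfolding abs_mult using sc(3) by (simp add: mult_left_mono del: foldr.simps)
    then show ?thesis unfolding dE by (simp only: mult_ac)
  qed
  \<comment> \<open>A primitive of the bound on the derivative is \<alpha> (sin t)^2, which grows by
    exactly \<alpha> over the interval.\<close>
  have "\<bar>h (pi/2) - h 0\<bar> \<le> \<alpha> * (sin (pi/2))\<^sup>2 - \<alpha> * (sin 0)\<^sup>2"
  proof (rule abs_DERIV_le_imp_le[where f'="\<lambda>t. \<integral>w. d t w \<partial>?RM" and g'="\<lambda>t. 2 * sin t * cos t * \<alpha>"])
    show "((\<lambda>t. \<alpha> * (sin t)\<^sup>2) has_real_derivative 2 * sin t * cos t * \<alpha>) (at t)" for t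
      by (auto intro!: derivative_eq_intros)
  qed (use deriv bound in auto)
  moreover have "h (pi/2) = (\<integral>\<omega>. g (V \<omega>) \<partial>R)" "h 0 = (\<integral>y. g (N y) \<partial>M)"
  proof -
    have i: "integrable R (\<lambda>\<omega>. g (V \<omega>))"
    proof (rule Bochner_Integration.integrable_bound)
      show "integrable R (\<lambda>\<omega>. \<bar>g 0\<bar> + l1 (V \<omega>))" using iVN by simp
      show "AE \<omega> in R. norm (g (V \<omega>)) \<le> norm (\<bar>g 0\<bar> + l1 (V \<omega>))"
      proof (intro AE_I2)
        fix \<omega> show "norm (g (V \<omega>)) \<le> norm (\<bar>g 0\<bar> + l1 (V \<omega>))" using lip[of 0 "V \<omega>"] by simp
      qed
    qed measurable
    show "h (pi/2) = (\<integral>\<omega>. g (V \<omega>) \<partial>R)" unfolding h_def Z_def using RM.integral_pair_fst[OF i] by simp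
    have i: "integrable M (\<lambda>y. g (N y))"
    proof (rule Bochner_Integration.integrable_bound)
      show "integrable M (\<lambda>y. \<bar>g 0\<bar> + l1 (N y))" using iVN by simp
      show "AE y in M. norm (g (N y)) \<le> norm (\<bar>g 0\<bar> + l1 (N y))"
      proof (intro AE_I2)
        fix y show "norm (g (N y)) \<le> norm (\<bar>g 0\<bar> + l1 (N y))" using lip[of 0 "N y"] by simp
      qed
    qed measurable
    show "h 0 = (\<integral>y. g (N y) \<partial>M)" unfolding h_def Z_def using RM.integral_pair_snd[OF i] by simp
  qed
  ultimately have "\<bar>(\<integral>\<omega>. g (V \<omega>) \<partial>R) - (\<integral>y. g (N y) \<partial>M)\<bar> \<le> \<alpha>" by simp
  then show ?thesis unfolding \<alpha>(2) by (rule ennreal_leI)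
qed (simp only: infinity_ennreal_def top_greatest)

end

theorem theorem3p1:
  fixes p q :: "nat \<Rightarrow> real"
    and F :: "'d::finite \<Rightarrow> (nat \<Rightarrow> real) \<Rightarrow> real"
    and M :: "'b measure" and N :: "'b \<Rightarrow> real ^ 'd" and S :: "real ^ 'd ^ 'd"
    and A1 A2 A3 :: ennreal
  assumes p: "\<And>k. 0 < p k" "\<And>k. p k < 1"
    and q: "\<And>k. q k = 1 - p k"
    and dom: "\<And>i. F i \<in> dom_D p"
    and centred: "\<And>i. (\<integral>\<omega>. F i \<omega> \<partial>rademacher p) = 0"
    and fourth: "\<And>i. (\<integral>\<^sup>+ \<omega>. (\<Sum>k. ennreal (\<bar>(p k * q k) powr (-1/4) * D p k (F i) \<omega>\<bar> ^ 4))
                        \<partial>rademacher p) < \<infinity>"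
    and S_sym: "transpose S = S"
    and S_psd: "\<And>x. 0 \<le> x \<bullet> (S *v x)"
    and M: "prob_space M"
    and N: "centred_gaussian_vector M N S"
    and A1: "A1 = ennreal (1/2) * (\<Sum>i\<in>UNIV. \<Sum>j\<in>UNIV. \<integral>\<^sup>+ \<omega>. ennreal
               \<bar>S $ i $ j - (\<Sum>k. D p k (F j) \<omega> * (- D p k (L_inv p (F i)) \<omega>))\<bar> \<partial>rademacher p)"
    and A2: "A2 = ennreal (1/4) * (\<integral>\<^sup>+ \<omega>. (\<Sum>k. ennreal
               (\<bar>p k - q k\<bar> / sqrt (p k * q k) * (\<Sum>j\<in>UNIV. \<bar>D p k (F j) \<omega>\<bar>)\<^sup>2
                 * (\<Sum>i\<in>UNIV. \<bar>- D p k (L_inv p (F i)) \<omega>\<bar>))) \<partial>rademacher p)"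
    and A3: "A3 = ennreal (5/24) * (\<integral>\<^sup>+ \<omega>. (\<Sum>k. ennreal
               (1 / (p k * q k) * (\<Sum>j\<in>UNIV. \<bar>D p k (F j) \<omega>\<bar>) ^ 3
                 * (\<Sum>i\<in>UNIV. \<bar>- D p k (L_inv p (F i)) \<omega>\<bar>))) \<partial>rademacher p)"
  shows "d4 (rademacher p) (\<lambda>\<omega>. \<chi> i. F i \<omega>) M N \<le> A1 + A2 + A3"
  unfolding d4_def
proof (rule SUP_least)
  fix g :: "real ^ 'd \<Rightarrow> real" assume g: "g \<in> d4_test"
  interpret RV: rademacher_vector p g F by unfold_locales (use p g dom centred in auto)
  interpret GV: gaussian_vector M N S
    by (intro gaussian_vector.intro gaussian_vector_axioms.intro M N)
  \<comment> \<open>In \<open>RV.U\<close> the minus sign sits inside the gradient, in the three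
    bounds of the statement outside it.\<close>
  have U: "D p k (RV.U i) \<omega> = - D p k (L_inv p (F i)) \<omega>" for k i \<omega>
    using RV.D_uminus[of k "L_inv p (F i)" \<omega>] by (simp add: RV.U_def[abs_def])
  have "A1 = RV.A1 S" "A2 = RV.A2" "A3 = RV.A3"
    unfolding A1 A2 A3 RV.A1_def RV.A2_def RV.A3_def RV.X_def RV.W_def U q by (rule refl)+
  then show "ennreal \<bar>(\<integral>x. g (\<chi> i. F i x) \<partial>rademacher p) - (\<integral>y. g (N y) \<partial>M)\<bar> \<le> A1 + A2 + A3"
    using RV.smart_path[OF GV.gaussian_vector_axioms] by (simp add: RV.V_def)
qed

end
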